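(* Any simple Harish-Chandra $\mathcal{S}$-module is isomorphic to one of the following $\mathcal{S}$-modules. (1) $V^{\mathcal{S}}$, where $V$ is a simple Harish-Chandra $\mathrm{Vir}$-module and $FV=0$; (2) $\mathscr{V}^\lambda\otimes V^{\mathcal{S}}$, where $\lambda\in\mathbb{C}^*$ and $V$ is a simple highest weight $\mathrm{Vir}$-module, and $\mathscr{V}^\lambda$ is considered as an $\mathcal{S}$-module; (3) the restricted dual of a module in (2).
   Context: All vector spaces and algebras are over $\mathbb{C}$; $\mathbb{Z}_+$ is the set of non-negative integers, $\mathbb{N}$ the positive integers, $\mathbb{C}^*$ the nonzero complex numbers. Modules over Lie superalgebras are $\mathbb{Z}_2$-graded, and simple means having no nonzero proper graded submodule. The Virasoro algebra is regarded as a purely even Lie superalgebra, so a simple $\mathrm{Vir}$-module is concentrated in a single parity, which may be even or odd. The Fermion-Virasoro algebra $\mathcal{S}=\mathcal{S}(0)$ is the Lie superalgebra with basis $\{L_m,\psi_n,c,z:m,n\in\mathbb{Z}\}$, where $L_m,c,z$ are even and $\psi_n$ odd, with $$[L_m,L_n]=(m-n)L_{m+n}+\delta_{m,-n}\tfrac{m^3-m}{12}c,\quad [L_m,\psi_n]=(-n-\tfrac m2)\psi_{m+n},\quad [\psi_m,\psi_n]=\delta_{m,-n}z,$$ and $c,z$ central. It contains $\mathrm{Vir}=\mathrm{span}\{c,L_i:i\in\mathbb{Z}\}$ and $F=\mathrm{span}\{z,\psi_i:i\in\mathbb{Z}\}$. A module $V$ over $\mathcal{S}$ or $\mathrm{Vir}$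 is a weight module if $V=\bigoplus_{\alpha\in\mathbb{C}}V_\alpha$ with $V_\alpha=\{v:L_0v=\alpha v\}$; it is a Harish-Chandra module if moreover all $V_\alpha$ are finite-dimensional. A weight module is a highest weight module if $\{\alpha:V_\alpha\ne0\}\subset\alpha_0+\mathbb{Z}_+$ for some $\alpha_0\in\mathbb{C}$ (note $L_m$ with $m>0$ lowers the $L_0$-eigenvalue by $m$). The restricted dual of a Harish-Chandra module $V=\bigoplus_\alpha V_\alpha$ is $\bigoplus_\alpha (V_\alpha)^*$ with the usual dual (contragredient) action of the Lie superalgebra. $\mathscr{V}$ is the exterior algebra generated by odd elements $\xi_i$, $i\in\mathbb{Z}_+$. It is an $F$-module: for $n\in\mathbb{N}$, $\psi_n$ acts as the odd derivation $\partial/\partial\xi_n$, $\psi_{-n}$ as left multiplication by $\xi_n$, $\psi_0$ as $\frac1{\sqrt2}(\xi_0+\partial/\partial\xi_0)$, $z$ as the identity. It is an $\mathcal{S}$-module with $c$ acting as $\frac12$ and $L_k$ acting as $$\bar L_k=\tfrac1{16}\delta_{k,0}+\tfrac12\sum_{j\in\mathbb{Z}}j:\psi_{-j}\psi_{j+k}:,$$ where $:\psi_j\psi_k:\,=\psi_j\psi_k$ if $k\ge j$ and $-\psi_k\psi_j$ if $k<j$. For $\mu\in\mathbb{C}^*$, $\sigma_\mu$ is the automorphism of $\mathcal{S}$ with $\sigma_\mu(L_k)=L_k$, $\sigma_\mu(\psi_l)=\mu\psi_l$, $\sigma_\mu(c)=c$, $\sigma_\mu(z)=\mu^2z$, and for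 an $\mathcal{S}$-module $W$, $W^\mu$ is the same space with action $x\cdot v=\sigma_\mu(x)v$. For a $\mathrm{Vir}$-module $V$, $V^{\mathcal{S}}$ denotes $V$ made into an $\mathcal{S}$-module by $F\cdot V=0$. Tensor products are the usual tensor products of modules over a Lie superalgebra. *)

theory Defs
  imports
    Complex_Main
    "HOL-Library.Z2"
    "HOL-Library.FSet"
    "HOL-Library.Poly_Mapping"
    "HOL-Library.Function_Algebras"
begin

section \<open>Conventions\<close>

text \<open>
  Parities are elements of the two-element field \<^typ>\<open>bit\<close>.  Free complex vector spaces are
  types of finitely supported functions \<open>'a \<Rightarrow>\<^sub>0 complex\<close>; function spaces \<open>'a \<Rightarrow> complex\<close> carry the
  pointwise structure.
\<close>

definition koszul :: "bit \<Rightarrow> complex" where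
  "koszul p = (if p = 1 then -1 else 1)"

definition pscale :: "complex \<Rightarrow> ('a \<Rightarrow>\<^sub>0 complex) \<Rightarrow> 'a \<Rightarrow>\<^sub>0 complex" where
  "pscale a f = Poly_Mapping.map ((*) a) f"

definition fscale :: "complex \<Rightarrow> ('a \<Rightarrow> complex) \<Rightarrow> 'a \<Rightarrow> complex" where
  "fscale a f = (\<lambda>x. a * f x)"

definition restrict_keys :: "'a set \<Rightarrow> ('a \<Rightarrow>\<^sub>0 complex) \<Rightarrow> 'a \<Rightarrow>\<^sub>0 complex" where
  "restrict_keys K x = (\<Sum>g \<in> Poly_Mapping.keys x \<inter> K. Poly_Mapping.single g (Poly_Mapping.lookup x g))"

definition linear_map_on ::
    "(complex \<Rightarrow> 'a::ab_group_add \<Rightarrow> 'a) \<Rightarrow> (complex \<Rightarrow> 'b::ab_group_add \<Rightarrow> 'b) \<Rightarrow> 'a set \<Rightarrow> ('a \<Rightarrow> 'b) \<Rightarrow> bool" where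
  "linear_map_on s t U f \<longleftrightarrow>
     (\<forall>u\<in>U. \<forall>v\<in>U. f (u + v) = f u + f v) \<and> (\<forall>a. \<forall>u\<in>U. f (s a u) = t a (f u))"

lemma lookup_pscale [simp]: "Poly_Mapping.lookup (pscale a f) x = a * Poly_Mapping.lookup f x"
  by (simp add: pscale_def map.rep_eq when_def)

lemma vector_space_pscale: "vector_space (pscale :: complex \<Rightarrow> ('a \<Rightarrow>\<^sub>0 complex) \<Rightarrow> _)"
  by unfold_locales (simp_all add: poly_mapping_eq_iff fun_eq_iff lookup_add algebra_simps)

lemma vector_space_fscale: "vector_space (fscale :: complex \<Rightarrow> ('a \<Rightarrow> complex) \<Rightarrow> _)"
  by unfold_locales (simp_all add: fscale_def fun_eq_iff algebra_simps)


section \<open>The Fermion-Virasoro algebra\<close>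

datatype gen = L int | Psi int | C | Z

type_synonym fv = "gen \<Rightarrow>\<^sub>0 complex"

primrec gen_parity :: "gen \<Rightarrow> bit" where
  "gen_parity (L m) = 0"
| "gen_parity (Psi n) = 1"
| "gen_parity C = 0"
| "gen_parity Z = 0"

abbreviation basis :: "gen \<Rightarrow> fv" where
  "basis g \<equiv> Poly_Mapping.single g 1"

fun gen_bracket :: "gen \<Rightarrow> gen \<Rightarrow> fv" where
  "gen_bracket (L m) (L n) =
     Poly_Mapping.single (L (m + n)) (of_int (m - n))
       + (if m = - n then Poly_Mapping.single C (of_int (m ^ 3 - m) / 12) else 0)"
| "gen_bracket (L m) (Psi n) = Poly_Mapping.single (Psi (m + n)) (- of_int n - of_int m / 2)"
| "gen_bracket (Psi n) (L m) = - Poly_Mapping.single (Psi (m + n)) (- of_int n - of_int m / 2)"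
| "gen_bracket (Psi m) (Psi n) = (if m = - n then basis Z else 0)"
| "gen_bracket _ _ = 0"

definition bracket :: "fv \<Rightarrow> fv \<Rightarrow> fv" where
  "bracket x y = (\<Sum>g\<in>Poly_Mapping.keys x. \<Sum>h\<in>Poly_Mapping.keys y. pscale (Poly_Mapping.lookup x g * Poly_Mapping.lookup y h) (gen_bracket g h))"

definition fv_grade :: "bit \<Rightarrow> fv set" where
  "fv_grade p = {x. \<forall>g\<in>Poly_Mapping.keys x. gen_parity g = p}"

definition fv_part :: "bit \<Rightarrow> fv \<Rightarrow> fv" where
  "fv_part p = restrict_keys {g. gen_parity g = p}"

definition vir_gens :: "gen set" where
  "vir_gens = insert C (range L)"

abbreviation FV :: "fv set" where
  "FV \<equiv> UNIV"

definition Vir :: "fv set" where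
  "Vir = {x. Poly_Mapping.keys x \<subseteq> vir_gens}"


section \<open>Graded modules\<close>

text \<open>
  The underlying space of a module is a subspace, namely \<open>grade 0 + grade 1\<close>, of an ambient vector
  space with addition from the type and scalar multiplication \<open>scl\<close>.  The values of \<open>act\<close>
  outside this subspace, or on elements outside the Lie superalgebra \<open>A\<close> under consideration,
  are irrelevant.  Because of the ambient space, every module of dimension at most that of a given
  module on type \<open>'v\<close> has an isomorphic copy on \<open>'v\<close>; this permits existential quantification over
  modules within that type.
\<close>

record 'v smod =
  scl :: "complex \<Rightarrow> 'v \<Rightarrow> 'v"
  grade :: "bit \<Rightarrow> 'v set"
  act :: "fv \<Rightarrow> 'v \<Rightarrow> 'v"

definition carr :: "('v::ab_group_add) smod \<Rightarrow> 'v set" where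
  "carr M = {u + v | u v. u \<in> grade M 0 \<and> v \<in> grade M 1}"

definition component :: "('v::ab_group_add) smod \<Rightarrow> bit \<Rightarrow> 'v \<Rightarrow> 'v" where
  "component M p v = (THE u. u \<in> grade M p \<and> v - u \<in> grade M (p + 1))"

text \<open>Here \<open>A\<close> is a graded subalgebra, either \<^term>\<open>FV\<close> or \<^term>\<open>Vir\<close>.\<close>

definition super_module :: "fv set \<Rightarrow> ('v::ab_group_add) smod \<Rightarrow> bool" where
  "super_module A M \<longleftrightarrow>
     vector_space (scl M) \<and>
     (\<forall>p. module.subspace (scl M) (grade M p)) \<and>
     grade M 0 \<inter> grade M 1 = {0} \<and>
     (\<forall>x\<in>A. linear_map_on (scl M) (scl M) (carr M) (act M x)) \<and>
     (\<forall>v\<in>carr M. linear_map_on pscale (scl M) A (\<lambda>x. act M x v)) \<and>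
     (\<forall>p q. \<forall>x \<in> A \<inter> fv_grade p. \<forall>v \<in> grade M q. act M x v \<in> grade M (p + q)) \<and>
     (\<forall>p q. \<forall>x \<in> A \<inter> fv_grade p. \<forall>y \<in> A \<inter> fv_grade q. \<forall>v \<in> carr M.
        act M (bracket x y) v
          = act M x (act M y v) - scl M (koszul (p * q)) (act M y (act M x v)))"

definition graded_submodule :: "fv set \<Rightarrow> ('v::ab_group_add) smod \<Rightarrow> 'v set \<Rightarrow> bool" where
  "graded_submodule A M N \<longleftrightarrow>
     module.subspace (scl M) N \<and>
     N = {u + v | u v. u \<in> N \<inter> grade M 0 \<and> v \<in> N \<inter> grade M 1} \<and>
     (\<forall>x\<in>A. \<forall>v\<in>N. act M x v \<in> N)"

definition simple_module :: "fv set \<Rightarrow> ('v::ab_group_add) smod \<Rightarrow> bool" where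
  "simple_module A M \<longleftrightarrow>
     super_module A M \<and> carr M \<noteq> {0} \<and>
     (\<forall>N. graded_submodule A M N \<longrightarrow> N = {0} \<or> N = carr M)"

text \<open>Isomorphisms preserve parity.\<close>

definition isomorphic ::
    "fv set \<Rightarrow> ('v::ab_group_add) smod \<Rightarrow> ('w::ab_group_add) smod \<Rightarrow> bool" where
  "isomorphic A M N \<longleftrightarrow>
     (\<exists>f. bij_betw f (carr M) (carr N) \<and>
        linear_map_on (scl M) (scl N) (carr M) f \<and>
        (\<forall>p. f ` grade M p \<subseteq> grade N p) \<and>
        (\<forall>x\<in>A. \<forall>v\<in>carr M. f (act M x v) = act N x (f v)))"


section \<open>Weight modules\<close>

definition weight_space :: "('v::ab_group_add) smod \<Rightarrow> complex \<Rightarrow> 'v set" where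
  "weight_space M \<alpha> = {v \<in> carr M. act M (basis (L 0)) v = scl M \<alpha> v}"

text \<open>The sum of the weight spaces, being eigenspaces of one operator, is automatically direct.\<close>

definition weight_module :: "fv set \<Rightarrow> ('v::ab_group_add) smod \<Rightarrow> bool" where
  "weight_module A M \<longleftrightarrow>
     super_module A M \<and> carr M = module.span (scl M) (\<Union>\<alpha>. weight_space M \<alpha>)"

definition harish_chandra :: "fv set \<Rightarrow> ('v::ab_group_add) smod \<Rightarrow> bool" where
  "harish_chandra A M \<longleftrightarrow>
     weight_module A M \<and>
     (\<forall>\<alpha>. \<exists>B. finite B \<and> weight_space M \<alpha> \<subseteq> module.span (scl M) B)"

definition highest_weight :: "fv set \<Rightarrow> ('v::ab_group_add) smod \<Rightarrow> bool" where
  "highest_weight A M \<longleftrightarrow>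
     weight_module A M \<and>
     (\<exists>\<alpha>\<^sub>0. {\<alpha>. weight_space M \<alpha> \<noteq> {0}} \<subseteq> {\<alpha>\<^sub>0 + of_nat n | n. True})"


section \<open>Constructions of modules\<close>

text \<open>The twist \<open>W\<^sup>\<mu>\<close> and the inflation \<open>V\<^sup>\<S>\<close>; the latter uses that \<open>F\<close> is an ideal complementary
  to the Virasoro algebra.\<close>

primrec sigma_coeff :: "complex \<Rightarrow> gen \<Rightarrow> complex" where
  "sigma_coeff \<mu> (L m) = 1"
| "sigma_coeff \<mu> (Psi n) = \<mu>"
| "sigma_coeff \<mu> C = 1"
| "sigma_coeff \<mu> Z = \<mu>\<^sup>2"

definition sigma :: "complex \<Rightarrow> fv \<Rightarrow> fv" where
  "sigma \<mu> x = (\<Sum>g\<in>Poly_Mapping.keys x. Poly_Mapping.single g (sigma_coeff \<mu> g * Poly_Mapping.lookup x g))"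

definition twist :: "complex \<Rightarrow> 'v smod \<Rightarrow> 'v smod" where
  "twist \<mu> M = \<lparr> scl = scl M, grade = grade M, act = (\<lambda>x. act M (sigma \<mu> x)) \<rparr>"

definition inflate :: "'v smod \<Rightarrow> 'v smod" where
  "inflate V = \<lparr> scl = scl V, grade = grade V, act = (\<lambda>x. act V (restrict_keys vir_gens x)) \<rparr>"

text \<open>
  The restricted dual consists of the linear forms on the module that vanish on all but finitely many
  weight spaces (extended by \<open>0\<close> outside the module).  For homogeneous \<open>x\<close> and \<open>f\<close> the action is
  \<open>(x f)(v) = - (-1)\<^bsup>|x| |f|\<^esup> f (x v)\<close>, and the component of \<open>f\<close> of parity \<open>q\<close> is the composition of \<open>f\<close>
  with the projection to the component of parity \<open>q\<close>.
\<close>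

definition restricted_forms :: "('v::ab_group_add) smod \<Rightarrow> ('v \<Rightarrow> complex) set" where
  "restricted_forms M = {f. linear_map_on (scl M) (*) (carr M) f \<and>
     (\<forall>v. v \<notin> carr M \<longrightarrow> f v = 0) \<and>
     finite {\<alpha>. \<exists>v\<in>weight_space M \<alpha>. f v \<noteq> 0}}"

definition restricted_dual :: "('v::ab_group_add) smod \<Rightarrow> ('v \<Rightarrow> complex) smod" where
  "restricted_dual M =
    \<lparr> scl = fscale,
      grade = (\<lambda>p. {f \<in> restricted_forms M. \<forall>v\<in>grade M (p + 1). f v = 0}),
      act = (\<lambda>x f v. if v \<in> carr M
        then - (\<Sum>p\<in>{0, 1}. \<Sum>q\<in>{0, 1}. koszul (p * q) * f (component M q (act M (fv_part p x) v)))
        else 0) \<rparr>"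

text \<open>
  The tensor product of \<open>M\<close> and \<open>N\<close> is realised in the dual of the space of bilinear forms, as the
  span of the evaluations \<open>m \<otimes> n : B \<mapsto> B m n\<close>.  Its universal property is
  \<open>pure_tensor_bilinear\<close> and \<open>tensor_universal\<close> below.  The action is the transpose of the
  one on bilinear forms, so that
  \<open>x (m \<otimes> n) = x m \<otimes> n + (-1)\<^bsup>|x| |m|\<^esup> m \<otimes> x n\<close> for homogeneous \<open>x\<close> and \<open>m\<close>
  (\<open>tensor_act_pure\<close>).
\<close>

type_synonym ('a, 'b) tensor = "('a \<Rightarrow> 'b \<Rightarrow> complex) \<Rightarrow> complex"

definition bilinear_on ::
    "('a::ab_group_add) smod \<Rightarrow> ('b::ab_group_add) smod \<Rightarrow> (complex \<Rightarrow> 'c::ab_group_add \<Rightarrow> 'c)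
      \<Rightarrow> ('a \<Rightarrow> 'b \<Rightarrow> 'c) \<Rightarrow> bool" where
  "bilinear_on M N s B \<longleftrightarrow>
     (\<forall>n\<in>carr N. linear_map_on (scl M) s (carr M) (\<lambda>m. B m n)) \<and>
     (\<forall>m\<in>carr M. linear_map_on (scl N) s (carr N) (B m))"

definition pure_tensor ::
    "('a::ab_group_add) smod \<Rightarrow> ('b::ab_group_add) smod \<Rightarrow> 'a \<Rightarrow> 'b \<Rightarrow> ('a, 'b) tensor" where
  "pure_tensor M N m n = (\<lambda>B. if bilinear_on M N (*) B then B m n else 0)"

definition tensor_act ::
    "('a::ab_group_add) smod \<Rightarrow> ('b::ab_group_add) smod \<Rightarrow> fv \<Rightarrow> ('a, 'b) tensor \<Rightarrow> ('a, 'b) tensor" where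
  "tensor_act M N x t = (\<lambda>B. if bilinear_on M N (*) B
     then t (\<lambda>m n. B (act M x m) n
       + (\<Sum>p\<in>{0, 1}. \<Sum>q\<in>{0, 1}. koszul (p * q) * B (component M q m) (act N (fv_part p x) n)))
     else 0)"

definition tensor_product ::
    "('a::ab_group_add) smod \<Rightarrow> ('b::ab_group_add) smod \<Rightarrow> ('a, 'b) tensor smod" where
  "tensor_product M N =
    \<lparr> scl = fscale,
      grade = (\<lambda>r. module.span fscale
        {pure_tensor M N m n | m n p q. m \<in> grade M p \<and> n \<in> grade N q \<and> p + q = r}),
      act = tensor_act M N \<rparr>"

lemma pure_tensor_bilinear: "bilinear_on M N fscale (pure_tensor M N)"
  by (auto simp: bilinear_on_def linear_map_on_def pure_tensor_def fscale_def fun_eq_iff)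

lemma tensor_universal:
  assumes s: "vector_space s" and B: "bilinear_on M N s B"
    and "\<And>i. i \<in> I \<Longrightarrow> m i \<in> carr M" "\<And>i. i \<in> I \<Longrightarrow> n i \<in> carr N"
    and sum0: "(\<Sum>i\<in>I. pure_tensor M N (m i) (n i)) = 0"
  shows "(\<Sum>i\<in>I. B (m i) (n i)) = 0"
proof (rule ccontr)
  interpret vector_space s by (fact s)
  interpret vector_space_pair s "(*)"
    by (intro vector_space_pair.intro s) (unfold_locales, simp_all add: algebra_simps)
  let ?w = "\<Sum>i\<in>I. B (m i) (n i)"
  assume "?w \<noteq> 0"
  then have "independent {?w}" by simp
  from linear_independent_extend[OF this, of "\<lambda>_. 1"]
  obtain \<phi> where lin: "Vector_Spaces.linear s (*) \<phi>" and one: "\<phi> ?w = (1::complex)" by blast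
  interpret \<phi>: Vector_Spaces.linear s "(*)" \<phi> by (fact lin)
  have bil: "bilinear_on M N (*) (\<lambda>a b. \<phi> (B a b))"
    using B by (auto simp: bilinear_on_def linear_map_on_def \<phi>.add \<phi>.scale)
  have "(\<Sum>i\<in>I. pure_tensor M N (m i) (n i)) (\<lambda>a b. \<phi> (B a b)) = (\<Sum>i\<in>I. \<phi> (B (m i) (n i)))"
    by (induction I rule: infinite_finite_induct) (simp_all add: pure_tensor_def bil)
  also have "\<dots> = 1" using one by (simp add: \<phi>.sum)
  finally show False by (simp add: sum0)
qed

lemma fv_part_homogeneous: "x \<in> fv_grade p \<Longrightarrow> fv_part q x = (if q = p then x else 0)"
proof (rule poly_mapping_eqI)
  fix k assume x: "x \<in> fv_grade p"
  show "Poly_Mapping.lookup (fv_part q x) k = Poly_Mapping.lookup (if q = p then x else 0) k"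
    using x unfolding fv_part_def restrict_keys_def fv_grade_def
    by (cases "k \<in> Poly_Mapping.keys x")
       (auto simp: lookup_sum lookup_single when_def in_keys_iff Collect_conv_if sum.delta' if_distrib cong: if_cong)
qed

lemma component_eq:
  assumes "super_module A M" "u \<in> grade M p" "v \<in> grade M (p + 1)"
  shows "component M p (u + v) = u"
proof -
  interpret vector_space "scl M" using assms by (simp add: super_module_def)
  have S: "subspace (grade M q)" for q using assms by (simp add: super_module_def)
  have ZZ: "grade M p \<inter> grade M (p + 1) = {0}" using assms by (cases p) (auto simp: super_module_def)
  show ?thesis unfolding component_def
  proof (rule the_equality)
    show "u \<in> grade M p \<and> u + v - u \<in> grade M (p + 1)" using assms by simp
  next
    fix w assume w: "w \<in> grade M p \<and> u + v - w \<in> grade M (p + 1)"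
    then have "u - w \<in> grade M p" using S assms subspace_diff by blast
    moreover have "(u + v - w) - v \<in> grade M (p + 1)" using S assms w subspace_diff by blast
    moreover have "(u + v - w) - v = u - w" by simp
    ultimately have "u - w \<in> grade M p \<inter> grade M (p + 1)" by simp
    then have "u - w \<in> {0}" unfolding ZZ .
    then show "w = u" by simp
  qed
qed

lemma carr_decomp:
  assumes "super_module A M" "v \<in> carr M"
  obtains a b where "a \<in> grade M p" "b \<in> grade M (p + 1)" "v = a + b"
  using assms(2) by (cases p) (auto simp: carr_def add.commute)

lemma sum_in_carr:
  assumes "a \<in> grade M p" "b \<in> grade M (p + 1)"
  shows "a + b \<in> carr M"
proof (cases "p = 0")
  case True
  then show ?thesis using assms by (auto simp: carr_def)
next
  case False
  then have "p = 1" by simp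
  then have "b \<in> grade M 0" "a \<in> grade M 1" "a + b = b + a" using assms by (simp_all add: add.commute)
  then show ?thesis unfolding carr_def by blast
qed

lemma grade_subset_carr:
  assumes "super_module A M" shows "grade M p \<subseteq> carr M"
proof -
  interpret vector_space "scl M" using assms by (simp add: super_module_def)
  have S: "0 \<in> grade M q" for q using assms subspace_0 by (simp add: super_module_def)
  show ?thesis using S[of 0] S[of 1] by (cases p) (force simp: carr_def)+
qed

lemma component_linear:
  assumes "super_module A M"
  shows "linear_map_on (scl M) (scl M) (carr M) (component M p)"
proof -
  interpret vector_space "scl M" using assms by (simp add: super_module_def)
  have S: "subspace (grade M q)" for q using assms by (simp add: super_module_def)
  show ?thesis unfolding linear_map_on_def
  proof (intro conjI ballI allI)
    fix u v assume "u \<in> carr M" "v \<in> carr M"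
    then obtain a b c d where *: "a \<in> grade M p" "b \<in> grade M (p + 1)" "u = a + b"
       "c \<in> grade M p" "d \<in> grade M (p + 1)" "v = c + d" using carr_decomp[OF assms] by metis
    have "component M p ((a + c) + (b + d)) = a + c"
      using * S by (intro component_eq[OF assms]) (auto intro: subspace_add)
    then show "component M p (u + v) = component M p u + component M p v"
      using * component_eq[OF assms] by (simp add: algebra_simps)
  next
    fix r u assume "u \<in> carr M"
    then obtain a b where *: "a \<in> grade M p" "b \<in> grade M (p + 1)" "u = a + b"
      using carr_decomp[OF assms] by metis
    have "component M p (scl M r a + scl M r b) = scl M r a"
      using * S by (intro component_eq[OF assms]) (auto intro: subspace_scale)
    then show "component M p (scl M r u) = scl M r (component M p u)"
      using * component_eq[OF assms] by (simp add: scale_right_distrib)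
  qed
qed

lemma act_in_carr:
  assumes "super_module FV M" "x \<in> fv_grade p" "v \<in> carr M"
  shows "act M x v \<in> carr M"
proof -
  obtain a b where *: "a \<in> grade M 0" "b \<in> grade M (0 + 1)" "v = a + b"
    using carr_decomp[OF assms(1,3)] by metis
  have "a \<in> carr M" "b \<in> carr M" using * grade_subset_carr[OF assms(1)] by blast+
  moreover have "linear_map_on (scl M) (scl M) (carr M) (act M x)"
    using assms(1) by (simp add: super_module_def)
  ultimately have "act M x v = act M x a + act M x b"
    using *(3) unfolding linear_map_on_def by blast
  moreover have "act M x a \<in> grade M (p + 0)" "act M x b \<in> grade M (p + (0 + 1))"
    using assms(1,2) *(1,2) unfolding super_module_def by blast+
  then have "act M x a + act M x b \<in> carr M" by (cases p) (auto intro: sum_in_carr sum_in_carr[of _ _ 1, simplified])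
  ultimately show ?thesis by simp
qed

lemma carr_closed:
  assumes "super_module A M" "u \<in> carr M" "v \<in> carr M"
  shows "u + v \<in> carr M" "scl M r u \<in> carr M"
proof -
  interpret vector_space "scl M" using assms by (simp add: super_module_def)
  have S: "subspace (grade M q)" for q using assms by (simp add: super_module_def)
  obtain a b where u: "a \<in> grade M 0" "b \<in> grade M (0 + 1)" "u = a + b"
    using carr_decomp[OF assms(1,2)] by metis
  obtain c d where v: "c \<in> grade M 0" "d \<in> grade M (0 + 1)" "v = c + d"
    using carr_decomp[OF assms(1,3)] by metis
  have "(a + c) + (b + d) \<in> carr M"
    by (rule sum_in_carr) (use u v S in \<open>blast intro: subspace_add\<close>)+
  then show "u + v \<in> carr M" using u v by (simp add: algebra_simps)
  have "scl M r a + scl M r b \<in> carr M"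
    by (rule sum_in_carr) (use u S in \<open>blast intro: subspace_scale\<close>)+
  then show "scl M r u \<in> carr M" using u by (simp add: scale_right_distrib)
qed

lemma tensor_act_pure:
  assumes M: "super_module FV M" and N: "super_module FV N"
    and x: "x \<in> fv_grade p" and m: "m \<in> grade M q" and n: "n \<in> carr N"
  shows "tensor_act M N x (pure_tensor M N m n) =
    pure_tensor M N (act M x m) n + fscale (koszul (p * q)) (pure_tensor M N m (act N x n))"
proof
  fix B
  interpret vm: vector_space "scl M" using M by (simp add: super_module_def)
  interpret vn: vector_space "scl N" using N by (simp add: super_module_def)
  have Sm: "vm.subspace (grade M q)" for q using M by (simp add: super_module_def)
  have S: "0 \<in> grade M r" for r using Sm vm.subspace_0 by blast
  have mc: "m \<in> carr M" using m grade_subset_carr[OF M] by blast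
  have comp: "component M r m = (if r = q then m else 0)" for r
    using component_eq[OF M, of m q 0] component_eq[OF M, of 0 "q+1" m] m S
    by (cases r; cases q) auto
  show "tensor_act M N x (pure_tensor M N m n) B =
    (pure_tensor M N (act M x m) n + fscale (koszul (p * q)) (pure_tensor M N m (act N x n))) B"
  proof (cases "bilinear_on M N (*) B")
    case False then show ?thesis by (simp add: tensor_act_def pure_tensor_def fscale_def)
  next
    case True
    have B0: "B m 0 = 0" if "m \<in> carr M" for m
    proof -
      have "0 \<in> carr N" using grade_subset_carr[OF N] N vn.subspace_0 by (auto simp: super_module_def)
      moreover have "scl N 0 0 = 0" by simp
      ultimately have "B m (scl N 0 0) = 0 * B m 0"
        using True that unfolding bilinear_on_def linear_map_on_def by blast
      then show ?thesis by simp
    qed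
    have B0': "B 0 n = 0" if "n \<in> carr N" for n
    proof -
      have "0 \<in> carr M" using grade_subset_carr[OF M] S by auto
      then have "B (scl M 0 0) n = 0 * B 0 n"
        using True that unfolding bilinear_on_def linear_map_on_def by blast
      then show ?thesis by simp
    qed
    have compc: "component M r u \<in> carr M" if u: "u \<in> carr M" for u r
    proof -
      obtain a b where "a \<in> grade M r" "b \<in> grade M (r + 1)" "u = a + b"
        using carr_decomp[OF M u] by metis
      then show ?thesis using component_eq[OF M] grade_subset_carr[OF M] by fastforce
    qed
    have lm: "linear_map_on (scl M) (scl M) (carr M) (act M x)" using M by (simp add: super_module_def)
    have ln: "linear_map_on (scl N) (scl N) (carr N) (act N x)" using N by (simp add: super_module_def)
    have homog: "(\<Sum>p'\<in>{0, 1}. \<Sum>q'\<in>{0, 1}. koszul (p' * q') * B (component M q' u) (act N (fv_part p' x) v))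
      = (\<Sum>q'\<in>{0, 1}. koszul (p * q') * B (component M q' u) (act N x v))"
      if "u \<in> carr M" "v \<in> carr N" for u v
    proof -
      have "linear_map_on pscale (scl N) FV (\<lambda>x. act N x v)" using N that by (simp add: super_module_def)
      then have "act N (pscale 0 0) v = scl N 0 (act N 0 v)" unfolding linear_map_on_def by blast
      moreover have "pscale 0 (0::fv) = 0" by (simp add: poly_mapping_eqI)
      ultimately have "act N 0 v = 0" by simp
      then show ?thesis using fv_part_homogeneous[OF x] B0 compc that by (cases p) simp_all
    qed
    have bil: "bilinear_on M N (*) (\<lambda>m n. B (act M x m) n +
      (\<Sum>p\<in>{0, 1}. \<Sum>q\<in>{0, 1}. koszul (p * q) * B (component M q m) (act N (fv_part p x) n)))"
    proof -
      let ?B = "\<lambda>m n. B (act M x m) n +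
        (\<Sum>p\<in>{0, 1}. \<Sum>q\<in>{0, 1}. koszul (p * q) * B (component M q m) (act N (fv_part p x) n))"
      have expand: "?B u v = B (act M x u) v
          + (koszul 0 * B (component M 0 u) (act N x v) + koszul p * B (component M 1 u) (act N x v))"
        if "u \<in> carr M" "v \<in> carr N" for u v
        using homog[OF that] by simp
      note cm = act_in_carr[OF M x] and cn = act_in_carr[OF N x]
      have Bl: "B (u + v) w = B u w + B v w" "B (scl M c u) w = c * B u w"
        if "u \<in> carr M" "v \<in> carr M" "w \<in> carr N" for u v w c
        using True that unfolding bilinear_on_def linear_map_on_def by blast+
      have Br: "B w (u + v) = B w u + B w v" "B w (scl N c u) = c * B w u"
        if "u \<in> carr N" "v \<in> carr N" "w \<in> carr M" for u v w c
        using True that unfolding bilinear_on_def linear_map_on_def by blast+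
      have am: "act M x (u + v) = act M x u + act M x v" "act M x (scl M c u) = scl M c (act M x u)"
        if "u \<in> carr M" "v \<in> carr M" for u v c using lm that unfolding linear_map_on_def by blast+
      have an: "act N x (u + v) = act N x u + act N x v" "act N x (scl N c u) = scl N c (act N x u)"
        if "u \<in> carr N" "v \<in> carr N" for u v c using ln that unfolding linear_map_on_def by blast+
      have co: "component M r (u + v) = component M r u + component M r v"
        "component M r (scl M c u) = scl M c (component M r u)"
        if "u \<in> carr M" "v \<in> carr M" for r u v c
        using component_linear[OF M] that unfolding linear_map_on_def by blast+
      have "?B (u + v) n = ?B u n + ?B v n" "?B (scl M c u) n = c * ?B u n"
        if h: "u \<in> carr M" "v \<in> carr M" "n \<in> carr N" for u v n c
        unfolding expand[OF carr_closed(1)[OF M h(1,2)] h(3)] expand[OF carr_closed(2)[OF M h(1,2)] h(3)]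
          expand[OF h(1,3)] expand[OF h(2,3)]
        unfolding am[OF h(1,2)] co[OF h(1,2)]
        unfolding Bl[OF cm[OF h(1)] cm[OF h(2)] h(3)] Bl[OF compc[OF h(1)] compc[OF h(2)] cn[OF h(3)]]
        by (simp_all add: algebra_simps)
      moreover have "?B m (u + v) = ?B m u + ?B m v" "?B m (scl N c u) = c * ?B m u"
        if h: "u \<in> carr N" "v \<in> carr N" "m \<in> carr M" for u v m c
        unfolding expand[OF h(3) carr_closed(1)[OF N h(1,2)]] expand[OF h(3) carr_closed(2)[OF N h(1,2)]]
          expand[OF h(3,1)] expand[OF h(3,2)]
        unfolding an[OF h(1,2)]
        unfolding Br[OF h(1,2) cm[OF h(3)]] Br[OF cn[OF h(1)] cn[OF h(2)] compc[OF h(3)]]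
        by (simp_all add: algebra_simps)
      ultimately show ?thesis unfolding bilinear_on_def linear_map_on_def by blast
    qed
    show ?thesis using True bil homog[OF mc n] B0'[OF act_in_carr[OF N x n]]
      by (cases q) (simp_all add: tensor_act_def pure_tensor_def fscale_def comp)
  qed
qed


section \<open>The exterior algebra and its Fermion-Virasoro module structure\<close>

text \<open>The basis vector of a finite set \<open>{i\<^sub>1 < \<dots> < i\<^sub>k}\<close> stands for \<open>\<xi>\<^bsub>i\<^sub>1\<^esub> \<dots> \<xi>\<^bsub>i\<^sub>k\<^esub>\<close>.\<close>

type_synonym ext = "nat fset \<Rightarrow>\<^sub>0 complex"

definition ext_mult_basis :: "nat fset \<Rightarrow> nat fset \<Rightarrow> ext" where
  "ext_mult_basis I J = (if I |\<inter>| J = {||}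
     then Poly_Mapping.single (I |\<union>| J) ((-1) ^ card {(i, j). i |\<in>| I \<and> j |\<in>| J \<and> j < i})
     else 0)"

definition ext_mult :: "ext \<Rightarrow> ext \<Rightarrow> ext" where
  "ext_mult f g = (\<Sum>I\<in>Poly_Mapping.keys f. \<Sum>J\<in>Poly_Mapping.keys g. pscale (Poly_Mapping.lookup f I * Poly_Mapping.lookup g J) (ext_mult_basis I J))"

definition xi :: "nat \<Rightarrow> ext" where
  "xi n = Poly_Mapping.single {|n|} 1"

text \<open>The odd derivation \<open>\<partial>/\<partial>\<xi>\<^sub>n\<close>; see \<open>ext_deriv_one\<close> and \<open>ext_deriv_xi_mult\<close>.\<close>

definition ext_deriv :: "nat \<Rightarrow> ext \<Rightarrow> ext" where
  "ext_deriv n f = (\<Sum>I\<in>{I \<in> Poly_Mapping.keys f. n |\<in>| I}.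
     Poly_Mapping.single (I |-| {|n|}) ((-1) ^ card {i. i |\<in>| I \<and> i < n} * Poly_Mapping.lookup f I))"

lemma linear_extension_add:
  fixes h :: "'a \<Rightarrow> 'b \<Rightarrow>\<^sub>0 complex"
  shows "(\<Sum>k\<in>Poly_Mapping.keys (f + g). pscale (Poly_Mapping.lookup (f + g) k) (h k))
    = (\<Sum>k\<in>Poly_Mapping.keys f. pscale (Poly_Mapping.lookup f k) (h k))
    + (\<Sum>k\<in>Poly_Mapping.keys g. pscale (Poly_Mapping.lookup g k) (h k))"
  by (rule setsum_keys_plus_distrib) (simp_all add: poly_mapping_eq_iff fun_eq_iff lookup_add algebra_simps)

lemma pscale_sum: "pscale a (\<Sum>k\<in>K. h k) = (\<Sum>k\<in>K. pscale a (h k))"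
  by (induction K rule: infinite_finite_induct)
     (simp_all add: poly_mapping_eq_iff fun_eq_iff lookup_add algebra_simps)

lemma pscale_simps:
  "pscale a (f + g) = pscale a f + pscale a g" "pscale a (f - g) = pscale a f - pscale a g"
  "pscale a (- f) = - pscale a f" "pscale a 0 = 0" "pscale 0 f = 0" "pscale 1 f = f"
  "pscale a (pscale b f) = pscale (a * b) f"
  "pscale a (Poly_Mapping.single k c) = Poly_Mapping.single k (a * c)"
  by (simp_all add: poly_mapping_eq_iff fun_eq_iff lookup_add lookup_minus lookup_single when_def algebra_simps)

lemma linear_extension_scale:
  fixes h :: "'a \<Rightarrow> 'b \<Rightarrow>\<^sub>0 complex"
  shows "(\<Sum>k\<in>Poly_Mapping.keys (pscale a f). pscale (Poly_Mapping.lookup (pscale a f) k) (h k))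
    = pscale a (\<Sum>k\<in>Poly_Mapping.keys f. pscale (Poly_Mapping.lookup f k) (h k))"
proof (cases "a = 0")
  case False
  then have "Poly_Mapping.keys (pscale a f) = Poly_Mapping.keys f" by (auto simp: in_keys_iff)
  then show ?thesis by (simp add: pscale_sum pscale_simps)
qed (simp add: pscale_simps)

lemma linear_extension_unique:
  fixes T :: "('a \<Rightarrow>\<^sub>0 complex) \<Rightarrow> 'b \<Rightarrow>\<^sub>0 complex"
  assumes "\<And>f g. T (f + g) = T f + T g" "\<And>a f. T (pscale a f) = pscale a (T f)"
  shows "T f = (\<Sum>k\<in>Poly_Mapping.keys f. pscale (Poly_Mapping.lookup f k) (T (Poly_Mapping.single k 1)))"
proof -
  have "T (pscale 0 0) = pscale 0 (T 0)" by (rule assms)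
  then have T0: "T 0 = 0" by (simp add: pscale_simps)
  have *: "T (\<Sum>k\<in>K. h k) = (\<Sum>k\<in>K. T (h k))" for K and h :: "'a \<Rightarrow> _"
    by (induction K rule: infinite_finite_induct) (simp_all add: T0 assms)
  have "f = (\<Sum>k\<in>Poly_Mapping.keys f. pscale (Poly_Mapping.lookup f k) (Poly_Mapping.single k 1))"
    by (rule poly_mapping_eqI)
       (auto simp: lookup_sum lookup_single when_def in_keys_iff if_distrib cong: if_cong)
  then have "T f = T (\<Sum>k\<in>Poly_Mapping.keys f. pscale (Poly_Mapping.lookup f k) (Poly_Mapping.single k 1))"
    by simp
  then show ?thesis by (simp only: * assms)
qed

lemma xi_mult_expand: "ext_mult (xi m) f =
   (\<Sum>J\<in>Poly_Mapping.keys f. pscale (Poly_Mapping.lookup f J) (ext_mult_basis {|m|} J))"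
  by (simp add: ext_mult_def xi_def)

lemma ext_deriv_expand: "ext_deriv n f =
   (\<Sum>I\<in>Poly_Mapping.keys f. pscale (Poly_Mapping.lookup f I)
      (if n |\<in>| I then Poly_Mapping.single (I |-| {|n|}) ((-1) ^ card {i. i |\<in>| I \<and> i < n}) else 0))"
  unfolding ext_deriv_def
  by (rule sum.mono_neutral_cong_left) (auto simp: pscale_simps mult.commute)

lemma xi_mult_linear:
  "ext_mult (xi m) (f + g) = ext_mult (xi m) f + ext_mult (xi m) g"
  "ext_mult (xi m) (pscale a f) = pscale a (ext_mult (xi m) f)"
  unfolding xi_mult_expand by (rule linear_extension_add linear_extension_scale)+

lemma ext_deriv_linear:
  "ext_deriv m (f + g) = ext_deriv m f + ext_deriv m g"
  "ext_deriv m (pscale a f) = pscale a (ext_deriv m f)"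
  unfolding ext_deriv_expand by (rule linear_extension_add linear_extension_scale)+

lemma xi_mult_single: "ext_mult (xi m) (Poly_Mapping.single I a) =
   (if m |\<in>| I then 0 else Poly_Mapping.single (finsert m I) ((-1) ^ card {i. i |\<in>| I \<and> i < m} * a))"
proof -
  have "{(i, j). i = m \<and> j |\<in>| I \<and> j < i} = Pair m ` {i. i |\<in>| I \<and> i < m}" by auto
  then have "card {(i, j). i = m \<and> j |\<in>| I \<and> j < i} = card {i. i |\<in>| I \<and> i < m}"
    by (simp add: card_image inj_on_def)
  then show ?thesis
    by (cases "a = 0") (auto simp: xi_mult_expand ext_mult_basis_def pscale_simps mult.commute)
qed

lemma ext_deriv_single: "ext_deriv m (Poly_Mapping.single I a) =
   (if m |\<in>| I then Poly_Mapping.single (I |-| {|m|}) ((-1) ^ card {i. i |\<in>| I \<and> i < m} * a) else 0)"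
  by (cases "a = 0") (auto simp: ext_deriv_expand pscale_simps mult.commute)

lemma ext_zero [simp]: "ext_mult (xi m) 0 = 0" "ext_deriv m 0 = 0"
  by (simp_all add: xi_mult_expand ext_deriv_expand)

lemma card_finsert_less: 
  "m |\<notin>| I \<Longrightarrow> card {i. (i = m \<or> i |\<in>| I) \<and> i < n} = card {i. i |\<in>| I \<and> i < n} + (if m < n then 1 else 0)"
proof -
  assume a: "m |\<notin>| I"
  have f: "finite {i. i |\<in>| I \<and> i < n}" by simp
  have "{i. (i = m \<or> i |\<in>| I) \<and> i < n} = (if m < n then insert m {i. i |\<in>| I \<and> i < n} else {i. i |\<in>| I \<and> i < n})"
    by auto
  then show ?thesis using a f by simp
qed

lemma ext_deriv_one: "ext_deriv n (Poly_Mapping.single {||} 1) = 0"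
  by (simp add: ext_deriv_single)

lemma ext_deriv_xi_mult:
  "ext_deriv n (ext_mult (xi m) f) = (if n = m then f else 0) - ext_mult (xi m) (ext_deriv n f)"
proof -
  have main: "ext_deriv n (ext_mult (xi m) (Poly_Mapping.single I 1)) + ext_mult (xi m) (ext_deriv n (Poly_Mapping.single I 1))
    = (if n = m then Poly_Mapping.single I 1 else 0)" for I
  proof (cases "n |\<in>| I")
    case False
    then show ?thesis
      by (auto simp: xi_mult_single ext_deriv_single card_finsert_less simp flip: power_add mult_2)
  next
    case True
    then obtain J where J: "I = finsert n J" "n |\<notin>| J" by (metis mk_disjoint_finsert)
    show ?thesis
    proof (cases "m |\<in>| J")
      case True
      then show ?thesis using J by (auto simp: xi_mult_single ext_deriv_single card_finsert_less)
    next
      case False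
      have c: "finsert m (finsert n J) |-| {|n|} = finsert m J" if "m \<noteq> n" using that J by auto
      have cc: "card {i. (i = m \<or> i = n \<or> i |\<in>| J) \<and> i < n} = card {i. i |\<in>| J \<and> i < n} + (if m < n then 1 else 0)"
        if "m \<noteq> n"
        using card_finsert_less[of m "finsert n J" n] card_finsert_less[of n J n] that J False by simp
      show ?thesis using J False c cc
        by (cases m n rule: linorder_cases)
           (simp_all add: xi_mult_single ext_deriv_single card_finsert_less finsert_commute add.commute flip: single_add single_diff power_add mult_2)
    qed
  qed
  let ?T = "\<lambda>f. ext_deriv n (ext_mult (xi m) f) + ext_mult (xi m) (ext_deriv n f)"
  let ?S = "\<lambda>f. if n = m then f else (0::ext)"
  have "?T f = ?S f"
    by (subst linear_extension_unique[of ?T], simp add: xi_mult_linear ext_deriv_linear,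
        simp add: xi_mult_linear ext_deriv_linear pscale_simps,
        subst linear_extension_unique[of ?S], simp, simp add: pscale_simps, simp only: main)
  then show ?thesis by (simp add: algebra_simps)
qed

definition psi_op :: "int \<Rightarrow> ext \<Rightarrow> ext" where
  "psi_op n f =
    (if n > 0 then ext_deriv (nat n) f
     else if n < 0 then ext_mult (xi (nat (- n))) f
     else pscale (1 / of_real (sqrt 2)) (ext_mult (xi 0) f + ext_deriv 0 f))"

definition normal_ordered :: "int \<Rightarrow> int \<Rightarrow> ext \<Rightarrow> ext" where
  "normal_ordered j k f = (if k \<ge> j then psi_op j (psi_op k f) else - psi_op k (psi_op j f))"

text \<open>On each vector only finitely many summands are nonzero, so that \<^const>\<open>Sum_any\<close> is a genuine
  finite sum.\<close>

definition Lbar :: "int \<Rightarrow> ext \<Rightarrow> ext" where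
  "Lbar k f = pscale (if k = 0 then 1 / 16 else 0) f
     + pscale (1 / 2) (Sum_any (\<lambda>j. pscale (of_int j) (normal_ordered (- j) (j + k) f)))"

primrec fock_op :: "gen \<Rightarrow> ext \<Rightarrow> ext" where
  "fock_op (L k) = Lbar k"
| "fock_op (Psi n) = psi_op n"
| "fock_op C = pscale (1 / 2)"
| "fock_op Z = (\<lambda>f. f)"

definition fock :: "ext smod" where
  "fock =
    \<lparr> scl = pscale,
      grade = (\<lambda>p. {f. \<forall>I\<in>Poly_Mapping.keys f. of_nat (fcard I) = p}),
      act = (\<lambda>x f. \<Sum>g\<in>Poly_Mapping.keys x. pscale (Poly_Mapping.lookup x g) (fock_op g f)) \<rparr>"

end

theory Submission
  imports Defs "HOL-Computational_Algebra.Fundamental_Theorem_Algebra"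
begin

text \<open>
  The element \<open>z\<close> acts on a simple Harish-Chandra module by a scalar \<open>\<zeta>\<close>.

  If \<open>\<zeta> = 0\<close>, then every element \<open>u \<psi>\<^sub>n\<close> with \<open>u\<close> in the enveloping algebra is nilpotent, so that
  \<open>w = u \<psi>\<^sub>n w\<close> is impossible for \<open>w \<noteq> 0\<close>; as \<open>\<psi>\<^sub>n w \<noteq> 0\<close> would generate the simple module, \<open>F\<close> acts by zero.

  If \<open>\<zeta> \<noteq> 0\<close>, the operators \<open>\<psi>\<^bsub>-n\<^esub> \<psi>\<^sub>n / \<zeta>\<close> are commuting idempotents on each weight space.  A weight vector
  on which infinitely many sign changes of these idempotents occur would yield infinitely many
  independent vectors of the next weight.  So there is a nonzero vector killed by almost all \<open>\<psi>\<^sub>n\<close>, \<open>n > 0\<close>, or by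
  almost all \<open>\<psi>\<^bsub>-n\<^esub>\<close>, \<open>n > 0\<close>.  In the first case the module is the tensor product of the Fock
  module and the space \<open>V\<close> of even vacuum vectors, on which \<open>L\<^sub>k\<close> minus its Sugawara part acts; finite
  dimension of the weight spaces forces the weights of \<open>V\<close> to be bounded below.  The second case is dual to the first.
\<close>

section \<open>Modules given on generators\<close>

text \<open>The theorem asks for \<open>V\<close> on the type of \<open>W\<close>, so everything
  stays inside \<open>W\<close>: \<open>V\<close> is a subspace of \<open>W\<close>, and the
  contragredient module is carried by \<open>W\<close> itself. The twist is dictated by z. On
  \<open>twist l fock\<close> it acts as l^2, so l is a square root of \<zeta>, and of -\<zeta> for
  the contragredient module, because transposing an even central element brings in a sign. Only even
  vacuum vectors enter \<open>V\<close>. Since psi_0 is odd, preserves the vacuum condition and has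
  square \<zeta>/2, it exchanges even and odd vacuum vectors; the odd ones are recovered from
  \<open>xi 0\<close> in the Fock factor. The constants 1/2 and 1/16 by which c and L_0 on
  \<open>V\<close> differ from those on \<open>W\<close> are the central charge and the lowest
  weight of the Fock module. For the sign changes, the infinite family of idempotents is never
  diagonalised. Finitely many of them are fixed at a time, which gives vectors of one weight with
  any prescribed number of sign changes, and the dimension of a single weight space bounds that
  number.\<close>

definition gact :: "'v smod \<Rightarrow> gen \<Rightarrow> 'v \<Rightarrow> 'v" where
  "gact M g = act M (basis g)"

text \<open>A common form for \<open>FV\<close> and \<open>Vir\<close>, so that expansions in
  generators and the construction of modules are treated once for both.\<close>

definition span_of_gens :: "gen set \<Rightarrow> fv set" where
  "span_of_gens \<Gamma> = {x. Poly_Mapping.keys x \<subseteq> \<Gamma>}"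

lemma FV_eq: "FV = span_of_gens UNIV" and Vir_eq: "Vir = span_of_gens vir_gens"
  by (auto simp: span_of_gens_def Vir_def)

lemma linear_map_on_sum:
  assumes "vector_space s" "vector_space t" "module.subspace s U" "linear_map_on s t U f" "\<And>i. i \<in> I \<Longrightarrow> v i \<in> U"
  shows "f (\<Sum>i\<in>I. v i) = (\<Sum>i\<in>I. f (v i))"
proof -
  interpret s: vector_space s by fact
  interpret t: vector_space t by fact
  have 0: "f 0 = 0"
  proof -
    have "f (s 0 0) = t 0 (f 0)"
      using assms(4) s.subspace_0[OF assms(3)] unfolding linear_map_on_def by blast
    then show ?thesis by simp
  qed
  show ?thesis using assms(5)
  proof (induction I rule: infinite_finite_induct)
    case (insert i I)
    then have "(\<Sum>i\<in>I. v i) \<in> U" by (intro s.subspace_sum[OF assms(3)]) auto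
    then show ?case using insert assms(4) by (simp add: linear_map_on_def)
  qed (simp_all add: 0)
qed

lemma subspace_span_of_gens: "module.subspace pscale (span_of_gens \<Gamma>)"
proof -
  interpret vector_space "pscale :: complex \<Rightarrow> fv \<Rightarrow> fv" by (rule vector_space_pscale)
  show ?thesis
    unfolding subspace_def span_of_gens_def
  proof (intro conjI ballI allI)
    fix x y :: fv assume "x \<in> {x. Poly_Mapping.keys x \<subseteq> \<Gamma>}" "y \<in> {x. Poly_Mapping.keys x \<subseteq> \<Gamma>}"
    then show "x + y \<in> {x. Poly_Mapping.keys x \<subseteq> \<Gamma>}" using Poly_Mapping.keys_add[of x y] by blast
  next
    fix c and x :: fv assume "x \<in> {x. Poly_Mapping.keys x \<subseteq> \<Gamma>}"
    then show "pscale c x \<in> {x. Poly_Mapping.keys x \<subseteq> \<Gamma>}" by (auto simp: in_keys_iff)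
  qed simp
qed

lemma poly_mapping_expand: "f = (\<Sum>k\<in>Poly_Mapping.keys f. pscale (Poly_Mapping.lookup f k) (Poly_Mapping.single k 1))"
  by (rule poly_mapping_eqI)
     (auto simp: lookup_sum lookup_single when_def in_keys_iff if_distrib cong: if_cong)

lemma subspace_carr:
  assumes "super_module A M" shows "module.subspace (scl M) (carr M)"
proof -
  interpret vector_space "scl M" using assms by (simp add: super_module_def)
  have "0 \<in> grade M 0" using assms subspace_0 by (simp add: super_module_def)
  then have "0 \<in> carr M" using grade_subset_carr[OF assms] by blast
  then show ?thesis unfolding subspace_def using carr_closed[OF assms] by blast
qed

lemma act_expand:
  assumes M: "super_module (span_of_gens \<Gamma>) M" and v: "v \<in> carr M" and x: "x \<in> span_of_gens \<Gamma>"
  shows "act M x v = (\<Sum>g\<in>Poly_Mapping.keys x. scl M (Poly_Mapping.lookup x g) (gact M g v))"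
proof -
  interpret vector_space "scl M" using M by (simp add: super_module_def)
  have lin: "linear_map_on pscale (scl M) (span_of_gens \<Gamma>) (\<lambda>x. act M x v)"
    using M v by (simp add: super_module_def)
  have gens: "basis g \<in> span_of_gens \<Gamma>" "pscale (Poly_Mapping.lookup x g) (basis g) \<in> span_of_gens \<Gamma>"
    if "g \<in> Poly_Mapping.keys x" for g
  proof -
    interpret pm: vector_space "pscale :: complex \<Rightarrow> fv \<Rightarrow> fv" by (rule vector_space_pscale)
    show "basis g \<in> span_of_gens \<Gamma>" using that x by (auto simp: span_of_gens_def)
    then show "pscale (Poly_Mapping.lookup x g) (basis g) \<in> span_of_gens \<Gamma>"
      by (intro pm.subspace_scale[OF subspace_span_of_gens])
  qed
  have "act M x v = act M (\<Sum>g\<in>Poly_Mapping.keys x. pscale (Poly_Mapping.lookup x g) (basis g)) v"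
    using poly_mapping_expand[of x] by simp
  also have "\<dots> = (\<Sum>g\<in>Poly_Mapping.keys x. act M (pscale (Poly_Mapping.lookup x g) (basis g)) v)"
    by (rule linear_map_on_sum[OF vector_space_pscale vector_space_axioms subspace_span_of_gens lin]) (rule gens(2))
  also have "\<dots> = (\<Sum>g\<in>Poly_Mapping.keys x. scl M (Poly_Mapping.lookup x g) (gact M g v))"
    using lin gens(1) by (intro sum.cong) (simp_all add: linear_map_on_def gact_def)
  finally show ?thesis .
qed

definition gen_act :: "(complex \<Rightarrow> 'v::ab_group_add \<Rightarrow> 'v) \<Rightarrow> (gen \<Rightarrow> 'v \<Rightarrow> 'v) \<Rightarrow> fv \<Rightarrow> 'v \<Rightarrow> 'v" where
  "gen_act s T x v = (\<Sum>g\<in>Poly_Mapping.keys x. s (Poly_Mapping.lookup x g) (T g v))"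

lemma gen_act_linear:
  assumes "vector_space s"
  shows "gen_act s T (x + y) v = gen_act s T x v + gen_act s T y v"
    "gen_act s T (pscale a x) v = s a (gen_act s T x v)"
    "gen_act s T 0 v = 0" "gen_act s T (- x) v = - gen_act s T x v"
    "gen_act s T (Poly_Mapping.single g a) v = s a (T g v)"
proof -
  interpret vector_space s by fact
  show add: "gen_act s T (x + y) v = gen_act s T x v + gen_act s T y v" for x y
    unfolding gen_act_def by (rule setsum_keys_plus_distrib) (simp_all add: scale_left_distrib)
  show sc: "gen_act s T (pscale a x) v = s a (gen_act s T x v)" for a x
  proof (cases "a = 0")
    case False
    then have "Poly_Mapping.keys (pscale a x) = Poly_Mapping.keys x" by (auto simp: in_keys_iff)
    then show ?thesis by (simp add: gen_act_def scale_sum_right)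
  qed (simp add: gen_act_def pscale_simps)
  show "gen_act s T 0 v = 0" by (simp add: gen_act_def)
  show "gen_act s T (- x) v = - gen_act s T x v"
  proof -
    have "pscale (- 1) x = - x" by (rule poly_mapping_eqI) simp
    then show ?thesis using sc[of "-1" x] by simp
  qed
  show "gen_act s T (Poly_Mapping.single g a) v = s a (T g v)"
    by (cases "a = 0") (simp_all add: gen_act_def)
qed

lemma gen_act_sum:
  assumes "vector_space s"
  shows "gen_act s T (\<Sum>i\<in>I. x i) v = (\<Sum>i\<in>I. gen_act s T (x i) v)"
  by (induction I rule: infinite_finite_induct) (simp_all add: gen_act_linear[OF assms])

text \<open>Both sides of the bracket relation are bilinear in the two Lie algebra elements, and all
  generators occurring in a homogeneous element have its parity, so the Koszul sign is constant over
  the double sum. Hence it suffices to check pairs of generators.\<close>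

lemma super_module_gen_act:
  fixes s :: "complex \<Rightarrow> 'v::ab_group_add \<Rightarrow> 'v"
  defines "M \<equiv> \<lambda>G T. \<lparr> scl = s, grade = G, act = gen_act s T \<rparr>"
  assumes vs: "vector_space s"
    and sub: "\<And>p. module.subspace s (G p)" and inter: "G 0 \<inter> G 1 = {0}"
    and lin: "\<And>g. g \<in> \<Gamma> \<Longrightarrow> linear_map_on s s (carr (M G T)) (T g)"
    and deg: "\<And>g q v. g \<in> \<Gamma> \<Longrightarrow> v \<in> G q \<Longrightarrow> T g v \<in> G (gen_parity g + q)"
    and rel: "\<And>g h v. g \<in> \<Gamma> \<Longrightarrow> h \<in> \<Gamma> \<Longrightarrow> v \<in> carr (M G T) \<Longrightarrow>
      gen_act s T (gen_bracket g h) v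
        = T g (T h v) - s (koszul (gen_parity g * gen_parity h)) (T h (T g v))"
  shows "super_module (span_of_gens \<Gamma>) (M G T)"
proof -
  interpret vector_space s by fact
  let ?H = "carr (M G T)"
  note ga = gen_act_linear[OF vs]
  have Hdef: "?H = {u + v |u v. u \<in> G 0 \<and> v \<in> G 1}" by (simp add: carr_def M_def)
  have TH: "T g v \<in> ?H" if g: "g \<in> \<Gamma>" and v: "v \<in> ?H" for g v
  proof -
    obtain a b where ab: "v = a + b" "a \<in> G 0" "b \<in> G 1" using v Hdef by blast
    have G0: "0 \<in> G p" for p using sub subspace_0 by blast
    have "a \<in> ?H" "b \<in> ?H" unfolding Hdef using ab G0[of 0] G0[of 1] by force+
    then have "T g v = T g a + T g b" using lin[OF g] ab(1) unfolding linear_map_on_def by blast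
    moreover have "T g a \<in> G (gen_parity g)" "T g b \<in> G (gen_parity g + 1)"
      using deg[OF g, of a 0] deg[OF g, of b 1] ab(2,3) by (simp_all only: add_0_right)
    ultimately show ?thesis unfolding Hdef by (cases "gen_parity g") (auto, metis add.commute)
  qed
  have Hsub: "subspace ?H" unfolding Hdef using subspace_sums[OF sub sub] .
  have tadd: "T g (v + w) = T g v + T g w" if "g \<in> \<Gamma>" "v \<in> ?H" "w \<in> ?H" for g v w
    using lin[OF that(1)] that(2,3) unfolding linear_map_on_def by blast
  have tscale: "T g (s a v) = s a (T g v)" if "g \<in> \<Gamma>" "v \<in> ?H" for g v a
    using lin[OF that(1)] that(2) unfolding linear_map_on_def by blast
  note tlin = tadd tscale
  have glin: "linear_map_on s s ?H (gen_act s T x)" if x: "x \<in> span_of_gens \<Gamma>" for x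
    unfolding linear_map_on_def
  proof (intro conjI ballI allI)
    fix u v assume "u \<in> ?H" "v \<in> ?H"
    then show "gen_act s T x (u + v) = gen_act s T x u + gen_act s T x v"
      unfolding gen_act_def sum.distrib[symmetric] using x
      by (intro sum.cong) (auto simp: span_of_gens_def tlin scale_right_distrib)
  next
    fix a u assume "u \<in> ?H"
    then show "gen_act s T x (s a u) = s a (gen_act s T x u)"
      unfolding gen_act_def scale_sum_right using x
      by (intro sum.cong) (auto simp: span_of_gens_def tlin mult.commute)
  qed
  have gdeg: "gen_act s T x v \<in> G (p + q)"
    if "x \<in> span_of_gens \<Gamma>" "x \<in> fv_grade p" "v \<in> G q" for x p q v
    unfolding gen_act_def
  proof (intro subspace_sum[OF sub] subspace_scale[OF sub])
    fix g assume "g \<in> Poly_Mapping.keys x"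
    then show "T g v \<in> G (p + q)" using that deg[of g v q] by (auto simp: span_of_gens_def fv_grade_def)
  qed
  have Tsum: "T g (\<Sum>i\<in>I. s (c i) (v i)) = (\<Sum>i\<in>I. s (c i) (T g (v i)))"
    if "g \<in> \<Gamma>" "\<And>i. i \<in> I \<Longrightarrow> v i \<in> ?H" for g I c and v :: "gen \<Rightarrow> 'v"
  proof -
    have "T g (\<Sum>i\<in>I. s (c i) (v i)) = (\<Sum>i\<in>I. T g (s (c i) (v i)))"
      using that by (intro linear_map_on_sum[OF vs vs Hsub lin]) (auto intro: subspace_scale[OF Hsub])
    then show ?thesis using tlin that by simp
  qed
  have comp: "gen_act s T x (gen_act s T y v) =
      (\<Sum>g\<in>Poly_Mapping.keys x. \<Sum>h\<in>Poly_Mapping.keys y. s (Poly_Mapping.lookup x g * Poly_Mapping.lookup y h) (T g (T h v)))"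
    if x: "x \<in> span_of_gens \<Gamma>" and y: "y \<in> span_of_gens \<Gamma>" and v: "v \<in> ?H" for x y v
    unfolding gen_act_def[of s T x]
  proof (rule sum.cong[OF refl])
    fix g assume "g \<in> Poly_Mapping.keys x"
    then have g: "g \<in> \<Gamma>" using x by (auto simp: span_of_gens_def)
    have "T g (gen_act s T y v) = (\<Sum>h\<in>Poly_Mapping.keys y. s (Poly_Mapping.lookup y h) (T g (T h v)))"
      unfolding gen_act_def using y v by (intro Tsum g TH) (auto simp: span_of_gens_def)
    then show "s (Poly_Mapping.lookup x g) (T g (gen_act s T y v)) =
      (\<Sum>h\<in>Poly_Mapping.keys y. s (Poly_Mapping.lookup x g * Poly_Mapping.lookup y h) (T g (T h v)))"
      by (simp add: scale_sum_right)
  qed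
  have br: "gen_act s T (bracket x y) v = gen_act s T x (gen_act s T y v)
        - s (koszul (p * q)) (gen_act s T y (gen_act s T x v))"
    if x: "x \<in> span_of_gens \<Gamma>" "x \<in> fv_grade p" and y: "y \<in> span_of_gens \<Gamma>" "y \<in> fv_grade q"
      and v: "v \<in> ?H" for x y p q v
  proof -
    let ?c = "\<lambda>g h. Poly_Mapping.lookup x g * Poly_Mapping.lookup y h"
    have "gen_act s T (bracket x y) v
        = (\<Sum>g\<in>Poly_Mapping.keys x. \<Sum>h\<in>Poly_Mapping.keys y. s (?c g h) (gen_act s T (gen_bracket g h) v))"
      by (simp add: bracket_def gen_act_sum[OF vs] ga)
    also have "\<dots> = (\<Sum>g\<in>Poly_Mapping.keys x. \<Sum>h\<in>Poly_Mapping.keys y.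
        s (?c g h) (T g (T h v)) - s (koszul (p * q)) (s (?c g h) (T h (T g v))))"
    proof (intro sum.cong refl)
      fix g h assume gh: "g \<in> Poly_Mapping.keys x" "h \<in> Poly_Mapping.keys y"
      then have "g \<in> \<Gamma>" "h \<in> \<Gamma>" "gen_parity g = p" "gen_parity h = q"
        using x y by (auto simp: span_of_gens_def fv_grade_def)
      then show "s (?c g h) (gen_act s T (gen_bracket g h) v)
        = s (?c g h) (T g (T h v)) - s (koszul (p * q)) (s (?c g h) (T h (T g v)))"
        using rel[OF _ _ v, of g h] by (simp add: scale_right_diff_distrib mult_ac)
    qed
    also have "\<dots> = gen_act s T x (gen_act s T y v) - s (koszul (p * q)) (gen_act s T y (gen_act s T x v))"
      unfolding comp[OF x(1) y(1) v] comp[OF y(1) x(1) v]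
      \<comment> \<open>In the second product the two sums stand in the opposite order.\<close>
      by (subst (3) sum.swap) (simp add: sum_subtractf scale_sum_right mult_ac)
    finally show ?thesis .
  qed
  show ?thesis
    unfolding super_module_def
    using vs sub inter glin gdeg br
    by (auto simp: M_def ga linear_map_on_def)
qed

lemma super_module_sub:
  assumes "super_module FV M" shows "super_module A M"
  using assms unfolding super_module_def linear_map_on_def by simp

text \<open>The iterates of \<open>w\<close> under \<open>T\<close> lie in a finite-dimensional
  space, so a nonzero polynomial in \<open>T\<close> kills \<open>w\<close>. Split off one root at a
  time by the fundamental theorem of algebra; the last value that is still nonzero is an
  eigenvector.\<close>

lemma exists_eigenvector:
  assumes "vector_space s" "module.subspace s X" "w \<in> X" "w \<noteq> 0" "finite B" "X \<subseteq> module.span s B"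
    and lin: "linear_map_on s s X T" and TX: "\<And>v. v \<in> X \<Longrightarrow> T v \<in> X"
  obtains a v where "v \<in> X" "v \<noteq> 0" "T v = s a v"
proof -
  interpret vector_space s by fact
  note X = assms(2)
  have T: "T (u + v) = T u + T v" if "u \<in> X" "v \<in> X" for u v
    using lin that unfolding linear_map_on_def by blast
  have Ts: "T (s a u) = s a (T u)" if "u \<in> X" for u a
    using lin that unfolding linear_map_on_def by blast
  have T0: "T 0 = 0" using Ts[of 0 0] subspace_0[OF X] by simp
  \<comment> \<open>The value p(T) v, by Horner's scheme.\<close>
  define ev where "ev p v = fold_coeffs (\<lambda>a u. s a v + T u) p 0" for p :: "complex poly" and v
  have ev0: "ev 0 v = 0" for v by (simp add: ev_def)
  have evC: "ev (pCons a p) v = s a v + T (ev p v)" for a p v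
    by (cases "p = 0 \<and> a = 0") (auto simp: ev_def T0)
  have evX: "ev p v \<in> X" if "v \<in> X" for p v
    by (induction p) (auto simp: ev0 evC intro!: subspace_add subspace_scale X TX that subspace_0)
  have ev_add: "ev (p + q) v = ev p v + ev q v" if "v \<in> X" for p q v
    by (induction p q rule: poly_induct2) (simp_all add: ev0 evC T Ts evX that scale_left_distrib)
  have ev_smult: "ev (smult c p) v = s c (ev p v)" if "v \<in> X" for c p v
    by (induction p) (simp_all add: ev0 evC T Ts evX that scale_right_distrib)
  have ev_T: "T (ev p v) = ev p (T v)" if "v \<in> X" for p v
    by (induction p) (simp_all add: ev0 evC T0 T Ts evX that TX subspace_scale[OF X])
  have main: "\<exists>a v. v \<in> X \<and> v \<noteq> 0 \<and> T v = s a v" if "degree p = n" "p \<noteq> 0" "v \<in> X" "v \<noteq> 0" "ev p v = 0" for n p v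
    using that
  proof (induction n arbitrary: p)
    case 0
    then obtain c where "p = [:c:]" by (metis degree_eq_zeroE)
    then show ?case using 0 by (simp add: evC ev0 T0)
  next
    case (Suc n)
    then have "\<not> constant (poly p)" by (simp add: constant_degree)
    then obtain a where "poly p a = 0" using fundamental_theorem_of_algebra by blast
    then obtain q where q: "p = [:- a, 1:] * q" by (metis dvdE poly_eq_0_iff_dvd)
    then have "q \<noteq> 0" using Suc by auto
    then have dq: "degree q = n" using Suc q by (simp add: degree_mult_eq del: mult_pCons_left)
    have "p = smult (- a) q + pCons 0 q" using q by simp
    then have "ev p v = T (ev q v) - s a (ev q v)"
      by (simp only: ev_add[OF Suc.prems(3)] ev_smult[OF Suc.prems(3)] evC) simp
    \<comment> \<open>Either \<open>ev q v\<close> is an eigenvector for the root \<open>a\<close>,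
      or it is zero and \<open>q\<close> has smaller degree.\<close>
    then show ?case using Suc dq \<open>q \<noteq> 0\<close> evX[OF Suc.prems(3), of q]
      by (cases "ev q v = 0") auto
  qed
  define f where "f i = (T ^^ i) w" for i
  have fX: "f i \<in> X" for i by (induction i) (auto simp: f_def assms(3) TX)
  have ev_monom: "ev (monom c i) w = s c (f i)" for c i
    by (induction i) (simp_all add: monom_0 monom_Suc evC ev0 T0 f_def T Ts fX[unfolded f_def] assms(3))
  have ev_sum: "ev (\<Sum>i\<in>I. p i) w = (\<Sum>i\<in>I. ev (p i) w)" for I and p :: "nat \<Rightarrow> _"
    by (induction I rule: infinite_finite_induct) (simp_all add: ev0 ev_add assms(3))
  have "\<exists>p. p \<noteq> 0 \<and> ev p w = 0"
  \<comment> \<open>Two equal iterates already give a relation. Otherwise the iterates form an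
    infinite, hence dependent, set, and the coefficients of a dependency are those of the
    polynomial.\<close>
  proof (cases "inj f")
    case False
    then obtain i j where ij: "i \<noteq> j" "f i = f j" by (auto simp: inj_def)
    have "ev (monom 1 i + monom (-1) j) w = 0" by (simp add: ev_add ev_monom assms(3) ij)
    moreover have "monom 1 i + monom (-1) j \<noteq> (0::complex poly)"
      using ij(1) by (auto simp: poly_eq_iff intro!: exI[of _ i])
    ultimately show ?thesis by blast
  next
    case True
    have "range f \<subseteq> span B" using fX assms(6) by blast
    then have "dependent (range f)" using independent_span_bound[OF assms(5)] True finite_imageD by (metis infinite_UNIV_nat)
    then obtain t u v where t: "finite t" "t \<subseteq> range f" "(\<Sum>v\<in>t. s (u v) v) = 0" "v \<in> t" "u v \<noteq> 0"
      unfolding dependent_explicit by blast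
    let ?I = "f -` t"
    have fin: "finite ?I" using t(1) True by (rule finite_vimageI)
    have tI: "f ` ?I = t" using t(2) by auto
    define p where "p = (\<Sum>i\<in>?I. monom (u (f i)) i)"
    have "ev p w = (\<Sum>i\<in>?I. s (u (f i)) (f i))" by (simp add: p_def ev_sum ev_monom)
    also have "\<dots> = (\<Sum>v\<in>f ` ?I. s (u v) v)"
      using True by (subst sum.reindex) (auto simp: inj_on_def)
    also have "\<dots> = 0" using t(3) unfolding tI .
    finally have 0: "ev p w = 0" .
    obtain i where i: "v = f i" using t(2,4) by blast
    then have "i \<in> ?I" using t(4) by simp
    then have "coeff p i = u (f i)" using fin by (simp add: p_def coeff_sum)
    then have "p \<noteq> 0" using t(5) i by auto
    with 0 show ?thesis by blast
  qed
  then show thesis using main assms(3,4) that by blast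
qed

section \<open>The case of trivial central charge \<open>z = 0\<close>\<close>

locale fv_module =
  fixes W :: "('w::ab_group_add) smod"
  assumes super: "super_module FV W"
begin

sublocale vector_space "scl W"
  using super by (simp add: super_module_def)

abbreviation "s \<equiv> scl W"
abbreviation "H \<equiv> carr W"
abbreviation "ps n \<equiv> gact W (Psi n)"
abbreviation "lo m \<equiv> gact W (L m)"
abbreviation "co \<equiv> gact W C"
abbreviation "zo \<equiv> gact W Z"

lemma subspace_H: "subspace H"
  by (rule subspace_carr[OF super])

lemma subspace_grade: "subspace (grade W p)"
  using super by (simp add: super_module_def)

lemma grade_H: "v \<in> grade W p \<Longrightarrow> v \<in> H"
  using grade_subset_carr[OF super] by blast

lemma H_closed [simp]:
  "0 \<in> H" "u \<in> H \<Longrightarrow> v \<in> H \<Longrightarrow> u + v \<in> H" "u \<in> H \<Longrightarrow> v \<in> H \<Longrightarrow> u - v \<in> H"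
  "u \<in> H \<Longrightarrow> s a u \<in> H" "u \<in> H \<Longrightarrow> - u \<in> H"
  by (simp_all add: subspace_H subspace_0 subspace_add subspace_diff subspace_scale subspace_neg)

lemma H_sum: "(\<And>i. i \<in> I \<Longrightarrow> f i \<in> H) \<Longrightarrow> sum f I \<in> H"
  by (rule subspace_sum[OF subspace_H])

lemma H_decomp:
  assumes "v \<in> H" obtains a b where "a \<in> grade W 0" "b \<in> grade W 1" "v = a + b"
  using assms by (auto simp: carr_def)

lemma H_decomp_unique:
  assumes "a \<in> grade W 0" "b \<in> grade W 1" "a' \<in> grade W 0" "b' \<in> grade W 1" "a + b = a' + b'"
  shows "a = a' \<and> b = b'"
proof -
  have "a - a' = b' - b" using assms(5) by (simp add: algebra_simps)
  moreover have "a - a' \<in> grade W 0" "b' - b \<in> grade W 1"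
    using assms subspace_diff[OF subspace_grade] by blast+
  ultimately have "a - a' \<in> grade W 0 \<inter> grade W 1" by simp
  moreover have "grade W 0 \<inter> grade W 1 = {0}" using super unfolding super_module_def by blast
  ultimately have "a - a' \<in> {0}" by blast
  then show ?thesis using assms(5) by simp
qed

lemma super_gens: "super_module (span_of_gens UNIV) W"
  using super by (simp add: FV_eq)

lemma act_gens: "v \<in> H \<Longrightarrow> act W x v = gen_act s (gact W) x v"
  unfolding gen_act_def by (rule act_expand[OF super_gens]) (auto simp: span_of_gens_def)

lemma basis_grade: "basis g \<in> fv_grade (gen_parity g)"
  by (simp add: fv_grade_def)

lemma gact_H [simp]: "v \<in> H \<Longrightarrow> gact W g v \<in> H"
  unfolding gact_def by (rule act_in_carr[OF super basis_grade])

lemma gact_grade: "v \<in> grade W q \<Longrightarrow> gact W g v \<in> grade W (gen_parity g + q)"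
  using super basis_grade[of g] unfolding super_module_def gact_def by blast

lemma gact_linear: "linear_map_on s s H (gact W g)"
  using super unfolding super_module_def gact_def by blast

lemma gact_add: "u \<in> H \<Longrightarrow> v \<in> H \<Longrightarrow> gact W g (u + v) = gact W g u + gact W g v"
  and gact_scale: "u \<in> H \<Longrightarrow> gact W g (s a u) = s a (gact W g u)"
  using gact_linear[of g] unfolding linear_map_on_def by blast+

lemma gact_zero [simp]: "gact W g 0 = 0"
  using gact_scale[of 0 g 0] by simp

lemma gact_neg: "u \<in> H \<Longrightarrow> gact W g (- u) = - gact W g u"
  using gact_scale[of u g "-1"] by simp

lemma gact_diff: "u \<in> H \<Longrightarrow> v \<in> H \<Longrightarrow> gact W g (u - v) = gact W g u - gact W g v"
  using gact_add[of u "- v" g] by (simp add: gact_neg)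

lemma gact_sum: "(\<And>i. i \<in> I \<Longrightarrow> f i \<in> H) \<Longrightarrow> gact W g (sum f I) = (\<Sum>i\<in>I. gact W g (f i))"
  by (rule linear_map_on_sum[OF vector_space_axioms vector_space_axioms subspace_H gact_linear])

lemmas gact_lin = gact_add gact_scale gact_neg gact_diff

lemma gact_span:
  assumes X: "subspace X" and S: "S \<subseteq> H" "\<And>v. v \<in> S \<Longrightarrow> gact W g v \<in> X" and w: "w \<in> span S"
  shows "gact W g w \<in> X"
proof -
  have "subspace {v \<in> H. gact W g v \<in> X}"
    by (auto simp: subspace_def gact_lin subspace_0[OF X] subspace_add[OF X] subspace_scale[OF X])
  then have "span S \<subseteq> {v \<in> H. gact W g v \<in> X}" using S by (intro span_minimal) auto
  then show ?thesis using w by blast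
qed

lemma bracket_basis: "bracket (basis g) (basis h) = gen_bracket g h"
  by (simp add: bracket_def pscale_simps)

lemma gact_bracket:
  assumes "v \<in> H"
  shows "gen_act s (gact W) (gen_bracket g h) v
    = gact W g (gact W h v) - s (koszul (gen_parity g * gen_parity h)) (gact W h (gact W g v))"
proof -
  have "\<forall>p q. \<forall>x \<in> FV \<inter> fv_grade p. \<forall>y \<in> FV \<inter> fv_grade q. \<forall>v \<in> H.
        act W (bracket x y) v = act W x (act W y v) - s (koszul (p * q)) (act W y (act W x v))"
    using super unfolding super_module_def by (elim conjE)
  then have "act W (bracket (basis g) (basis h)) v = act W (basis g) (act W (basis h) v)
      - s (koszul (gen_parity g * gen_parity h)) (act W (basis h) (act W (basis g) v))"
    using assms basis_grade[of g] basis_grade[of h] by (metis IntI UNIV_I)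
  then show ?thesis using act_gens[OF assms] by (simp add: bracket_basis gact_def)
qed

lemmas ga = gen_act_linear[OF vector_space_axioms]

lemma lo_lo:
  assumes "v \<in> H"
  shows "lo m (lo n v) = lo n (lo m v) + s (of_int (m - n)) (lo (m + n) v)
    + (if m = - n then s (of_int (m ^ 3 - m) / 12) (co v) else 0)"
  using gact_bracket[OF assms, of "L m" "L n"] by (auto simp: ga koszul_def algebra_simps)

lemma lo_ps:
  assumes "v \<in> H"
  shows "lo m (ps n v) = ps n (lo m v) - s (of_int n + of_int m / 2) (ps (m + n) v)"
proof -
  have "lo m (ps n v) - ps n (lo m v) = s (- (of_int n + of_int m / 2)) (ps (m + n) v)"
    using gact_bracket[OF assms, of "L m" "Psi n"] by (simp add: ga koszul_def)
  then show ?thesis unfolding scale_minus_left by (simp add: algebra_simps)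
qed

lemma ps_ps:
  assumes "v \<in> H"
  shows "ps m (ps n v) = (if m = - n then zo v else 0) - ps n (ps m v)"
  using gact_bracket[OF assms, of "Psi m" "Psi n"] by (auto simp: ga koszul_def algebra_simps)

lemma zo_comm:
  assumes "v \<in> H" shows "zo (gact W g v) = gact W g (zo v)"
  using gact_bracket[OF assms, of Z g] by (cases g) (simp_all add: ga koszul_def)

lemma co_comm:
  assumes "v \<in> H" shows "co (gact W g v) = gact W g (co v)"
  using gact_bracket[OF assms, of C g] by (cases g) (simp_all add: ga koszul_def)

lemma graded_submoduleI:
  assumes N: "subspace N" "N \<subseteq> H" and act: "\<And>g v. v \<in> N \<Longrightarrow> gact W g v \<in> N"
    and dec: "\<And>v. v \<in> N \<Longrightarrow> \<exists>a\<in>N \<inter> grade W 0. \<exists>b\<in>N \<inter> grade W 1. v = a + b"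
  shows "graded_submodule FV W N"
  unfolding graded_submodule_def
proof (intro conjI ballI)
  show "N = {u + v |u v. u \<in> N \<inter> grade W 0 \<and> v \<in> N \<inter> grade W 1}"
    using dec subspace_add[OF N(1)] by blast
next
  fix x v assume "v \<in> N"
  then have "act W x v = gen_act s (gact W) x v" "\<And>g. gact W g v \<in> N"
    using N act act_gens[of v x] by auto
  then show "act W x v \<in> N"
    by (simp add: gen_act_def subspace_sum[OF N(1)] subspace_scale[OF N(1)])
qed (rule N)

lemma graded_submodule_span:
  assumes S: "\<And>v. v \<in> S \<Longrightarrow> \<exists>p. v \<in> grade W p" and act: "\<And>g v. v \<in> S \<Longrightarrow> gact W g v \<in> span S"
  shows "graded_submodule FV W (span S)"
proof (rule graded_submoduleI)
  have SH: "S \<subseteq> H" using S grade_H by blast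
  then show sH: "span S \<subseteq> H" using span_minimal subspace_H by blast
  show "gact W g v \<in> span S" if "v \<in> span S" for g v
    using gact_span[OF subspace_span SH act that] by blast
  show "\<exists>a\<in>span S \<inter> grade W 0. \<exists>b\<in>span S \<inter> grade W 1. v = a + b" if "v \<in> span S" for v
    using that
  proof (induction rule: span_induct_alt)
    case base
    then show ?case using subspace_0[OF subspace_grade] span_zero by (metis IntI add_0)
  next
    case (step c x y)
    then obtain a b where ab: "a \<in> span S \<inter> grade W 0" "b \<in> span S \<inter> grade W 1" "y = a + b" by blast
    have xs: "s c x \<in> span S" using step span_base span_scale by blast
    obtain p where "x \<in> grade W p" using S step by blast
    then have p: "s c x \<in> grade W p" using subspace_scale[OF subspace_grade] by blast
    show ?case
    proof (cases "p = 0")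
      case True
      then show ?thesis using ab p xs subspace_add[OF subspace_grade] span_add
        by (intro bexI[of _ "s c x + a"] bexI[of _ b]) (auto simp: add_ac)
    next
      case False
      then have "p = 1" by simp
      then show ?thesis using ab p xs subspace_add[OF subspace_grade] span_add
        by (intro bexI[of _ "a"] bexI[of _ "s c x + b"]) (auto simp: add_ac)
    qed
  qed
qed simp

text \<open>A generator shifts parity by a fixed amount, so the images of the even and the odd
  component of \<open>v\<close> have different parity and cannot cancel.\<close>

lemma kernel_decomp:
  assumes v: "v \<in> H" and K: "\<And>g. g \<in> G \<Longrightarrow> gact W g v = 0"
  obtains a b where "a \<in> grade W 0" "b \<in> grade W 1" "v = a + b"
    "\<And>g. g \<in> G \<Longrightarrow> gact W g a = 0" "\<And>g. g \<in> G \<Longrightarrow> gact W g b = 0"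
proof -
  obtain a b where ab: "a \<in> grade W 0" "b \<in> grade W 1" "v = a + b" using H_decomp[OF v] .
  have "gact W g a = 0 \<and> gact W g b = 0" if g: "g \<in> G" for g
  proof -
    have 0: "gact W g a + gact W g b = 0" using K[OF g] ab grade_H gact_add by metis
    have gr: "gact W g a \<in> grade W (gen_parity g + 0)" "gact W g b \<in> grade W (gen_parity g + 1)"
      using ab gact_grade by blast+
    show ?thesis
    proof (cases "gen_parity g = 0")
      case True
      then show ?thesis using gr 0 H_decomp_unique[of "gact W g a" "gact W g b" 0 0] subspace_0[OF subspace_grade] by simp
    next
      case False
      then have "gen_parity g = 1" by simp
      then show ?thesis using gr 0 H_decomp_unique[of "gact W g b" "gact W g a" 0 0] subspace_0[OF subspace_grade]
        by (simp add: add.commute)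
    qed
  qed
  then show thesis using that ab by blast
qed

end

locale simple_fv_module = fv_module +
  assumes simple: "simple_module FV W"
begin

lemma submodule_full:
  assumes "graded_submodule FV W N" "v \<in> N" "v \<noteq> 0"
  shows "N = H"
  using simple assms unfolding simple_module_def by blast

lemma H_nonzero: obtains v where "v \<in> H" "v \<noteq> 0"
proof -
  have "H \<noteq> {0}" using simple by (simp add: simple_module_def)
  then show thesis using that H_closed(1) by blast
qed

end

context fv_module
begin

section \<open>Words in the odd generators and their filtration\<close>

primrec reach :: "int set \<Rightarrow> int set \<Rightarrow> nat \<Rightarrow> int set" where
  "reach M P 0 = P"
| "reach M P (Suc j) = reach M P j \<union> {m + i | m i. m \<in> M \<and> i \<in> reach M P j}"

lemma finite_reach: "finite M \<Longrightarrow> finite P \<Longrightarrow> finite (reach M P j)"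
  by (induction j) (auto intro!: finite_image_set2)

lemma reach_mono: "i \<le> j \<Longrightarrow> reach M P i \<subseteq> reach M P j"
  by (rule lift_Suc_mono_le) auto

text \<open>In a pair \<open>(i, j)\<close>, the level \<open>j\<close> bounds the number of shifts by elements of \<open>M\<close> that produce the index
  \<open>i\<close> from one in \<open>P\<close>.\<close>

definition psi_word :: "(int \<times> nat) list \<Rightarrow> 'w \<Rightarrow> 'w" where
  "psi_word l = foldr (\<lambda>(i, j). ps i) l"

text \<open>Here \<open>p\<close> counts the odd letters standing in front of a vector, and
  \<open>q\<close> bounds the number of even generators absorbed into the indices of these
  letters.\<close>

definition psi_words :: "int set \<Rightarrow> int set \<Rightarrow> nat \<Rightarrow> nat \<Rightarrow> 'w set" where
  "psi_words M P p q = span {psi_word l v | l v. v \<in> H \<and> length l = p \<and>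
     (\<forall>(i, j) \<in> set l. i \<in> reach M P j) \<and> sum_list (map snd l) \<le> q}"

lemma psi_word_H [simp]: "v \<in> H \<Longrightarrow> psi_word l v \<in> H"
  by (induction l) (auto simp: psi_word_def)

lemma psi_words_mono: "q \<le> q' \<Longrightarrow> psi_words M P p q \<subseteq> psi_words M P p q'"
  unfolding psi_words_def by (rule span_mono) force

lemma psi_words_gact:
  assumes "\<And>l v. v \<in> H \<Longrightarrow> length l = p \<Longrightarrow> \<forall>(i, j) \<in> set l. i \<in> reach M P j \<Longrightarrow> sum_list (map snd l) \<le> q
     \<Longrightarrow> gact W g (psi_word l v) \<in> psi_words M P p' q'"
    and w: "w \<in> psi_words M P p q"
  shows "gact W g w \<in> psi_words M P p' q'"
  using w unfolding psi_words_def[of M P p q]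
  by (rule gact_span[rotated -1]) (use assms(1) in \<open>auto simp: psi_words_def\<close>)

lemma psi_words_Psi:
  assumes "i \<in> reach M P j" "w \<in> psi_words M P p q"
  shows "ps i w \<in> psi_words M P (Suc p) (q + j)"
  using _ assms(2)
proof (rule psi_words_gact)
  fix l v assume *: "v \<in> H" "length l = p" "\<forall>(i, j) \<in> set l. i \<in> reach M P j" "sum_list (map snd l) \<le> q"
  have "ps i (psi_word l v) = psi_word ((i, j) # l) v" by (simp add: psi_word_def)
  then show "ps i (psi_word l v) \<in> psi_words M P (Suc p) (q + j)"
    unfolding psi_words_def using * assms(1) by (intro span_base CollectI exI[of _ "(i, j) # l"] exI[of _ v]) auto
qed

text \<open>The rightmost letter of a word can be made part of the arbitrary vector on which the
  word acts.\<close>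

lemma psi_words_Suc: "psi_words M P (Suc p) q \<subseteq> psi_words M P p q"
  unfolding psi_words_def[of M P "Suc p"]
proof (rule span_minimal)
  show "subspace (psi_words M P p q)" by (simp add: psi_words_def)
  show "{psi_word l v |l v. v \<in> H \<and> length l = Suc p \<and> (\<forall>(i, j)\<in>set l. i \<in> reach M P j) \<and> sum_list (map snd l) \<le> q}
    \<subseteq> psi_words M P p q"
  proof safe
    fix l v assume *: "v \<in> H" "length l = Suc p" "\<forall>(i, j)\<in>set l. i \<in> reach M P j" "sum_list (map snd l) \<le> q"
    then obtain l' ij where l: "l = l' @ [ij]" by (metis length_Suc_conv_rev)
    then have "psi_word l v = psi_word l' (ps (fst ij) v)" by (simp add: psi_word_def split_beta)
    then show "psi_word l v \<in> psi_words M P p q"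
      unfolding psi_words_def using * l
      by (intro span_base CollectI exI[of _ l'] exI[of _ "ps (fst ij) v"]) auto
  qed
qed

lemma psi_words_central:
  assumes "g = C \<or> g = Z" "w \<in> psi_words M P p q"
  shows "gact W g w \<in> psi_words M P p q"
  using _ assms(2)
proof (rule psi_words_gact)
  fix l v assume *: "v \<in> H" "length l = p" "\<forall>(i, j) \<in> set l. i \<in> reach M P j" "sum_list (map snd l) \<le> q"
  have "gact W g (psi_word l v) = psi_word l (gact W g v)"
    using assms(1) *(1) psi_word_H[OF *(1)] by (induction l) (auto simp: psi_word_def zo_comm co_comm)
  then show "gact W g (psi_word l v) \<in> psi_words M P p q"
    unfolding psi_words_def using * by (intro span_base CollectI exI[of _ l] exI[of _ "gact W g v"]) auto
qed

text \<open>Commute L_m to the right. At each letter psi_i it either passes or is absorbed, turning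
  psi_i into a multiple of psi_(m+i) and raising its level by one; if it passes all letters, it
  disappears in the vector.\<close>

lemma psi_words_L:
  assumes m: "m \<in> M" "w \<in> psi_words M P p q"
  shows "lo m w \<in> psi_words M P p (Suc q)"
  using _ assms(2)
proof (rule psi_words_gact)
  fix l v assume "v \<in> H" "length l = p" "\<forall>(i, j) \<in> set l. i \<in> reach M P j" "sum_list (map snd l) \<le> q"
  then show "lo m (psi_word l v) \<in> psi_words M P p (Suc q)"
  proof (induction l arbitrary: p q)
    case Nil
    then show ?case unfolding psi_words_def
      by (intro span_base CollectI exI[of _ "[]"] exI[of _ "lo m v"]) (auto simp: psi_word_def)
  next
    case (Cons ij l)
    obtain i j where ij: "ij = (i, j)" by force
    obtain p' where p': "p = Suc p'" using Cons.prems by (cases p) auto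
    have l: "length l = p'" "\<forall>(i, j) \<in> set l. i \<in> reach M P j" "sum_list (map snd l) \<le> q - j" "j \<le> q"
      using Cons.prems ij p' by auto
    have r: "i \<in> reach M P j" "m + i \<in> reach M P (Suc j)" using Cons.prems ij m(1) by auto
    have 1: "lo m (psi_word l v) \<in> psi_words M P p' (Suc (q - j))"
      using Cons.IH[OF Cons.prems(1) l(1,2,3)] .
    have 2: "psi_word l v \<in> psi_words M P p' (q - j)"
      unfolding psi_words_def using l Cons.prems(1) by (intro span_base CollectI exI[of _ l] exI[of _ v]) auto
    have e: "lo m (psi_word (ij # l) v)
      = ps i (lo m (psi_word l v)) - s (of_int i + of_int m / 2) (ps (m + i) (psi_word l v))"
      using lo_ps[OF psi_word_H[OF Cons.prems(1)]] by (simp add: psi_word_def ij)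
    show ?case unfolding e
      using psi_words_Psi[OF r(1) 1] psi_words_Psi[OF r(2) 2] l(4) p'
      unfolding psi_words_def by (intro span_diff span_scale) simp_all
  qed
qed

text \<open>For z = 0 the psi_i anticommute and have square zero, psi_0 included, so a nonzero word
  has distinct indices. At most \<open>card (reach M P k)\<close> of its letters have level at most
  \<open>k\<close>, and every other letter uses up at least \<open>Suc k\<close> of the total level
  \<open>q\<close>.\<close>

lemma psi_words_zero:
  assumes z: "\<And>v. v \<in> H \<Longrightarrow> zo v = 0" and fin: "finite M" "finite P"
    and large: "q + card (reach M P k) * Suc k < p * Suc k"
  shows "psi_words M P p q = {0}"
proof -
  have sq: "ps i (ps i v) = 0" if "v \<in> H" for i v
  proof -
    have "ps i (ps i v) = - ps i (ps i v)" using ps_ps[OF that, of i i] z[OF that] by (simp split: if_splits)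
    then have "ps i (ps i v) + ps i (ps i v) = 0" by (metis add.right_inverse)
    then have "s 2 (ps i (ps i v)) = 0" by (metis scale_left_distrib one_add_one scale_one)
    then show ?thesis by simp
  qed
  have rep: "ps i (psi_word l v) = 0" if "i \<in> fst ` set l" "v \<in> H" for i l v
    using that
  proof (induction l)
    case (Cons ij l)
    obtain i' j where ij: "ij = (i', j)" by force
    show ?case
    proof (cases "i = i'")
      case True
      then show ?thesis using sq[OF psi_word_H[OF Cons.prems(2)], of i l] ij by (simp add: psi_word_def)
    next
      case False
      then have "ps i (psi_word l v) = 0" using Cons ij by auto
      then show ?thesis using ps_ps[OF psi_word_H[OF Cons.prems(2)], of i i' l] z Cons.prems(2) ij
        by (simp add: psi_word_def z[OF psi_word_H, unfolded psi_word_def])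
    qed
  qed simp
  have nondistinct: "psi_word l v = 0" if "\<not> distinct (map fst l)" "v \<in> H" for l v
    using that
  proof (induction l)
    case (Cons ij l)
    show ?case
    proof (cases "distinct (map fst l)")
      case True
      then have "fst ij \<in> fst ` set l" using Cons by auto
      then show ?thesis using rep[OF _ Cons.prems(2)] by (simp add: psi_word_def split_beta)
    next
      case False
      then show ?thesis using Cons by (simp add: psi_word_def split_beta)
    qed
  qed simp
  have bound: "length l * Suc k \<le> sum_list (map snd l) + card (reach M P k) * Suc k"
    if "distinct (map fst l)" "\<forall>(i, j) \<in> set l. i \<in> reach M P j" for l
  proof -
    let ?A = "filter (\<lambda>ij. snd ij \<le> k) l" and ?B = "filter (\<lambda>ij. \<not> snd ij \<le> k) l"
    have len: "length l = length ?A + length ?B" by (rule sum_length_filter_compl[symmetric])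
    have "set (map fst ?A) \<subseteq> reach M P k" using that(2) reach_mono[of _ k M P] by force
    then have "card (set (map fst ?A)) \<le> card (reach M P k)" by (rule card_mono[OF finite_reach[OF fin]])
    moreover have "distinct (map fst ?A)" using that(1) by (rule distinct_map_filter)
    then have "card (set (map fst ?A)) = length ?A" by (metis distinct_card length_map)
    moreover have "length ?B * Suc k \<le> sum_list (map snd l)"
      by (induction l) (auto simp del: mult_Suc_right)
    ultimately have "length ?A \<le> card (reach M P k)" by simp
    then have "length ?A * Suc k \<le> card (reach M P k) * Suc k" by (rule mult_le_mono1)
    then show ?thesis using \<open>length ?B * Suc k \<le> sum_list (map snd l)\<close>
      unfolding len add_mult_distrib by linarith
  qed
  have "{psi_word l v | l v. v \<in> H \<and> length l = p \<and>
     (\<forall>(i, j) \<in> set l. i \<in> reach M P j) \<and> sum_list (map snd l) \<le> q} \<subseteq> {0}"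
  proof safe
    fix l v assume *: "v \<in> H" "p = length l" "\<forall>(i, j) \<in> set l. i \<in> reach M P j" "sum_list (map snd l) \<le> q"
    show "psi_word l v = 0"
    proof (rule nondistinct[OF _ *(1)], rule notI)
      assume "distinct (map fst l)"
      from order_trans[OF bound[OF this *(3)] add_right_mono[OF *(4)]] show False
        using large unfolding *(2) by (meson leD)
    qed
  qed
  then have "psi_words M P p q \<subseteq> {0}"
    unfolding psi_words_def by (rule span_minimal) (rule subspace_single_0)
  then show ?thesis using span_zero by (auto simp: psi_words_def)
qed

end

context simple_fv_module
begin

definition word :: "gen list \<Rightarrow> 'a \<Rightarrow> 'a" where
  "word ws = foldr (gact W) ws"

text \<open>The words applied to a homogeneous vector span a graded submodule, which is everything
  by simplicity.\<close>

lemma word_generates: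
  assumes y: "y \<in> grade W p" "y \<noteq> 0" and w: "w \<in> H"
  shows "w \<in> span (range (\<lambda>ws. word ws y))"
proof -
  have "graded_submodule FV W (span (range (\<lambda>ws. word ws y)))"
  proof (rule graded_submodule_span)
    fix v assume "v \<in> range (\<lambda>ws. word ws y)"
    then obtain ws where v: "v = word ws y" by blast
    have "\<exists>q. word ws y \<in> grade W q"
      using y by (induction ws) (auto simp: word_def intro: gact_grade)
    then show "\<exists>q. v \<in> grade W q" using v by simp
    fix g
    have "gact W g v = word (g # ws) y" using v by (simp add: word_def)
    then show "gact W g v \<in> span (range (\<lambda>ws. word ws y))" by (simp add: span_base)
  qed
  moreover have "y \<in> span (range (\<lambda>ws. word ws y))"
    by (rule span_base, rule range_eqI[of _ _ "[]"]) (simp add: word_def)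
  ultimately show ?thesis using submodule_full y(2) w by blast
qed

text \<open>If \<open>\<psi>\<^sub>n w \<noteq> 0\<close>, then \<open>w = u \<psi>\<^sub>n w\<close> for some \<open>u\<close> in the enveloping algebra.  But \<open>u \<psi>\<^sub>n\<close> is nilpotent:
  in its \<open>r\<close>-th power at least \<open>r\<close> odd generators must absorb at most \<open>r\<ell>\<close> even ones, and only boundedly
  many distinct odd generators arise from few absorptions.\<close>

theorem z_zero_imp_psi_zero:
  assumes z: "\<And>v. v \<in> H \<Longrightarrow> zo v = 0" and v: "v \<in> H"
  shows "ps n v = 0"
proof -
  have hom: "ps n w = 0" if w: "w \<in> grade W p" for w p
  proof (rule ccontr)
    assume nz: "ps n w \<noteq> 0"
    have wH: "w \<in> H" using w by (rule grade_H)
    have "w \<in> span (range (\<lambda>ws. word ws (ps n w)))"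
      by (rule word_generates[OF gact_grade[OF w] nz wH])
    then obtain T r where T: "finite T" "T \<subseteq> range (\<lambda>ws. word ws (ps n w))" "w = (\<Sum>a\<in>T. s (r a) a)"
      by (auto simp: span_explicit)
    have "\<forall>a\<in>T. \<exists>ws. a = word ws (ps n w)" using T by blast
    then obtain f where f: "\<And>a. a \<in> T \<Longrightarrow> a = word (f a) (ps n w)" by metis
    define G where "G = (\<Union>a\<in>T. set (f a))"
    define M where "M = {m. L m \<in> G}"
    define P where "P = insert n {i. Psi i \<in> G}"
    \<comment> \<open>No word in the expression of \<open>w\<close> has more than \<open>k\<close>
      letters, so re-expressing \<open>w\<close> once raises the level bound by at most
      \<open>k\<close>.\<close>
    define k where "k = Max (insert 0 ((\<lambda>a. length (f a)) ` T))"
    have finG: "finite G" using T by (simp add: G_def)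
    have "finite (L -` G)" "finite (Psi -` G)" using finG by (auto intro!: finite_vimageI injI)
    then have fin: "finite M" "finite P" by (simp_all add: M_def P_def vimage_def)
    have k: "length (f a) \<le> k" if "a \<in> T" for a
      unfolding k_def using that T by (intro Max_ge) auto
    have letter: "gact W g u \<in> psi_words M P p (Suc q)" if g: "g \<in> G" and u: "u \<in> psi_words M P p q" for g u p q
    proof (cases g)
      case (L m)
      then show ?thesis using psi_words_L[of m M u P p q] g u by (simp add: M_def)
    next
      case (Psi i)
      then have "i \<in> reach M P 0" using g by (simp add: P_def)
      \<comment> \<open>The extra odd letter is given away: only the letter \<open>ps n\<close> is
        counted in each round.\<close>
      from psi_words_Psi[OF this u] show ?thesis
        using Psi psi_words_Suc psi_words_mono[of q "Suc q" M P p] by fastforce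
    qed (use psi_words_central[OF _ u, of g] psi_words_mono[of q "Suc q" M P p] in auto)
    have words: "word ws u \<in> psi_words M P p (q + length ws)" if "set ws \<subseteq> G" "u \<in> psi_words M P p q" for ws u p q
      using that by (induction ws) (simp_all add: word_def letter)
    have step: "w \<in> psi_words M P (Suc p) (q + k)" if "w \<in> psi_words M P p q" for p q
    proof -
      have "n \<in> reach M P 0" by (simp add: P_def)
      from psi_words_Psi[OF this that] have "ps n w \<in> psi_words M P (Suc p) q" by simp
      then have "a \<in> psi_words M P (Suc p) (q + k)" if "a \<in> T" for a
        using words[of "f a" "ps n w" "Suc p" q] f[OF that] that k[OF that]
          psi_words_mono[of "q + length (f a)" "q + k" M P "Suc p"] by (auto simp: G_def)
      then show ?thesis
        by (subst T(3)) (simp add: psi_words_def span_sum span_scale)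
    qed
    have "w \<in> psi_words M P 0 0"
      unfolding psi_words_def using wH by (intro span_base CollectI exI[of _ "[]"] exI[of _ w]) (auto simp: psi_word_def)
    have all: "w \<in> psi_words M P r (r * k)" for r
    proof (induction r)
      case (Suc r)
      from step[OF Suc.IH] show ?case by (simp only: mult_Suc add.commute)
    qed (simp add: \<open>w \<in> psi_words M P 0 0\<close>)
    \<comment> \<open>Each round gains one odd letter, worth \<open>Suc k\<close>, and costs at most
      \<open>k\<close> levels. The net gain of one per round must exceed the fixed allowance
      \<open>card (reach M P k) * Suc k\<close>.\<close>
    define r where "r = Suc (card (reach M P k) * Suc k)"
    have "r * k + card (reach M P k) * Suc k < r * Suc k" by (simp add: r_def)
    from psi_words_zero[OF z fin this] all[of r] have "w = 0" by simp
    then show False using nz by simp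
  qed
  obtain a b where ab: "a \<in> grade W 0" "b \<in> grade W 1" "v = a + b" using H_decomp[OF v] .
  then show ?thesis using hom[OF ab(1)] hom[OF ab(2)] grade_H by (simp add: gact_add)
qed

end

section \<open>The Fock module\<close>

interpretation pm: vector_space "pscale :: complex \<Rightarrow> ('a \<Rightarrow>\<^sub>0 complex) \<Rightarrow> _"
  by (rule vector_space_pscale)

abbreviation vac :: ext where "vac \<equiv> Poly_Mapping.single {||} 1"

lemma ext_span_induct [case_names single add scale]:
  assumes "\<And>I. P (Poly_Mapping.single I 1)" "\<And>f g. P f \<Longrightarrow> P g \<Longrightarrow> P (f + g)" "\<And>a f. P f \<Longrightarrow> P (pscale a f)"
  shows "P (f :: ext)"
proof -
  have P0: "P 0" using assms(3)[OF assms(1), of 0] by simp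
  have "P (\<Sum>k\<in>K. pscale (c k) (Poly_Mapping.single k 1))" for K and c :: "nat fset \<Rightarrow> complex"
    by (induction K rule: infinite_finite_induct) (simp_all add: P0 assms)
  then show ?thesis using poly_mapping_expand[of f] by metis
qed

lemma xi_xi: "ext_mult (xi m) (ext_mult (xi n) f) = - ext_mult (xi n) (ext_mult (xi m) f)"
proof (induction f rule: ext_span_induct)
  case (single I)
  show ?case
    by (cases m n rule: linorder_cases)
       (auto simp: xi_mult_single card_finsert_less finsert_commute mult.commute single_uminus[symmetric] simp del: single_uminus)
qed (simp_all add: xi_mult_linear pscale_simps)

lemma deriv_deriv: "ext_deriv m (ext_deriv n f) = - ext_deriv n (ext_deriv m f)"
proof (induction f rule: ext_span_induct)
  case (single I)
  show ?case
  proof (cases "m |\<in>| I \<and> n |\<in>| I \<and> m \<noteq> n")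
    case False
    then show ?thesis by (auto simp: ext_deriv_single)
  next
    case True
    define J where "J = I |-| {|n|} |-| {|m|}"
    have J: "I = finsert n (finsert m J)" "n |\<notin>| J" "m |\<notin>| J"
      using True by (auto simp: J_def)
    have m: "m |\<notin>| finsert n J" using J True by auto
    have n: "n |\<notin>| finsert m J" using J True by auto
    have e: "finsert n (finsert m J) = finsert m (finsert n J)" by auto
    have r: "finsert n (finsert m J) |-| {|n|} = finsert m J" "finsert n (finsert m J) |-| {|m|} = finsert n J"
      "finsert m J |-| {|m|} = J" "finsert n J |-| {|n|} = J"
      using J True by auto
    have cn: "card {i. i |\<in>| finsert n (finsert m J) \<and> i < n} = card {i. i |\<in>| J \<and> i < n} + (if m < n then 1 else 0)"
      using card_finsert_less[OF n, of n] card_finsert_less[OF J(3), of n] by simp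
    have cm: "card {i. i |\<in>| finsert n (finsert m J) \<and> i < m} = card {i. i |\<in>| J \<and> i < m} + (if n < m then 1 else 0)"
      using card_finsert_less[OF m, of m] card_finsert_less[OF J(2), of m] by (simp add: e)
    have c: "card {i. i |\<in>| finsert m J \<and> i < m} = card {i. i |\<in>| J \<and> i < m}"
      "card {i. i |\<in>| finsert n J \<and> i < n} = card {i. i |\<in>| J \<and> i < n}"
      using card_finsert_less[OF J(3), of m] card_finsert_less[OF J(2), of n] by simp_all
    have mem: "m |\<in>| finsert n (finsert m J)" "n |\<in>| finsert n (finsert m J)" "m |\<in>| finsert m J" "n |\<in>| finsert n J" by auto
    show ?thesis unfolding J(1) ext_deriv_single r cn cm c if_P[OF mem(1)] if_P[OF mem(2)] if_P[OF mem(3)] if_P[OF mem(4)]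
      using True by (cases m n rule: linorder_cases) (auto simp: mult.commute single_uminus[symmetric] simp del: single_uminus)
  qed
qed (simp_all add: ext_deriv_linear pscale_simps)

lemma psi_op_add: "psi_op n (f + g) = psi_op n f + psi_op n g"
  by (simp add: psi_op_def xi_mult_linear ext_deriv_linear pscale_simps add_ac)

lemma psi_op_scale: "psi_op n (pscale a f) = pscale a (psi_op n f)"
  by (simp add: psi_op_def xi_mult_linear ext_deriv_linear pscale_simps mult.commute)

lemma psi_op_zero [simp]: "psi_op n 0 = 0"
  using psi_op_scale[of n 0 0] by simp

lemma psi_op_neg: "psi_op n (- f) = - psi_op n f"
  using psi_op_scale[of n "-1" f] by simp

lemma psi_op_diff: "psi_op n (f - g) = psi_op n f - psi_op n g"
  using psi_op_add[of n f "- g"] by (simp add: psi_op_neg)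

lemmas psi_op_lin = psi_op_add psi_op_scale psi_op_neg psi_op_diff

lemma psi_op_sum: "psi_op n (sum f I) = (\<Sum>i\<in>I. psi_op n (f i))"
  by (induction I rule: infinite_finite_induct) (simp_all add: psi_op_add)

lemma square_zero: "x = - x \<Longrightarrow> x = (0 :: ext)"
proof -
  assume "x = - x"
  then have "pscale 2 x = 0" by (metis add.right_inverse one_add_one pm.scale_left_distrib pm.scale_one)
  then show ?thesis by simp
qed

lemma xi_sq: "ext_mult (xi m) (ext_mult (xi m) f) = 0" and deriv_sq: "ext_deriv m (ext_deriv m f) = 0"
  by (rule square_zero, rule xi_xi deriv_deriv)+

lemma psi_op_anticomm: "psi_op m (psi_op n f) = (if m = - n then f else 0) - psi_op n (psi_op m f)"
proof -
  \<comment> \<open>The operator xi_0 + d/dxi_0 has square one, so the factor \<open>r\<close> makes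
    the square of psi_0 equal to 1/2, as the relation at m = n = 0 demands.\<close>
  define r :: complex where "r = 1 / of_real (sqrt 2)"
  have r: "r * r = 1/2"
    by (simp add: r_def flip: of_real_mult)
  define z where "z = (\<lambda>f. ext_mult (xi 0) f + ext_deriv 0 f)"
  have zz: "pscale r (z (pscale r (z f))) + pscale r (z (pscale r (z f))) = f"
  proof -
    have "z (z f) = f" by (simp add: z_def xi_mult_linear ext_deriv_linear xi_sq deriv_sq ext_deriv_xi_mult)
    moreover have "z (pscale r g) = pscale r (z g)" for g
      by (simp add: z_def xi_mult_linear ext_deriv_linear pscale_simps)
    ultimately have "pscale r (z (pscale r (z f))) = pscale (1/2) f" by (simp add: r)
    then show ?thesis by (simp flip: pm.scale_left_distrib)
  qed
  have p0: "psi_op 0 f = pscale r (z f)" for f by (simp add: psi_op_def r_def z_def)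
  have zx: "ext_mult (xi n) (pscale r (z f)) = - pscale r (z (ext_mult (xi n) f))" if "n > 0" for n
    using that xi_xi[of n 0 f] by (simp add: z_def xi_mult_linear ext_deriv_xi_mult pscale_simps)
  have zd: "ext_deriv n (pscale r (z f)) = - pscale r (z (ext_deriv n f))" if "n > 0" for n
    using that deriv_deriv[of n 0 f] by (simp add: z_def ext_deriv_linear ext_deriv_xi_mult pscale_simps)
  consider "m = 0" "n = 0" | "m = 0" "n > 0" | "m = 0" "n < 0" | "m > 0" "n = 0" | "m < 0" "n = 0"
    | "m > 0" "n > 0" | "m > 0" "n < 0" | "m < 0" "n > 0" | "m < 0" "n < 0" by linarith
  then show ?thesis
  proof cases
    case 1
    then show ?thesis using zz by (simp add: p0 algebra_simps)
  next
    case 6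
    then show ?thesis using deriv_deriv[of "nat m" "nat n" f] by (simp add: psi_op_def)
  next
    case 9
    then show ?thesis using xi_xi[of "nat (- m)" "nat (- n)" f] by (simp add: psi_op_def)
  next
    case 7
    then show ?thesis by (auto simp: psi_op_def ext_deriv_xi_mult nat_eq_iff)
  next
    case 8
    then show ?thesis by (auto simp: psi_op_def ext_deriv_xi_mult nat_eq_iff)
  next
    case 2
    then have "psi_op n g = ext_deriv (nat n) g" for g by (simp add: psi_op_def)
    then show ?thesis using 2 by (simp add: p0 zd)
  next
    case 4
    then have "psi_op m g = ext_deriv (nat m) g" for g by (simp add: psi_op_def)
    then show ?thesis using 4 by (simp add: p0 zd)
  next
    case 3
    then have "psi_op n g = ext_mult (xi (nat (- n))) g" for g by (simp add: psi_op_def)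
    then show ?thesis using 3 by (simp add: p0 zx)
  next
    case 5
    then have "psi_op m g = ext_mult (xi (nat (- m))) g" for g by (simp add: psi_op_def)
    then show ?thesis using 5 by (simp add: p0 zx)
  qed
qed

lemma psi_op_vac: "n > 0 \<Longrightarrow> psi_op n vac = 0"
  by (simp add: psi_op_def ext_deriv_one)

text \<open>The Fock space is generated from the vacuum by the psi_n with n \<le> 0. Later
  identities are proved by this induction: they are checked on \<open>vac\<close> and carried along
  the commutation relations with psi_n.\<close>

lemma ext_induct [case_names vac psi add scale]:
  assumes "P vac" "\<And>n f. n \<le> 0 \<Longrightarrow> P f \<Longrightarrow> P (psi_op n f)" "\<And>f g. P f \<Longrightarrow> P g \<Longrightarrow> P (f + g)" "\<And>a f. P f \<Longrightarrow> P (pscale a f)"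
  shows "P f"
proof (induction f rule: ext_span_induct)
  case (single I)
  show ?case
  proof (induction I rule: fset_induct_stronger)
    case empty
    then show ?case using assms(1) by simp
  next
    case (insert n I)
    let ?e = "(-1) ^ card {i. i |\<in>| I \<and> i < n} :: complex"
    have xi: "ext_mult (xi n) (Poly_Mapping.single I 1) = pscale ?e (Poly_Mapping.single (finsert n I) 1)"
      using insert by (simp add: xi_mult_single pscale_simps)
    have "P (ext_mult (xi n) (Poly_Mapping.single I 1))"
    proof (cases "n = 0")
      case True
      \<comment> \<open>On monomials without xi_0 the derivative part of psi_0 vanishes, so psi_0 is
        xi_0 up to a factor.\<close>
      have "ext_deriv 0 (Poly_Mapping.single I 1) = 0" using insert True by (simp add: ext_deriv_single)
      then have "ext_mult (xi n) (Poly_Mapping.single I 1) = pscale (of_real (sqrt 2)) (psi_op 0 (Poly_Mapping.single I 1))"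
        using True by (simp add: psi_op_def)
      then show ?thesis using assms insert by simp
    next
      case False
      then have "ext_mult (xi n) (Poly_Mapping.single I 1) = psi_op (- int n) (Poly_Mapping.single I 1)"
        by (simp add: psi_op_def)
      then show ?thesis using assms insert by simp
    qed
    then have "P (pscale ?e (pscale ?e (Poly_Mapping.single (finsert n I) 1)))"
      unfolding xi by (rule assms(4))
    moreover have "?e * ?e = 1" by (simp flip: power_mult_distrib)
    ultimately show ?case by (simp only: pm.scale_scale pm.scale_one)
  qed
qed (use assms in auto)

lemma psi_op_eventually_zero: obtains N where "N > 0" "\<And>n. n \<ge> N \<Longrightarrow> psi_op n f = 0"
proof -
  define K where "K = (\<Union>I\<in>Poly_Mapping.keys f. fset I)"
  have "finite K" by (simp add: K_def)
  then obtain M where M: "\<And>k. k \<in> K \<Longrightarrow> k \<le> M" using finite_nat_set_iff_bounded_le by auto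
  show thesis
  proof (rule that[of "int (Suc M)"])
    fix n assume n: "n \<ge> int (Suc M)"
    have "{I \<in> Poly_Mapping.keys f. nat n |\<in>| I} = {}"
      using M n by (force simp: K_def)
    note e = this
    have "psi_op n f = ext_deriv (nat n) f" using n by (simp add: psi_op_def)
    also have "\<dots> = 0" unfolding ext_deriv_def e by simp
    finally show "psi_op n f = 0" .
  qed simp
qed

section \<open>The Virasoro operators on the Fock space\<close>

lemma normal_ordered_lin:
  "normal_ordered a b (f + g) = normal_ordered a b f + normal_ordered a b g"
  "normal_ordered a b (pscale c f) = pscale c (normal_ordered a b f)"
  by (simp_all add: normal_ordered_def psi_op_lin)

lemma normal_ordered_finite:
  obtains S where "finite S" "\<And>j. j \<notin> S \<Longrightarrow> normal_ordered (- j) (j + k) f = 0"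
proof -
  obtain N where N: "N > 0" "\<And>n. n \<ge> N \<Longrightarrow> psi_op n f = 0" using psi_op_eventually_zero[of f] by blast
  show thesis
  proof (rule that[of "{- (N + \<bar>k\<bar>) .. N + \<bar>k\<bar>}"])
    fix j assume "j \<notin> {- (N + \<bar>k\<bar>) .. N + \<bar>k\<bar>}"
    then consider "j > N + \<bar>k\<bar>" | "j < - (N + \<bar>k\<bar>)" by force
    then show "normal_ordered (- j) (j + k) f = 0"
    proof cases
      case 1
      then have "j + k \<ge> N" "j + k \<ge> - j" using N(1) by linarith+
      then show ?thesis using N(2) by (simp add: normal_ordered_def)
    next
      case 2
      then have "- j \<ge> N" "\<not> j + k \<ge> - j" using N(1) by linarith+
      then show ?thesis using N(2) by (simp add: normal_ordered_def)
    qed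
  qed simp
qed

text \<open>Any finite set containing the support may serve as index set, so sums belonging to
  different vectors can be taken over a common one.\<close>

lemma Lbar_sum:
  assumes "finite S" "\<And>j. j \<notin> S \<Longrightarrow> pscale (of_int j) (normal_ordered (- j) (j + k) f) = 0"
  shows "Lbar k f = pscale (if k = 0 then 1 / 16 else 0) f
    + pscale (1 / 2) (\<Sum>j\<in>S. pscale (of_int j) (normal_ordered (- j) (j + k) f))"
  unfolding Lbar_def by (subst Sum_any.expand_superset[OF assms(1)]) (use assms(2) in auto)

lemma Lbar_lin: "Lbar k (f + g) = Lbar k f + Lbar k g" "Lbar k (pscale c f) = pscale c (Lbar k f)"
proof -
  obtain S where S: "finite S" "\<And>j. j \<notin> S \<Longrightarrow> normal_ordered (- j) (j + k) f = 0" using normal_ordered_finite[where k = k and f = "f"] by blast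
  obtain S' where S': "finite S'" "\<And>j. j \<notin> S' \<Longrightarrow> normal_ordered (- j) (j + k) g = 0" using normal_ordered_finite[where k = k and f = "g"] by blast
  have "finite (S \<union> S')" using S S' by simp
  note L = Lbar_sum[OF this]
  show "Lbar k (f + g) = Lbar k f + Lbar k g"
    by (subst (1 2 3) L) (use S S' in \<open>simp_all add: normal_ordered_lin pscale_simps sum.distrib algebra_simps\<close>)
  note L = Lbar_sum[OF S(1)]
  show "Lbar k (pscale c f) = pscale c (Lbar k f)"
    by (subst (1 2) L) (use S in \<open>simp_all add: normal_ordered_lin pscale_simps pm.scale_sum_right mult_ac\<close>)
qed

lemma Lbar_zero [simp]: "Lbar k 0 = 0"
  using Lbar_lin(2)[of k 0 0] by simp

lemma Lbar_neg: "Lbar k (- f) = - Lbar k f"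
  using Lbar_lin(2)[of k "-1" f] by simp

lemma Lbar_diff: "Lbar k (f - g) = Lbar k f - Lbar k g"
  using Lbar_lin(1)[of k f "- g"] by (simp add: Lbar_neg)

lemma Lbar_sum_arg: "Lbar k (sum f I) = (\<Sum>i\<in>I. Lbar k (f i))"
  by (induction I rule: infinite_finite_induct) (simp_all add: Lbar_lin)

text \<open>Normal ordering changes a product only by a scalar, so its commutator with psi_n is that
  of the plain product.\<close>

lemma normal_ordered_psi:
  "normal_ordered a b (psi_op n f) = psi_op n (normal_ordered a b f)
     + ((if b = - n then psi_op a f else 0) - (if a = - n then psi_op b f else 0))"
proof -
  have *: "psi_op c (psi_op d (psi_op n f)) = psi_op n (psi_op c (psi_op d f))
     + ((if d = - n then psi_op c f else 0) - (if c = - n then psi_op d f else 0))" for c d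
    using psi_op_anticomm[of d n f] psi_op_anticomm[of c n "psi_op d f"]
    by (simp add: psi_op_lin)
  show ?thesis unfolding normal_ordered_def using *[of a b] *[of b a] by (auto simp: psi_op_lin)
qed

text \<open>Only the summands j = n and j = -n-k fail to commute with psi_n. Both give multiples of
  psi_(n+k), with total coefficient -2(n + k/2); the factor 1/2 in front of the sum turns this into
  the structure constant.\<close>

lemma Lbar_psi: "Lbar k (psi_op n f) = psi_op n (Lbar k f) - pscale (of_int n + of_int k / 2) (psi_op (k + n) f)"
proof -
  obtain S where S: "finite S" "\<And>j. j \<notin> S \<Longrightarrow> normal_ordered (- j) (j + k) f = 0" using normal_ordered_finite[where k = k and f = "f"] by blast
  obtain S' where S': "finite S'" "\<And>j. j \<notin> S' \<Longrightarrow> normal_ordered (- j) (j + k) (psi_op n f) = 0" using normal_ordered_finite[where k = k and f = "psi_op n f"] by blast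
  define a where "a = - n - k"
  define U where "U = S \<union> S' \<union> {n, a}"
  have U: "finite U" using S S' by (simp add: U_def)
  have nU: "n \<in> U" "a \<in> U" by (auto simp: U_def)
  note L = Lbar_sum[OF U]
  have L1: "Lbar k f = pscale (if k = 0 then 1 / 16 else 0) f
    + pscale (1 / 2) (\<Sum>j\<in>U. pscale (of_int j) (normal_ordered (- j) (j + k) f))"
    by (rule L) (use S in \<open>auto simp: U_def\<close>)
  have L2: "Lbar k (psi_op n f) = pscale (if k = 0 then 1 / 16 else 0) (psi_op n f)
    + pscale (1 / 2) (\<Sum>j\<in>U. pscale (of_int j) (normal_ordered (- j) (j + k) (psi_op n f)))"
    by (rule L) (use S' in \<open>auto simp: U_def\<close>)
  have e: "(j + k = - n) = (j = a)" "(- j = - n) = (j = n)" for j by (auto simp: a_def)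
  have "pscale (of_int j) (normal_ordered (- j) (j + k) (psi_op n f))
    = pscale (of_int j) (psi_op n (normal_ordered (- j) (j + k) f))
        + ((if j = a then pscale (of_int a) (psi_op (- a) f) else 0)
         - (if j = n then pscale (of_int n) (psi_op (n + k) f) else 0))" for j
    unfolding normal_ordered_psi e by (cases "j = a"; cases "j = n") (simp_all add: pscale_simps)
  then have "(\<Sum>j\<in>U. pscale (of_int j) (normal_ordered (- j) (j + k) (psi_op n f)))
    = psi_op n (\<Sum>j\<in>U. pscale (of_int j) (normal_ordered (- j) (j + k) f))
      + (pscale (of_int a) (psi_op (- a) f) - pscale (of_int n) (psi_op (n + k) f))"
    using U nU by (simp add: sum.distrib sum_subtractf psi_op_sum psi_op_scale)
  also have "pscale (of_int a) (psi_op (- a) f) - pscale (of_int n) (psi_op (n + k) f)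
      = pscale (of_int a - of_int n) (psi_op (n + k) f)"
  proof -
    have "- a = n + k" by (simp add: a_def)
    then show ?thesis by (simp only: pm.scale_left_diff_distrib)
  qed
  also have "of_int a - of_int n = (- 2 * (of_int n + of_int k / 2) :: complex)"
    by (simp add: a_def)
  finally have S: "(\<Sum>j\<in>U. pscale (of_int j) (normal_ordered (- j) (j + k) (psi_op n f)))
    = psi_op n (\<Sum>j\<in>U. pscale (of_int j) (normal_ordered (- j) (j + k) f))
      + pscale (- 2 * (of_int n + of_int k / 2)) (psi_op (n + k) f)" .
  have c: "pscale (1 / 2) (pscale (- 2 * c) g) = - pscale c g" for c and g :: ext by simp
  have "k + n = n + k" by simp
  then show ?thesis unfolding L1 L2 S by (simp only: psi_op_lin pm.scale_right_distrib c) (simp add: algebra_simps)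
qed

section \<open>Degrees on the Fock space and the Virasoro relations at the vacuum\<close>

definition ext_deg :: "int \<Rightarrow> ext set" where
  "ext_deg d = {f. \<forall>I\<in>Poly_Mapping.keys f. int (\<Sum>i\<in>fset I. i) = d}"

lemma subspace_ext_deg: "pm.subspace (ext_deg d)"
  unfolding pm.subspace_def
proof (intro conjI ballI allI)
  fix f g assume "f \<in> ext_deg d" "g \<in> ext_deg d"
  then show "f + g \<in> ext_deg d" using Poly_Mapping.keys_add[of f g] by (auto simp: ext_deg_def)
qed (auto simp: ext_deg_def in_keys_iff)

lemma single_ext_deg: "int (\<Sum>i\<in>fset I. i) = d \<Longrightarrow> Poly_Mapping.single I c \<in> ext_deg d"
  by (auto simp: ext_deg_def in_keys_iff lookup_single when_def)

lemma ext_deg_psi: "f \<in> ext_deg d \<Longrightarrow> psi_op n f \<in> ext_deg (d - n)"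
proof -
  assume f: "f \<in> ext_deg d"
  have S: "psi_op n (Poly_Mapping.single I 1) \<in> ext_deg (d - n)" if I: "int (\<Sum>i\<in>fset I. i) = d" for I
  proof -
    have x: "ext_mult (xi m) (Poly_Mapping.single I 1) \<in> ext_deg (d + int m)" for m
      using I pm.subspace_0[OF subspace_ext_deg]
      by (auto simp: xi_mult_single sum.insert intro!: single_ext_deg)
    have y: "ext_deriv m (Poly_Mapping.single I 1) \<in> ext_deg (d - int m)" for m
    proof (cases "m |\<in>| I")
      case True
      then have "(\<Sum>i\<in>fset I. i) = m + (\<Sum>i\<in>fset I - {m}. i)" by (simp add: sum.remove)
      then show ?thesis using I True by (auto simp: ext_deriv_single intro!: single_ext_deg)
    qed (use pm.subspace_0[OF subspace_ext_deg] in \<open>simp add: ext_deriv_single\<close>)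
    consider "n > 0" | "n = 0" | "n < 0" by linarith
    then show ?thesis
    proof cases
      case 1 then show ?thesis using y[of "nat n"] by (simp add: psi_op_def)
    next
      case 2 then show ?thesis using x[of 0] y[of 0]
        by (simp add: psi_op_def pm.subspace_add[OF subspace_ext_deg] pm.subspace_scale[OF subspace_ext_deg])
    next
      case 3 then show ?thesis using x[of "nat (- n)"] by (simp add: psi_op_def)
    qed
  qed
  have "psi_op n f = (\<Sum>k\<in>Poly_Mapping.keys f. pscale (Poly_Mapping.lookup f k) (psi_op n (Poly_Mapping.single k 1)))"
    by (rule linear_extension_unique[of "psi_op n"]) (rule psi_op_lin)+
  then show ?thesis
    using f S by (simp add: ext_deg_def[of d] pm.subspace_sum[OF subspace_ext_deg] pm.subspace_scale[OF subspace_ext_deg])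
qed

lemma ext_deg_Lbar: "f \<in> ext_deg d \<Longrightarrow> Lbar k f \<in> ext_deg (d - k)"
proof -
  assume f: "f \<in> ext_deg d"
  obtain S where S: "finite S" "\<And>j. j \<notin> S \<Longrightarrow> normal_ordered (- j) (j + k) f = 0" using normal_ordered_finite[where k = k and f = "f"] by blast
  note sub = subspace_ext_deg[of "d - k"]
  have "psi_op a (psi_op b f) \<in> ext_deg (d - k)" if "a + b = k" for a b
    using ext_deg_psi[OF ext_deg_psi[OF f, of b], of a] that by (simp add: algebra_simps)
  then have no: "normal_ordered (- j) (j + k) f \<in> ext_deg (d - k)" for j
    unfolding normal_ordered_def using pm.subspace_neg[OF sub] by auto
  have "Lbar k f = pscale (if k = 0 then 1 / 16 else 0) f
    + pscale (1 / 2) (\<Sum>j\<in>S. pscale (of_int j) (normal_ordered (- j) (j + k) f))"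
    by (rule Lbar_sum[OF S(1)]) (simp add: S(2))
  moreover have "pscale (if k = 0 then 1 / 16 else 0) f \<in> ext_deg (d - k)"
    using f pm.subspace_scale[OF sub] pm.subspace_0[OF sub] by auto
  ultimately show ?thesis using no
    by (simp only: pm.subspace_add[OF sub] pm.subspace_scale[OF sub] pm.subspace_sum[OF sub])
qed

text \<open>A monomial of nonzero degree contains some xi_n with n > 0. Distinct monomials
  containing xi_n have distinct derivatives, so nothing cancels and the n-th derivative of
  \<open>f\<close> would be nonzero.\<close>

lemma psi_killed_deg:
  assumes d: "f \<in> ext_deg d" "d \<noteq> 0" and k: "\<And>n. n > 0 \<Longrightarrow> psi_op n f = 0"
  shows "f = 0"
proof (rule ccontr)
  assume "f \<noteq> 0"
  then obtain I where I: "I \<in> Poly_Mapping.keys f" by fastforce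
  then have "int (\<Sum>i\<in>fset I. i) \<noteq> 0" using d by (auto simp: ext_deg_def)
  then obtain n where n: "n |\<in>| I" "n > 0" by (metis gr0I of_nat_0 sum.neutral)
  have sub: "J = K" if "J |-| {|n|} = K |-| {|n|}" "n |\<in>| J" "n |\<in>| K" for J K
    using that by (metis finsert_fminus)
  have "Poly_Mapping.lookup (ext_deriv n f) (I |-| {|n|})
    = (\<Sum>J\<in>{J \<in> Poly_Mapping.keys f. n |\<in>| J}. if J = I then ((-1) ^ card {i. i |\<in>| I \<and> i < n} * Poly_Mapping.lookup f I) else 0)"
    unfolding ext_deriv_def lookup_sum
    by (intro sum.cong refl) (use sub n in \<open>auto simp: lookup_single when_def\<close>)
  also have "\<dots> = (-1) ^ card {i. i |\<in>| I \<and> i < n} * Poly_Mapping.lookup f I"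
    using I n by simp
  also have "\<dots> \<noteq> 0" using I by (simp add: in_keys_iff)
  finally show False using k[of "int n"] n by (simp add: psi_op_def)
qed

lemma normal_ordered_noncrit: "a + b \<noteq> 0 \<Longrightarrow> normal_ordered a b f = psi_op a (psi_op b f)"
  using psi_op_anticomm[of a b f] by (auto simp: normal_ordered_def)

lemma Lbar_vac_pos: "k > 0 \<Longrightarrow> Lbar k vac = 0"
proof -
  assume k: "k > 0"
  have "normal_ordered (- j) (j + k) vac = 0" for j
  proof (cases "j + k \<ge> - j")
    case True
    then have "j + k > 0" using k by linarith
    then show ?thesis using True by (simp add: normal_ordered_def psi_op_vac)
  next
    case False
    then have "- j > 0" using k by linarith
    then show ?thesis using False by (simp add: normal_ordered_def psi_op_vac)
  qed
  then show ?thesis using Lbar_sum[of "{}" k vac] k by simp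
qed

lemma Lbar_vac_0: "Lbar 0 vac = pscale (1 / 16) vac"
proof -
  have "pscale (of_int j) (normal_ordered (- j) (j + 0) vac) = 0" for j
    by (cases j "0 :: int" rule: linorder_cases) (simp_all add: normal_ordered_def psi_op_vac)
  then show ?thesis using Lbar_sum[of "{}" 0 vac] by simp
qed

lemma Lbar_vac_neg:
  assumes "m > 0"
  shows "Lbar (- m) vac = pscale (1 / 2) (\<Sum>j\<in>{1..m}. pscale (of_int j) (psi_op (- j) (psi_op (j - m) vac)))"
proof -
  have "pscale (of_int j) (normal_ordered (- j) (j + - m) vac) = 0" if j: "j \<notin> {1..m}" for j
  proof -
    \<comment> \<open>For j = 0 it is the coefficient that vanishes. In the other cases one of the
      two factors has positive index and can be moved onto the vacuum.\<close>
    consider "j = 0" | "j < 0" | "j > m" using j assms by force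
    then show ?thesis
      using assms psi_op_anticomm[of "- j" "j - m" vac] by cases (simp_all add: normal_ordered_noncrit psi_op_vac)
  qed
  from Lbar_sum[OF finite_atLeastAtMost_int this] show ?thesis using assms by (simp add: normal_ordered_noncrit)
qed

text \<open>This is where the values 1/2 of c and 1/16 of the lowest weight come from. Moving
  \<open>Lbar m\<close> through the finite sum for \<open>Lbar (- m) vac\<close> leaves power sums
  of degree one and two.\<close>

lemma Lbar_comm_vac_crit:
  assumes m: "m > 0"
  shows "Lbar m (Lbar (- m) vac) = pscale (of_int (2 * m) / 16 + of_int (m ^ 3 - m) / 24) vac"
proof -
  \<comment> \<open>The summand j = m is exceptional: it ends with the square of psi_0, which is
    1/2, where the others end with 1.\<close>
  have t: "Lbar m (psi_op (- j) (psi_op (j - m) vac)) = pscale (if j = m then of_int m / 4 else of_int j - of_int m / 2) vac"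
    if j: "j \<in> {1..m}" for j
  proof -
    have 0: "psi_op (- j) (psi_op j vac) = 0" using j by (simp add: psi_op_vac)
    have 1: "psi_op (m - j) (psi_op (j - m) vac) = pscale (if j = m then 1 / 2 else 1) vac"
    proof (cases "j = m")
      case True
      let ?y = "psi_op 0 (psi_op 0 vac)"
      have "?y + ?y = vac" using psi_op_anticomm[of 0 0 vac] by (simp add: eq_diff_eq)
      then have "pscale (1/2) vac = pscale (1/2) (?y + ?y)" by (simp only:)
      also have "\<dots> = ?y" by (simp only: pm.scale_right_distrib) (simp flip: pm.scale_left_distrib)
      finally have "?y = pscale (1/2) vac" by (simp only:)
      then show ?thesis using True by simp
    next
      case False
      then show ?thesis using psi_op_anticomm[of "m - j" "j - m" vac] j psi_op_vac[of "m - j"] by simp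
    qed
    have "Lbar m (psi_op (- j) (psi_op (j - m) vac)) = pscale (of_int j - of_int m / 2) (psi_op (m - j) (psi_op (j - m) vac))"
      by (simp add: Lbar_psi psi_op_lin Lbar_vac_pos[OF m] 0 flip: pm.scale_minus_left)
    then show ?thesis unfolding 1 by simp
  qed
  have "Lbar m (Lbar (- m) vac) = pscale (1/2) (\<Sum>j\<in>{1..m}. pscale (of_int j) (Lbar m (psi_op (- j) (psi_op (j - m) vac))))"
    by (simp add: Lbar_vac_neg[OF m] Lbar_lin Lbar_sum_arg)
  also have "\<dots> = pscale (1/2) (\<Sum>j\<in>{1..m}. pscale (of_int j) (pscale (if j = m then of_int m / 4 else of_int j - of_int m / 2) vac))"
    using t by (intro arg_cong[of _ _ "pscale (1/2)"] sum.cong refl) auto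
  also have "\<dots> = pscale (1/2 * (\<Sum>j\<in>{1..m}. of_int j * (if j = m then of_int m / 4 else of_int j - of_int m / 2))) vac"
    by (simp only: pm.scale_scale pm.scale_sum_left[symmetric])
  \<comment> \<open>The exceptional summand is counted like the others, as m * m/2, and the excess m
    * m/4 is subtracted.\<close>
  also have "(\<Sum>j\<in>{1..m}. of_int j * (if j = m then of_int m / 4 else of_int j - of_int m / 2))
     = (\<Sum>j\<in>{1..m}. of_int j * (of_int j - of_int m / 2)) - of_int m * (of_int m / 4 :: complex)"
  proof -
    have e: "{1..m} = insert m {1..m-1}" using m by auto
    show ?thesis unfolding e by (simp add: algebra_simps cong: sum.cong_simp)
  qed
  also have "(\<Sum>j\<in>{1..m}. of_int j * (of_int j - of_int m / 2)) =
      of_int (m * (m + 1) * (2 * m + 1)) / 6 - of_int m / 2 * (of_int (m * (m + 1)) / 2 :: complex)"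
  proof -
    have "(\<Sum>j\<in>{1..int n}. of_int j * (of_int j - c)) =
      of_int (int n * (int n + 1) * (2 * int n + 1)) / 6 - c * (of_int (int n * (int n + 1)) / 2 :: complex)" for n :: nat and c :: complex
    proof (induction n)
      case (Suc n)
      have e: "{1..int (Suc n)} = insert (int (Suc n)) {1..int n}" by auto
      show ?case unfolding e using Suc by (simp add: field_simps)
    qed simp
    from this[where n = "nat m" and c = "of_int m / 2"] m show ?thesis by simp
  qed
  also have "1/2 * (of_int (m * (m + 1) * (2 * m + 1)) / 6 - of_int m / 2 * (of_int (m * (m + 1)) / 2) - of_int m * (of_int m / 4))
     = (of_int (2 * m) / 16 + of_int (m ^ 3 - m) / 24 :: complex)"
    by (simp add: field_simps power3_eq_cube)
  finally show ?thesis .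
qed

text \<open>For m + n \<noteq> 0 the defect of the relation commutes with every psi_p, so its value
  at the vacuum is killed by all psi_p with p > 0. That value has degree -(m + n) \<noteq> 0 and
  therefore vanishes. Only the case m = -n requires a computation with sums.\<close>

lemma Lbar_comm_vac:
  "Lbar m (Lbar n vac) - Lbar n (Lbar m vac) =
     pscale (of_int (m - n)) (Lbar (m + n) vac) + pscale (if m = - n then of_int (m ^ 3 - m) / 24 else 0) vac"
proof (cases "m = - n")
  case False
  define X where "X f = Lbar m (Lbar n f) - Lbar n (Lbar m f) - pscale (of_int (m - n)) (Lbar (m + n) f)" for f
  have X0: "X 0 = 0" by (simp add: X_def)
  have c: "X (psi_op p f) = psi_op p (X f)" for p f
  proof -
    let ?y = "psi_op (m + n + p) f"
    have e: "Lbar a (Lbar b (psi_op p f)) = psi_op p (Lbar a (Lbar b f)) - pscale (of_int p + of_int a / 2) (psi_op (a + p) (Lbar b f))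
      - pscale (of_int p + of_int b / 2) (psi_op (b + p) (Lbar a f))
      + pscale ((of_int p + of_int b / 2) * (of_int (b + p) + of_int a / 2)) (psi_op (a + (b + p)) f)" for a b
      unfolding Lbar_psi Lbar_diff Lbar_lin pm.scale_right_diff_distrib pm.scale_scale by simp
    have i: "m + (n + p) = m + n + p" "n + (m + p) = m + n + p" by simp_all
    have "X (psi_op p f) - psi_op p (X f)
      = pscale ((of_int p + of_int n / 2) * (of_int (n + p) + of_int m / 2)) ?y
        - pscale ((of_int p + of_int m / 2) * (of_int (m + p) + of_int n / 2)) ?y
        + pscale (of_int (m - n) * (of_int p + of_int (m + n) / 2)) ?y"
      unfolding X_def e i unfolding Lbar_psi psi_op_lin pm.scale_right_diff_distrib pm.scale_scale by simp
    also have "\<dots> = pscale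
      ((of_int p + of_int n / 2) * (of_int (n + p) + of_int m / 2) - (of_int p + of_int m / 2) * (of_int (m + p) + of_int n / 2)
        + of_int (m - n) * (of_int p + of_int (m + n) / 2)) ?y"
      by (simp only: pm.scale_left_diff_distrib pm.scale_left_distrib)
    \<comment> \<open>The coefficients cancel by the Jacobi identity for L_m, L_n and psi_p.\<close>
    also have "\<dots> = pscale 0 (psi_op (m + n + p) f)" by (rule arg_cong[of _ _ "\<lambda>c. pscale c _"]) (simp add: field_simps)
    finally show ?thesis by simp
  qed
  have "vac \<in> ext_deg 0" by (rule single_ext_deg) simp
  then have "Lbar m (Lbar n vac) \<in> ext_deg (0 - n - m)" "Lbar n (Lbar m vac) \<in> ext_deg (0 - m - n)"
    "Lbar (m + n) vac \<in> ext_deg (0 - (m + n))"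
    by (intro ext_deg_Lbar; assumption)+
  moreover have "0 - n - m = - (m + n)" "0 - m - n = - (m + n)" "0 - (m + n) = - (m + n)" by simp_all
  ultimately have "Lbar m (Lbar n vac) \<in> ext_deg (- (m + n))" "Lbar n (Lbar m vac) \<in> ext_deg (- (m + n))"
    "Lbar (m + n) vac \<in> ext_deg (- (m + n))"
    by (simp_all only:)
  then have "X vac \<in> ext_deg (- (m + n))"
    unfolding X_def using pm.subspace_diff[OF subspace_ext_deg] pm.subspace_scale[OF subspace_ext_deg] by blast
  moreover have "psi_op p (X vac) = 0" if "p > 0" for p using c[of p vac] that by (simp add: psi_op_vac X0)
  ultimately have "X vac = 0" using psi_killed_deg[of "X vac" "- (m + n)"] False by auto
  then show ?thesis using False by (simp add: X_def)
next
  case True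
  have pos: "Lbar k (Lbar (- k) vac) - Lbar (- k) (Lbar k vac) =
     pscale (of_int (2 * k)) (Lbar 0 vac) + pscale (of_int (k ^ 3 - k) / 24) vac" if "k > 0" for k
    using that by (simp add: Lbar_comm_vac_crit Lbar_vac_pos Lbar_vac_0 flip: pm.scale_left_distrib)
  consider "m > 0" | "m = 0" | "m < 0" by linarith
  then show ?thesis
  proof cases
    case 1 then show ?thesis using pos[of m] True by (simp add: algebra_simps)
  next
    case 2 then show ?thesis using True by simp
  next
    case 3
    have "Lbar m (Lbar n vac) - Lbar n (Lbar m vac) = - (Lbar n (Lbar (- n) vac) - Lbar (- n) (Lbar n vac))"
      using True by simp
    also have "\<dots> = pscale (- of_int (2 * n)) (Lbar 0 vac) + pscale (- (of_int (n ^ 3 - n) / 24)) vac"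
      using 3 True by (subst pos) (simp_all add: pm.scale_minus_left)
    also have "\<dots> = pscale (of_int (m - n)) (Lbar 0 vac) + pscale (of_int (m ^ 3 - m) / 24) vac"
    proof -
      have "- of_int (2 * n) = (of_int (m - n) :: complex)" "- (of_int (n ^ 3 - n) / 24) = (of_int (m ^ 3 - m) / 24 :: complex)"
        using True by (simp_all add: field_simps)
      then show ?thesis by (simp only:)
    qed
    finally show ?thesis using True by simp
  qed
qed

section \<open>Weights and the dichotomy\<close>

text \<open>The amount by which a generator lowers the eigenvalue of L_0.\<close>

primrec gen_shift :: "gen \<Rightarrow> int" where
  "gen_shift (L m) = m"
| "gen_shift (Psi n) = n"
| "gen_shift C = 0"
| "gen_shift Z = 0"

section \<open>Weight spaces\<close>

context fv_module
begin

abbreviation "wt \<equiv> weight_space W"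

lemma wt_H: "v \<in> wt \<alpha> \<Longrightarrow> v \<in> H" and wt_eq: "v \<in> wt \<alpha> \<Longrightarrow> lo 0 v = s \<alpha> v"
  and wtI: "v \<in> H \<Longrightarrow> lo 0 v = s \<alpha> v \<Longrightarrow> v \<in> wt \<alpha>"
  by (auto simp: weight_space_def gact_def)

lemma subspace_wt: "subspace (wt \<alpha>)"
  unfolding subspace_def
proof (intro conjI ballI allI)
  fix x y assume xy: "x \<in> wt \<alpha>" "y \<in> wt \<alpha>"
  then have "x \<in> H" "y \<in> H" by (auto intro: wt_H)
  then show "x + y \<in> wt \<alpha>" using xy by (intro wtI) (simp_all add: gact_lin wt_eq scale_right_distrib)
next
  fix c x assume x: "x \<in> wt \<alpha>"
  then have "x \<in> H" by (rule wt_H)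
  then show "s c x \<in> wt \<alpha>" using x by (intro wtI) (simp_all add: gact_lin wt_eq mult.commute)
qed (simp add: wtI)

lemma gact_wt:
  assumes v: "v \<in> wt \<alpha>" shows "gact W g v \<in> wt (\<alpha> - of_int (gen_shift g))"
proof (rule wtI)
  have vH: "v \<in> H" using v by (rule wt_H)
  then show "gact W g v \<in> H" by simp
  show "lo 0 (gact W g v) = s (\<alpha> - of_int (gen_shift g)) (gact W g v)"
  proof (cases g)
    case (L n)
    then show ?thesis using lo_lo[OF vH, of 0 n] wt_eq[OF v] vH by (auto simp: gact_lin scale_left_diff_distrib)
  next
    case (Psi n)
    then show ?thesis using lo_ps[OF vH, of 0 n] wt_eq[OF v] vH by (simp add: gact_lin scale_left_diff_distrib)
  next
    case C
    then show ?thesis using co_comm[OF vH, of "L 0"] wt_eq[OF v] vH by (simp add: gact_lin)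
  next
    case Z
    then show ?thesis using zo_comm[OF vH, of "L 0"] wt_eq[OF v] vH by (simp add: gact_lin)
  qed
qed

lemma ps_wt: "v \<in> wt \<alpha> \<Longrightarrow> ps n v \<in> wt (\<alpha> - of_int n)"
  using gact_wt[of v \<alpha> "Psi n"] by simp

text \<open>Applying L_0 - \<beta> removes the component of weight \<beta> and multiplies every
  other one by a nonzero scalar, so the remaining components lie in \<open>N\<close> by induction,
  and then the removed one does as well.\<close>

lemma wt_stable_decomp:
  assumes N: "subspace N" "\<And>v. v \<in> N \<Longrightarrow> lo 0 v \<in> N"
    and "finite A" "\<And>\<alpha>. \<alpha> \<in> A \<Longrightarrow> x \<alpha> \<in> wt \<alpha>" "(\<Sum>\<alpha>\<in>A. x \<alpha>) \<in> N"
  shows "\<forall>\<alpha>\<in>A. x \<alpha> \<in> N"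
  using assms(3-5)
proof (induction A arbitrary: x)
  case (insert \<beta> A)
  have xH: "x \<alpha> \<in> H" if "\<alpha> \<in> insert \<beta> A" for \<alpha> using insert.prems(1)[OF that] by (rule wt_H)
  let ?v = "\<Sum>\<alpha>\<in>insert \<beta> A. x \<alpha>"
  have "lo 0 ?v = (\<Sum>\<alpha>\<in>insert \<beta> A. lo 0 (x \<alpha>))" by (rule gact_sum) (rule xH)
  also have "\<dots> = (\<Sum>\<alpha>\<in>insert \<beta> A. s \<alpha> (x \<alpha>))" by (rule sum.cong) (auto intro: wt_eq insert.prems(1))
  finally have "lo 0 ?v - s \<beta> ?v = (\<Sum>\<alpha>\<in>insert \<beta> A. s \<alpha> (x \<alpha>) - s \<beta> (x \<alpha>))"
    by (simp add: sum_subtractf scale_sum_right)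
  also have "\<dots> = (\<Sum>\<alpha>\<in>A. s (\<alpha> - \<beta>) (x \<alpha>))"
    using insert.hyps by (simp add: scale_left_diff_distrib)
  finally have "lo 0 ?v - s \<beta> ?v = (\<Sum>\<alpha>\<in>A. s (\<alpha> - \<beta>) (x \<alpha>))" .
  moreover have "lo 0 ?v - s \<beta> ?v \<in> N"
    by (intro subspace_diff[OF N(1)] subspace_scale[OF N(1)] N(2) insert.prems(2))
  ultimately have "(\<Sum>\<alpha>\<in>A. s (\<alpha> - \<beta>) (x \<alpha>)) \<in> N" by (simp only:)
  moreover have "s (\<alpha> - \<beta>) (x \<alpha>) \<in> wt \<alpha>" if "\<alpha> \<in> A" for \<alpha>
    using insert.prems(1) that subspace_scale[OF subspace_wt] by blast
  ultimately have IH: "\<forall>\<alpha>\<in>A. s (\<alpha> - \<beta>) (x \<alpha>) \<in> N" using insert.IH[of "\<lambda>\<alpha>. s (\<alpha> - \<beta>) (x \<alpha>)"] by blast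
  have xN: "x \<alpha> \<in> N" if "\<alpha> \<in> A" for \<alpha>
  proof -
    have "\<alpha> - \<beta> \<noteq> 0" using that insert.hyps by auto
    moreover have "s (inverse (\<alpha> - \<beta>)) (s (\<alpha> - \<beta>) (x \<alpha>)) \<in> N" using IH that subspace_scale[OF N(1)] by blast
    ultimately show ?thesis by simp
  qed
  then have "?v - (\<Sum>\<alpha>\<in>A. x \<alpha>) \<in> N"
    by (intro subspace_diff[OF N(1)] subspace_sum[OF N(1)] insert.prems(2))
  then have "x \<beta> \<in> N" using insert.hyps by simp
  then show ?case using xN by blast
qed simp

lemma wt_sum_zero:
  assumes "finite A" "\<And>\<alpha>. \<alpha> \<in> A \<Longrightarrow> x \<alpha> \<in> wt \<alpha>" "(\<Sum>\<alpha>\<in>A. x \<alpha>) = 0" "\<alpha> \<in> A"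
  shows "x \<alpha> = 0"
  using wt_stable_decomp[OF subspace_single_0 _ assms(1,2)] assms(3,4) by auto

lemma wt_span_decomp:
  assumes "v \<in> span (\<Union>\<alpha>\<in>S. wt \<alpha>)"
  obtains A x where "finite A" "A \<subseteq> S" "\<And>\<alpha>. x \<alpha> \<in> wt \<alpha>" "v = (\<Sum>\<alpha>\<in>A. x \<alpha>)"
proof -
  have "\<exists>A x. finite A \<and> A \<subseteq> S \<and> (\<forall>\<alpha>. x \<alpha> \<in> wt \<alpha>) \<and> (\<forall>\<alpha>. \<alpha> \<notin> A \<longrightarrow> x \<alpha> = 0) \<and> v = (\<Sum>\<alpha>\<in>A. x \<alpha>)"
    using assms
  proof (induction rule: span_induct_alt)
    case base
    show ?case by (rule exI[of _ "{}"], rule exI[of _ "\<lambda>_. 0"]) (simp add: subspace_0[OF subspace_wt])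
  next
    case (step c y v)
    obtain \<beta> where \<beta>: "\<beta> \<in> S" "y \<in> wt \<beta>" using step.hyps by blast
    obtain A x where A: "finite A" "A \<subseteq> S" "\<forall>\<alpha>. x \<alpha> \<in> wt \<alpha>" "\<forall>\<alpha>. \<alpha> \<notin> A \<longrightarrow> x \<alpha> = 0" "v = (\<Sum>\<alpha>\<in>A. x \<alpha>)"
      using step.IH by blast
    define x' where "x' \<alpha> = (if \<alpha> = \<beta> then s c y else 0) + x \<alpha>" for \<alpha>
    have v: "v = (\<Sum>\<alpha>\<in>insert \<beta> A. x \<alpha>)" using A by (cases "\<beta> \<in> A") (simp_all add: insert_absorb)
    have "s c y + v = (\<Sum>\<alpha>\<in>insert \<beta> A. x' \<alpha>)" unfolding x'_def sum.distrib v using A(1) by simp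
    moreover have "x' \<alpha> \<in> wt \<alpha>" for \<alpha>
      unfolding x'_def using A(3) \<beta> subspace_0[OF subspace_wt] subspace_add[OF subspace_wt] subspace_scale[OF subspace_wt] by auto
    ultimately show ?case using A \<beta>
      by (intro exI[of _ "insert \<beta> A"] exI[of _ x']) (auto simp: x'_def)
  qed
  then show thesis using that by blast
qed

lemma wt_parity:
  assumes "a \<in> grade W 0" "b \<in> grade W 1" "a + b \<in> wt \<alpha>"
  shows "a \<in> wt \<alpha>" "b \<in> wt \<alpha>"
proof -
  have H: "a \<in> H" "b \<in> H" using assms grade_H by blast+
  have "lo 0 a + lo 0 b = s \<alpha> a + s \<alpha> b"
    using wt_eq[OF assms(3)] H by (simp add: gact_lin scale_right_distrib)
  moreover have "lo 0 a \<in> grade W 0" "lo 0 b \<in> grade W 1"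
    using gact_grade[OF assms(1), of "L 0"] gact_grade[OF assms(2), of "L 0"] by simp_all
  moreover have "s \<alpha> a \<in> grade W 0" "s \<alpha> b \<in> grade W 1" using assms subspace_scale[OF subspace_grade] by blast+
  ultimately have "lo 0 a = s \<alpha> a \<and> lo 0 b = s \<alpha> b" using H_decomp_unique by blast
  then show "a \<in> wt \<alpha>" "b \<in> wt \<alpha>" using H wtI by blast+
qed

text \<open>The operators \<open>Q m\<close> pick out single coefficients of a linear relation, so
  the vectors \<open>y n\<close> are independent. This turns finite dimension into a bound, both for
  sign changes and for the weights of vacuum vectors.\<close>

lemma card_le_separated:
  assumes B: "finite B" and T: "finite T" and y: "\<And>n. n \<in> T \<Longrightarrow> y n \<in> span B" "\<And>n. n \<in> T \<Longrightarrow> y n \<in> H"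
    and Q: "\<And>m. m \<in> T \<Longrightarrow> linear_map_on s s H (Q m)"
      "\<And>m n. m \<in> T \<Longrightarrow> n \<in> T \<Longrightarrow> m \<noteq> n \<Longrightarrow> Q m (y n) = 0" "\<And>m. m \<in> T \<Longrightarrow> Q m (y m) \<noteq> 0"
  shows "card T \<le> card B"
proof -
  have inj: "inj_on y T" using Q(2,3) by (metis inj_onI)
  have "independent (y ` T)"
  proof
    assume "dependent (y ` T)"
    then obtain u where u: "\<exists>v\<in>y ` T. u v \<noteq> 0" "(\<Sum>v\<in>y ` T. s (u v) v) = 0"
      using dependent_finite[OF finite_imageI[OF T]] by blast
    then obtain m where m: "m \<in> T" "u (y m) \<noteq> 0" by blast
    have "0 = Q m (\<Sum>n\<in>T. s (u (y n)) (y n))"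
      \<comment> \<open>The empty sum yields \<open>Q m 0 = 0\<close>.\<close>
      using u(2) Q(1)[OF m(1)] linear_map_on_sum[OF vector_space_axioms vector_space_axioms subspace_H Q(1)[OF m(1)], of "{}"]
      by (simp add: sum.reindex[OF inj])
    also have "\<dots> = (\<Sum>n\<in>T. Q m (s (u (y n)) (y n)))"
      using y by (intro linear_map_on_sum[OF vector_space_axioms vector_space_axioms subspace_H Q(1)[OF m(1)]]) auto
    also have "\<dots> = (\<Sum>n\<in>T. if n = m then s (u (y m)) (Q m (y m)) else 0)"
      using Q(1,2) m y(2) by (intro sum.cong) (auto simp: linear_map_on_def)
    also have "\<dots> = s (u (y m)) (Q m (y m))" using T m by simp
    finally show False using m Q(3) by simp
  qed
  then have "card (y ` T) \<le> card B" using y(1) independent_span_bound[OF B] by blast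
  then show ?thesis by (simp add: card_image[OF inj])
qed

end

section \<open>Consequences of simplicity together with finite-dimensional weight spaces\<close>

locale hc_module = simple_fv_module +
  assumes hc: "harish_chandra FV W"
begin

lemma wt_finite: obtains B where "finite B" "wt \<alpha> \<subseteq> span B"
  using hc unfolding harish_chandra_def by blast

lemma H_span_wt: "H = span (\<Union>\<alpha>. wt \<alpha>)"
  using hc unfolding harish_chandra_def weight_module_def by blast

lemma wt_decomp:
  assumes "v \<in> H"
  obtains A x where "finite A" "\<And>\<alpha>. x \<alpha> \<in> wt \<alpha>" "v = (\<Sum>\<alpha>\<in>A. x \<alpha>)"
  using wt_span_decomp[of v UNIV] assms H_span_wt by blast

lemma exists_weight_vector:
  obtains \<alpha> p v where "v \<in> wt \<alpha>" "v \<in> grade W p" "v \<noteq> 0"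
proof -
  obtain v where v: "v \<in> H" "v \<noteq> 0" by (rule H_nonzero)
  obtain A x where Ax: "\<And>\<alpha>. x \<alpha> \<in> wt \<alpha>" "v = (\<Sum>\<alpha>\<in>A. x \<alpha>)" using wt_decomp[OF v(1)] by metis
  then obtain \<alpha> where \<alpha>: "x \<alpha> \<noteq> 0" using v(2) by (metis sum.neutral)
  obtain a b where ab: "a \<in> grade W 0" "b \<in> grade W 1" "x \<alpha> = a + b" using H_decomp wt_H Ax(1) by metis
  then have p: "a \<in> wt \<alpha>" "b \<in> wt \<alpha>" using wt_parity[of a b \<alpha>] Ax(1)[of \<alpha>] by auto
  show thesis
  proof (cases "a = 0")
    case True
    then have "b \<noteq> 0" using \<alpha> ab by simp
    then show thesis by (rule that[OF p(2) ab(2)])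
  qed (rule that[OF p(1) ab(1)])
qed

text \<open>Generators shift weights by integers, so a homogeneous weight vector generates a
  submodule with weights in a single coset of the integers; by simplicity this is the whole
  module.\<close>

lemma wt_coset:
  assumes "u \<in> wt \<alpha>" "u \<noteq> 0" "v \<in> wt \<beta>" "v \<noteq> 0"
  shows "\<exists>n::int. \<beta> = \<alpha> + of_int n"
proof (rule ccontr)
  assume no: "\<nexists>n::int. \<beta> = \<alpha> + of_int n"
  let ?S = "{\<alpha> + of_int n | n :: int. True}"
  obtain a b where ab: "a \<in> grade W 0" "b \<in> grade W 1" "u = a + b" using H_decomp wt_H assms(1) by metis
  then have p: "a \<in> wt \<alpha>" "b \<in> wt \<alpha>" using wt_parity[of a b \<alpha>] assms(1) by auto
  have "a \<noteq> 0 \<or> b \<noteq> 0" using ab assms(2) by auto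
  then obtain y p where y: "y \<in> grade W p" "y \<in> wt \<alpha>" "y \<noteq> 0" using ab p by blast
  have "word ws y \<in> (\<Union>\<gamma>\<in>?S. wt \<gamma>)" for ws
  proof (induction ws)
    case Nil
    have "\<alpha> \<in> ?S" by (intro CollectI exI[of _ 0]) simp
    then show ?case using y(2) by (simp only: word_def foldr.simps id_apply UN_iff) blast
  next
    case (Cons g ws)
    then obtain n :: int where "word ws y \<in> wt (\<alpha> + of_int n)" by auto
    from gact_wt[OF this, of g] have "word (g # ws) y \<in> wt (\<alpha> + of_int n - of_int (gen_shift g))"
      by (simp add: word_def)
    moreover have "\<alpha> + of_int n - of_int (gen_shift g) \<in> ?S"
      by (intro CollectI exI[of _ "n - gen_shift g"]) simp
    ultimately show ?case by blast
  qed
  then have "span (range (\<lambda>ws. word ws y)) \<subseteq> span (\<Union>\<gamma>\<in>?S. wt \<gamma>)" by (intro span_mono) auto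
  then have "v \<in> span (\<Union>\<gamma>\<in>?S. wt \<gamma>)" using word_generates[OF y(1,3) wt_H[OF assms(3)]] by blast
  then obtain A x where A: "finite A" "A \<subseteq> ?S" "\<And>\<gamma>. x \<gamma> \<in> wt \<gamma>" "v = (\<Sum>\<gamma>\<in>A. x \<gamma>)"
    using wt_span_decomp by blast
  have nA: "\<beta> \<notin> A" using A(2) no by auto
  \<comment> \<open>Moving \<open>v\<close> to the other side gives a vanishing sum of vectors of
    different weights.\<close>
  define x' where "x' \<gamma> = (if \<gamma> = \<beta> then - v else x \<gamma>)" for \<gamma>
  have "(\<Sum>\<gamma>\<in>A. x' \<gamma>) = (\<Sum>\<gamma>\<in>A. x \<gamma>)" using nA by (intro sum.cong) (auto simp: x'_def)
  then have "(\<Sum>\<gamma>\<in>insert \<beta> A. x' \<gamma>) = 0" using A nA by (simp add: x'_def)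
  moreover have "x' \<gamma> \<in> wt \<gamma>" for \<gamma> using A(3) assms(3) subspace_neg[OF subspace_wt] by (auto simp: x'_def)
  ultimately have "x' \<beta> = 0" using A(1) by (intro wt_sum_zero[of "insert \<beta> A" x']) auto
  then show False using assms(4) by (simp add: x'_def)
qed

text \<open>Schur's lemma: z preserves a finite-dimensional weight space and has an eigenvector
  there, and its eigenspaces are graded submodules because z is even and central.\<close>

lemma zo_scalar: "\<exists>\<zeta>. \<forall>v\<in>H. zo v = s \<zeta> v"
proof -
  obtain \<alpha> p w where w: "w \<in> wt \<alpha>" "w \<noteq> 0" using exists_weight_vector by metis
  obtain B where B: "finite B" "wt \<alpha> \<subseteq> span B" by (rule wt_finite)
  have "linear_map_on s s (wt \<alpha>) zo" using wt_H by (auto simp: linear_map_on_def gact_lin)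
  moreover have "zo v \<in> wt \<alpha>" if "v \<in> wt \<alpha>" for v using gact_wt[OF that, of Z] by simp
  ultimately obtain \<zeta> v where v: "v \<in> wt \<alpha>" "v \<noteq> 0" "zo v = s \<zeta> v"
    using exists_eigenvector[OF vector_space_axioms subspace_wt w B] by metis
  let ?N = "{v \<in> H. zo v = s \<zeta> v}"
  have "graded_submodule FV W ?N"
  proof (rule graded_submoduleI)
    show "subspace ?N"
      by (auto simp: subspace_def gact_lin scale_right_distrib mult.commute)
    fix g u assume u: "u \<in> ?N"
    then show "gact W g u \<in> ?N" using zo_comm[of u g] by (auto simp: gact_lin)
    obtain a b where ab: "a \<in> grade W 0" "b \<in> grade W 1" "u = a + b" using H_decomp u by blast
    then have H: "a \<in> H" "b \<in> H" using grade_H by blast+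
    then have "zo a + zo b = s \<zeta> a + s \<zeta> b" using u ab by (simp add: gact_lin scale_right_distrib)
    moreover have "zo a \<in> grade W 0" "zo b \<in> grade W 1"
      using gact_grade[OF ab(1), of Z] gact_grade[OF ab(2), of Z] by simp_all
    moreover have "s \<zeta> a \<in> grade W 0" "s \<zeta> b \<in> grade W 1" using ab subspace_scale[OF subspace_grade] by blast+
    ultimately have "zo a = s \<zeta> a \<and> zo b = s \<zeta> b" using H_decomp_unique by blast
    then show "\<exists>a\<in>?N \<inter> grade W 0. \<exists>b\<in>?N \<inter> grade W 1. u = a + b" using ab H by blast
  qed auto
  then have "?N = H" using v wt_H by (intro submodule_full) auto
  then show ?thesis by blast
qed

end

section \<open>Nonzero scalar \<zeta>: idempotents and the dichotomy\<close>

locale charged_module = hc_module +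
  fixes \<zeta> :: complex
  assumes zeta: "\<zeta> \<noteq> 0" and zo_zeta: "\<And>v. v \<in> carr W \<Longrightarrow> gact W Z v = scl W \<zeta> v"
begin

lemma ps_anti: "v \<in> H \<Longrightarrow> m \<noteq> - n \<Longrightarrow> ps m (ps n v) = - ps n (ps m v)"
  using ps_ps[of v m n] by simp

lemma ps_conj: "v \<in> H \<Longrightarrow> ps n (ps (- n) v) = s \<zeta> v - ps (- n) (ps n v)"
  using ps_ps[of v n "- n"] zo_zeta by simp

lemma ps_sq: "v \<in> H \<Longrightarrow> n \<noteq> 0 \<Longrightarrow> ps n (ps n v) = 0"
proof -
  assume "v \<in> H" "n \<noteq> 0"
  then have "ps n (ps n v) = - ps n (ps n v)" using ps_anti[of v n n] by simp
  then have "ps n (ps n v) + ps n (ps n v) = 0" by (metis add.right_inverse)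
  then have "s 2 (ps n (ps n v)) = 0" by (metis scale_left_distrib one_add_one scale_one)
  then show ?thesis by simp
qed

text \<open>As psi_n has square zero for n \<noteq> 0, the product psi_n psi_(-n) psi_n equals
  \<zeta> psi_n.\<close>

lemma ps_proj_nonzero:
  assumes v: "v \<in> H" and n: "n \<noteq> 0" "ps n v \<noteq> 0" shows "ps (- n) (ps n v) \<noteq> 0"
proof
  assume 0: "ps (- n) (ps n v) = 0"
  have "s \<zeta> (ps n v) = ps n (ps (- n) (ps n v)) + ps (- n) (ps n (ps n v))"
    using ps_conj[of "ps n v" n] v by simp
  also have "\<dots> = 0" using 0 ps_sq[OF v n(1)] by simp
  finally show False using zeta n by simp
qed

lemma ps_proj_kill:
  assumes "v \<in> H" "ps i v = 0" "i \<noteq> k" "i \<noteq> - k" shows "ps i (ps (- k) (ps k v)) = 0"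
  using assms ps_anti[of "ps k v" i "- k"] ps_anti[of v i k] by (simp add: gact_neg)

text \<open>In the code a sign change of \<open>v\<close> at n means psi_(-n) v = 0 = psi_(n+1) v:
  the idempotent number n is 1 on \<open>v\<close> and number n + 1 is 0. If both alternatives fail,
  every nonzero vector admits further projections at arbitrarily large indices, so vectors of weight
  \<alpha> with any number of sign changes exist. Each change n yields a vector psi_(-(n+1)) psi_n v
  of weight \<alpha> + 1, and psi_(-m) psi_(m+1) maps the vector of the change m to \<zeta>^2 v and
  those of the other changes to 0.\<close>

lemma psi_dichotomy:
  "(\<exists>v N. v \<in> H \<and> v \<noteq> 0 \<and> (\<forall>n\<ge>N. ps n v = 0)) \<or> (\<exists>v N. v \<in> H \<and> v \<noteq> 0 \<and> (\<forall>n\<ge>N. ps (- n) v = 0))"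
proof (rule ccontr)
  assume neg: "\<not> ?thesis"
  then have A: "\<exists>n\<ge>N. ps n v \<noteq> 0" and B: "\<exists>n\<ge>N. ps (- n) v \<noteq> 0" if "v \<in> H" "v \<noteq> 0" for v N
    using that by blast+
  obtain \<alpha> p v0 where v0: "v0 \<in> wt \<alpha>" "v0 \<noteq> 0" using exists_weight_vector by metis
  have many: "\<exists>v T M. v \<in> wt \<alpha> \<and> v \<noteq> 0 \<and> finite T \<and> card T = K \<and> M > 0 \<and> T \<subseteq> {1..<M} \<and>
      (\<forall>n\<in>T. ps (- n) v = 0 \<and> ps (n + 1) v = 0)" for K
  proof (induction K)
    case 0
    then show ?case using v0 by (intro exI[of _ v0] exI[of _ "{}"] exI[of _ 1]) auto
  next
    case (Suc K)
    then obtain v T M where v: "v \<in> wt \<alpha>" "v \<noteq> 0" and T: "finite T" "card T = K" "M > 0" "T \<subseteq> {1..<M}"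
      and kill: "\<And>n. n \<in> T \<Longrightarrow> ps (- n) v = 0" "\<And>n. n \<in> T \<Longrightarrow> ps (n + 1) v = 0" by blast
    have vH: "v \<in> H" using v by (simp add: wt_H)
    \<comment> \<open>Beyond all indices used so far, make the idempotent number k equal to 1 by
      projecting with psi_(-k) psi_k.\<close>
    obtain k where k: "k \<ge> M + 1" "ps k v \<noteq> 0" using A[OF vH v(2), of "M + 1"] by blast
    define v' where "v' = ps (- k) (ps k v)"
    have v': "v' \<noteq> 0" unfolding v'_def using ps_proj_nonzero[OF vH _ k(2)] k(1) T(3) by auto
    have v'w: "v' \<in> wt \<alpha>" using ps_wt[OF ps_wt[OF v(1), of k], of "- k"] by (simp add: v'_def)
    then have v'H: "v' \<in> H" by (simp add: wt_H)
    have k0: "ps (- k) v' = 0" unfolding v'_def using k T vH by (intro ps_sq) auto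
    obtain j where j: "j \<ge> k + 1" "ps (- j) v' \<noteq> 0" using B[OF v'H v', of "k + 1"] by blast
    \<comment> \<open>The first index \<open>k'\<close> above \<open>k\<close> at which the
      idempotent is not 1 on \<open>v'\<close>. Projecting it to 0 there produces a sign change at
      \<open>k' - 1\<close>, which may be \<open>k\<close> itself.\<close>
    define d where "d = (LEAST d. ps (- (k + 1 + int d)) v' \<noteq> 0)"
    have ex: "ps (- (k + 1 + int (nat (j - k - 1)))) v' \<noteq> 0" using j by simp
    define k' where "k' = k + 1 + int d"
    have d: "ps (- k') v' \<noteq> 0" unfolding d_def k'_def using ex by (rule LeastI)
    have k1: "ps (- (k' - 1)) v' = 0"
    proof (cases d)
      case 0 then show ?thesis using k0 by (simp add: k'_def)
    next
      case (Suc e)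
      then have "ps (- (k + 1 + int e)) v' = 0"
        using not_less_Least[of e "\<lambda>d. ps (- (k + 1 + int d)) v' \<noteq> 0"] unfolding d_def by auto
      then show ?thesis using Suc by (simp add: k'_def algebra_simps)
    qed
    define v'' where "v'' = ps (- (- k')) (ps (- k') v')"
    have k': "k' > k" by (simp add: k'_def)
    have kpos: "k > 0" using k T by simp
    have v'': "v'' \<noteq> 0" unfolding v''_def using ps_proj_nonzero[OF v'H _ d] k' kpos by auto
    have v''w: "v'' \<in> wt \<alpha>" using ps_wt[OF ps_wt[OF v'w, of "- k'"], of "k'"] by (simp add: v''_def)
    \<comment> \<open>Both projections use indices above \<open>M\<close>, so they leave the old
      conditions intact. These involve indices up to n + 1 \<le> M, as \<open>T\<close> stops below
      \<open>M\<close>.\<close>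
    have pres: "ps i v'' = 0" if "ps i v = 0" "\<bar>i\<bar> \<le> M" for i
    proof -
      have "ps i v' = 0" unfolding v'_def using that k kpos by (intro ps_proj_kill vH) auto
      then show ?thesis unfolding v''_def using that k k' kpos by (intro ps_proj_kill v'H) auto
    qed
    have b1: "ps (- (k' - 1)) v'' = 0" unfolding v''_def using k1 k' kpos by (intro ps_proj_kill v'H) auto
    have b2: "ps (k' - 1 + 1) v'' = 0"
      unfolding v''_def using k' kpos v'H ps_sq[of "ps (- k') v'" k'] by simp
    have notin: "k' - 1 \<notin> T" using T(4) k(1) k' by auto
    show ?case
    proof (intro exI[of _ v''] exI[of _ "insert (k' - 1) T"] exI[of _ "k'"] conjI ballI)
      show "card (insert (k' - 1) T) = Suc K" using T notin by simp
      show "insert (k' - 1) T \<subseteq> {1..<k'}" using T(4) k k' kpos by auto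
      fix n assume n: "n \<in> insert (k' - 1) T"
      have "ps (- n) v'' = 0 \<and> ps (n + 1) v'' = 0"
      proof (cases "n = k' - 1")
        case True then show ?thesis using b1 b2 by simp
      next
        case False
        then have "n \<in> T" using n by simp
        then show ?thesis using kill T(4) by (intro conjI pres) auto
      qed
      then show "ps (- n) v'' = 0" "ps (n + 1) v'' = 0" by blast+
    qed (use v'' v''w T k' kpos in auto)
  qed
  obtain B where B: "finite B" "wt (\<alpha> + 1) \<subseteq> span B" by (rule wt_finite)
  obtain v T M where v: "v \<in> wt \<alpha>" "v \<noteq> 0" and T: "finite T" "card T = Suc (card B)" "M > 0" "T \<subseteq> {1..<M}"
      and kill: "\<And>n. n \<in> T \<Longrightarrow> ps (- n) v = 0" "\<And>n. n \<in> T \<Longrightarrow> ps (n + 1) v = 0" using many by metis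
  have vH: "v \<in> H" using v by (simp add: wt_H)
  define y where "y n = ps (- (n + 1)) (ps n v)" for n
  define Q where "Q m u = ps (- m) (ps (m + 1) u)" for m u
  have pos: "n \<ge> 1" if "n \<in> T" for n using T that by auto
  have "card T \<le> card B"
  proof (rule card_le_separated[OF B(1) T(1), of y Q])
    fix n assume n: "n \<in> T"
    have "y n \<in> wt (\<alpha> + 1)" using ps_wt[OF ps_wt[OF v(1), of n], of "- (n + 1)"] by (simp add: y_def)
    then show "y n \<in> span B" using B by blast
    show "y n \<in> H" by (simp add: y_def vH)
  next
    show "linear_map_on s s H (Q m)" for m by (auto simp: linear_map_on_def Q_def gact_lin)
  next
    fix m n assume mn: "m \<in> T" "n \<in> T" "m \<noteq> n"
    have "ps (m + 1) (y n) = - ps (- (n + 1)) (ps (m + 1) (ps n v))"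
      unfolding y_def using mn by (intro ps_anti) (auto simp: vH)
    also have "ps (m + 1) (ps n v) = - ps n (ps (m + 1) v)"
      using pos[OF mn(1)] pos[OF mn(2)] by (intro ps_anti vH) linarith
    finally show "Q m (y n) = 0" using kill mn by (simp add: Q_def)
  next
    fix m assume m: "m \<in> T"
    have "ps (m + 1) (ps m v) = - ps m (ps (m + 1) v)"
      using pos[OF m] by (intro ps_anti vH) linarith
    then have "ps (m + 1) (y m) = s \<zeta> (ps m v)"
      unfolding y_def using ps_conj[of "ps m v" "m + 1"] kill m vH by simp
    moreover have "ps (- m) (ps m v) = s \<zeta> v" using ps_conj[of v "- m"] kill m vH by simp
    ultimately show "Q m (y m) \<noteq> 0" using zeta v vH by (simp add: Q_def gact_lin)
  qed
  then show False using T(2) by simp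
qed

end

section \<open>Vacuum vectors and the coset Virasoro algebra\<close>

text \<open>Ordered products of modes are written with increasing indices, so a new least index is
  applied outermost.\<close>

lemma fset_min_induct [case_names empty insert]:
  fixes I :: "'a::linorder fset"
  assumes "P {||}" "\<And>m I. (\<And>i. i |\<in>| I \<Longrightarrow> m < i) \<Longrightarrow> P I \<Longrightarrow> P (finsert m I)"
  shows "P I"
proof (induction "fcard I" arbitrary: I)
  case 0
  then show ?case using assms(1) by simp
next
  case (Suc n)
  then have ne: "fset I \<noteq> {}" by (auto simp: fcard.rep_eq)
  define m where "m = Min (fset I)"
  have m: "m |\<in>| I" unfolding m_def using ne by (intro Min_in) auto
  have I: "I = finsert m (I |-| {|m|})" using m by auto
  have "m < i" if "i |\<in>| I |-| {|m|}" for i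
    using that Min_le[of "fset I" i] unfolding m_def by (auto simp: order_le_less)
  moreover have "fcard I = Suc (fcard (I |-| {|m|}))"
    using I fcard_finsert_disjoint[of m "I |-| {|m|}"] by simp
  then have "P (I |-| {|m|})" using Suc by (intro Suc.hyps) simp
  ultimately show ?case by (subst I) (rule assms(2))
qed

section \<open>Parity on the Fock space\<close>

lemma fock_carr: "carr fock = UNIV"
proof -
  have "f \<in> carr fock" for f
  proof -
    have "f = restrict_keys {I. (of_nat (fcard I) :: bit) = 0} f + restrict_keys {I. (of_nat (fcard I) :: bit) = 1} f"
      by (rule poly_mapping_eqI)
         (auto simp: restrict_keys_def lookup_add lookup_sum lookup_single when_def in_keys_iff if_distrib cong: if_cong)
    moreover have "restrict_keys {I. (of_nat (fcard I) :: bit) = p} f \<in> grade fock p" for p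
      by (auto simp: fock_def restrict_keys_def in_keys_iff lookup_sum lookup_single when_def if_distrib cong: if_cong split: if_splits)
    ultimately show ?thesis unfolding carr_def by blast
  qed
  then show ?thesis by blast
qed

lemma subspace_fock_grade: "pm.subspace (grade fock p)"
  unfolding pm.subspace_def
proof (intro conjI ballI allI)
  fix f g assume "f \<in> grade fock p" "g \<in> grade fock p"
  then show "f + g \<in> grade fock p" using Poly_Mapping.keys_add[of f g] by (auto simp: fock_def)
qed (auto simp: fock_def in_keys_iff)

lemma single_fock_grade: "Poly_Mapping.single I c \<in> grade fock (of_nat (fcard I))"
  by (auto simp: fock_def in_keys_iff lookup_single when_def)

lemma psi_op_grade:
  assumes "f \<in> grade fock p" shows "psi_op n f \<in> grade fock (p + 1)"
proof -
  have S: "psi_op n (Poly_Mapping.single I 1) \<in> grade fock (of_nat (fcard I) + 1)" for I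
  proof -
    have x: "ext_mult (xi m) (Poly_Mapping.single I 1) \<in> grade fock (of_nat (fcard I) + 1)" for m
    proof (cases "m |\<in>| I")
      case False
      then have "of_nat (fcard (finsert m I)) = (of_nat (fcard I) + 1 :: bit)" by (simp add: fcard_finsert_disjoint add.commute)
      then show ?thesis using False single_fock_grade[of "finsert m I"] by (simp add: xi_mult_single)
    qed (use pm.subspace_0[OF subspace_fock_grade] in \<open>simp add: xi_mult_single\<close>)
    have y: "ext_deriv m (Poly_Mapping.single I 1) \<in> grade fock (of_nat (fcard I) + 1)" for m
    proof (cases "m |\<in>| I")
      case True
      then have "I = finsert m (I |-| {|m|})" "m |\<notin>| I |-| {|m|}" by auto
      then have "fcard I = Suc (fcard (I |-| {|m|}))" by (metis fcard_finsert_disjoint)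
      then have "of_nat (fcard (I |-| {|m|})) = (of_nat (fcard I) + 1 :: bit)" by (simp add: add.commute)
      then show ?thesis using True single_fock_grade[of "I |-| {|m|}"] by (simp add: ext_deriv_single)
    qed (use pm.subspace_0[OF subspace_fock_grade] in \<open>simp add: ext_deriv_single\<close>)
    show ?thesis using x y pm.subspace_add[OF subspace_fock_grade] pm.subspace_scale[OF subspace_fock_grade]
      by (simp add: psi_op_def)
  qed
  have "psi_op n f = (\<Sum>k\<in>Poly_Mapping.keys f. pscale (Poly_Mapping.lookup f k) (psi_op n (Poly_Mapping.single k 1)))"
    by (rule linear_extension_unique[of "psi_op n"]) (rule psi_op_lin)+
  moreover have "psi_op n (Poly_Mapping.single k 1) \<in> grade fock (p + 1)" if "k \<in> Poly_Mapping.keys f" for k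
    using S[of k] assms that by (simp add: fock_def)
  ultimately show ?thesis
    by (simp only: pm.subspace_sum[OF subspace_fock_grade] pm.subspace_scale[OF subspace_fock_grade])
qed

lemma Lbar_grade:
  assumes f: "f \<in> grade fock p" shows "Lbar k f \<in> grade fock p"
proof -
  obtain S where S: "finite S" "\<And>j. j \<notin> S \<Longrightarrow> normal_ordered (- j) (j + k) f = 0"
    using normal_ordered_finite[where k = k and f = f] by blast
  note sub = subspace_fock_grade[of p]
  have "psi_op a (psi_op b f) \<in> grade fock p" for a b
  proof -
    have "p + 1 + 1 = p" by (cases p) simp_all
    then show ?thesis using psi_op_grade[OF psi_op_grade[OF f, of b], of a] by (simp only:)
  qed
  then have "normal_ordered (- j) (j + k) f \<in> grade fock p" for j
    unfolding normal_ordered_def using pm.subspace_neg[OF sub] by auto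
  moreover have "Lbar k f = pscale (if k = 0 then 1 / 16 else 0) f
    + pscale (1 / 2) (\<Sum>j\<in>S. pscale (of_int j) (normal_ordered (- j) (j + k) f))"
    by (rule Lbar_sum[OF S(1)]) (simp add: S(2))
  ultimately show ?thesis using f
    by (simp only: pm.subspace_add[OF sub] pm.subspace_scale[OF sub] pm.subspace_sum[OF sub])
qed

text \<open>A twist by \<open>lam\<close> multiplies the action of z on the Fock module by the
  square of \<open>lam\<close>, whence the equation imposed on \<open>lam\<close>.\<close>

locale restricted_module = charged_module +
  fixes lam :: complex
  assumes lam: "lam\<^sup>2 = \<zeta>"
    and exists_restricted: "\<exists>v N. v \<in> carr W \<and> v \<noteq> 0 \<and> (\<forall>n\<ge>N. gact W (Psi n) v = 0)"
begin

lemma lam0: "lam \<noteq> 0" and lam_lam: "lam * lam = \<zeta>"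
  using lam zeta by (auto simp: power2_eq_square)

text \<open>Counterparts of left multiplication by \<open>\<xi>\<^sub>n\<close>; only \<open>mode 0\<close>, whose square is the identity, deviates from
  the relations of the exterior algebra.\<close>

definition mode :: "nat \<Rightarrow> 'a \<Rightarrow> 'a" where
  "mode n v = (if n = 0 then s (of_real (sqrt 2) / lam) (ps 0 v) else s (1 / lam) (ps (- int n) v))"

definition modes :: "nat fset \<Rightarrow> 'a \<Rightarrow> 'a" where
  "modes I v = foldr mode (sorted_list_of_set (fset I)) v"

text \<open>For a vacuum vector \<open>v\<close> this is the map f \<mapsto> f v, the F-module
  homomorphism from the Fock module twisted by \<open>lam\<close> that sends \<open>vac\<close> to
  \<open>v\<close>.\<close>

definition Theta :: "ext \<Rightarrow> 'a \<Rightarrow> 'a" where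
  "Theta f v = (\<Sum>I\<in>Poly_Mapping.keys f. s (Poly_Mapping.lookup f I) (modes I v))"

lemma mode_H [simp]: "v \<in> H \<Longrightarrow> mode n v \<in> H"
  by (simp add: mode_def)

lemma mode_lin:
  "u \<in> H \<Longrightarrow> v \<in> H \<Longrightarrow> mode n (u + v) = mode n u + mode n v"
  "u \<in> H \<Longrightarrow> mode n (s a u) = s a (mode n u)"
  by (simp_all add: mode_def gact_lin scale_right_distrib mult.commute)

lemma mode_mode:
  assumes "v \<in> H" "m \<noteq> n" shows "mode m (mode n v) = - mode n (mode m v)"
  using assms by (auto simp: mode_def gact_lin ps_anti[of v 0 "- int n"] ps_anti[of v "- int m" 0]
      ps_anti[of v "- int m" "- int n"] mult.commute)

lemma mode_sq:
  assumes "v \<in> H" shows "mode m (mode m v) = (if m = 0 then v else 0)"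
proof (cases "m = 0")
  case True
  have "ps 0 (ps 0 v) + ps 0 (ps 0 v) = s \<zeta> v" using ps_conj[OF assms, of 0] by (simp add: eq_diff_eq)
  then have "s (1 / \<zeta>) (ps 0 (ps 0 v) + ps 0 (ps 0 v)) = v" using zeta by simp
  then have "s (2 / \<zeta>) (ps 0 (ps 0 v)) = v" by (simp add: scale_right_distrib flip: scale_left_distrib)
  moreover have "of_real (sqrt 2) / lam * (of_real (sqrt 2) / lam) = 2 / \<zeta>"
    by (simp add: lam_lam flip: of_real_mult)
  ultimately show ?thesis using True assms by (simp add: mode_def gact_lin)
next
  case False
  then show ?thesis using assms by (simp add: mode_def gact_lin ps_sq)
qed

lemma modes_empty [simp]: "modes {||} v = v"
  by (simp add: modes_def)

lemma modes_insert_min: "(\<And>i. i |\<in>| I \<Longrightarrow> m < i) \<Longrightarrow> modes (finsert m I) v = mode m (modes I v)"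
proof -
  assume m: "\<And>i. i |\<in>| I \<Longrightarrow> m < i"
  then have "sorted_list_of_set (insert m (fset I)) = m # sorted_list_of_set (fset I)"
    by (subst sorted_list_of_set_insert) (auto intro!: insort_is_Cons order_less_imp_le)
  then show ?thesis by (simp add: modes_def)
qed

lemma modes_singleton [simp]: "modes {|m|} v = mode m v"
  using modes_insert_min[of "{||}" m v] by simp

lemma modes_H [simp]: "v \<in> H \<Longrightarrow> modes I v \<in> H"
  by (induction I rule: fset_min_induct) (simp_all add: modes_insert_min)

lemma modes_lin:
  assumes "u \<in> H" "v \<in> H"
  shows "modes I (u + v) = modes I u + modes I v" "modes I (s a u) = s a (modes I u)"
  using assms by (induction I rule: fset_min_induct) (simp_all add: modes_insert_min mode_lin)

lemma modes_scale: "u \<in> H \<Longrightarrow> modes I (s a u) = s a (modes I u)"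
  by (rule modes_lin)

lemma Theta_H [simp]: "v \<in> H \<Longrightarrow> Theta f v \<in> H"
  unfolding Theta_def by (intro H_sum) simp

lemma Theta_add: "Theta (f + g) v = Theta f v + Theta g v"
  unfolding Theta_def by (rule setsum_keys_plus_distrib) (simp_all add: scale_left_distrib)

lemma Theta_scale: "Theta (pscale a f) v = s a (Theta f v)"
proof (cases "a = 0")
  case False
  then have "Poly_Mapping.keys (pscale a f) = Poly_Mapping.keys f" by (auto simp: in_keys_iff)
  then show ?thesis by (simp add: Theta_def scale_sum_right)
qed (simp add: Theta_def pscale_simps)

lemma Theta_neg: "Theta (- f) v = - Theta f v"
  using Theta_scale[of "-1" f v] by simp

lemma Theta_diff: "Theta (f - g) v = Theta f v - Theta g v"
  using Theta_add[of f "- g" v] by (simp add: Theta_neg)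

lemma Theta_single: "Theta (Poly_Mapping.single I a) v = s a (modes I v)"
  by (cases "a = 0") (simp_all add: Theta_def)

lemma Theta_zero [simp]: "Theta 0 v = 0"
  by (simp add: Theta_def)

lemma Theta_vac [simp]: "Theta vac v = v"
  by (simp add: Theta_single)

lemma Theta_right:
  assumes "u \<in> H" "v \<in> H"
  shows "Theta f (u + v) = Theta f u + Theta f v" "Theta f (s a u) = s a (Theta f u)"
  using assms by (simp_all add: Theta_def modes_lin scale_right_distrib sum.distrib scale_sum_right mult.commute)

lemma Theta_right_diff: "u \<in> H \<Longrightarrow> v \<in> H \<Longrightarrow> Theta f (u - v) = Theta f u - Theta f v"
  using Theta_right(1)[of u "s (-1) v" f] Theta_right(2)[of v v f "-1"] by simp

text \<open>The new mode moves right past the smaller indices, each contributing the sign that is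
  counted in the exterior product; a repeated positive index gives zero.\<close>

lemma mode_modes_pos:
  assumes "v \<in> H" "m > 0"
  shows "mode m (modes I v) = Theta (ext_mult (xi m) (Poly_Mapping.single I 1)) v"
proof (induction I rule: fset_min_induct)
  case empty
  then show ?case by (simp add: xi_mult_single Theta_single modes_insert_min)
next
  case (insert k J)
  have kJ: "k |\<notin>| J" using insert.hyps by blast
  consider "m < k" | "m = k" | "m > k" by linarith
  then show ?case
  proof cases
    case 1
    then have less: "m < i" if "i |\<in>| finsert k J" for i using that insert.hyps by fastforce
    have "{i. i |\<in>| finsert k J \<and> i < m} = {}" using less by fastforce
    then have c: "card {i. i |\<in>| finsert k J \<and> i < m} = 0" by (simp only: card.empty)
    have mem: "m |\<notin>| finsert k J" using less by blast
    have "modes (finsert m (finsert k J)) v = mode m (modes (finsert k J) v)"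
      by (rule modes_insert_min) (rule less)
    then show ?thesis unfolding xi_mult_single if_not_P[OF mem] c by (simp add: Theta_single)
  next
    case 2
    then show ?thesis using assms mode_sq[of "modes J v" m] insert.hyps
      by (simp add: modes_insert_min xi_mult_single Theta_def)
  next
    case 3
    have "mode m (modes (finsert k J) v) = - mode k (mode m (modes J v))"
      using 3 assms mode_mode[of "modes J v" m k] insert.hyps by (simp add: modes_insert_min)
    also have "\<dots> = - mode k (Theta (ext_mult (xi m) (Poly_Mapping.single J 1)) v)"
      by (simp add: insert.IH)
    also have "\<dots> = Theta (ext_mult (xi m) (Poly_Mapping.single (finsert k J) 1)) v"
    proof (cases "m |\<in>| J")
      case True
      then show ?thesis using mode_lin(2)[of 0 k 0] by (simp add: xi_mult_single Theta_def)
    next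
      case False
      have less: "k < i" if "i |\<in>| finsert m J" for i using that insert.hyps 3 by auto
      have c: "card {i. i |\<in>| finsert k J \<and> i < m} = Suc (card {i. i |\<in>| J \<and> i < m})"
        using card_finsert_less[OF kJ, of m] 3 by simp
      have mem: "m |\<notin>| finsert k J" using False 3 by auto
      have e: "finsert m (finsert k J) = finsert k (finsert m J)" by auto
      have "modes (finsert k (finsert m J)) v = mode k (modes (finsert m J) v)"
        by (rule modes_insert_min) (rule less)
      then show ?thesis unfolding xi_mult_single c if_not_P[OF mem] if_not_P[OF False] e
        using assms by (simp add: Theta_single mode_lin)
    qed
    finally show ?thesis .
  qed
qed

text \<open>The index 0 always stands first, so no signs occur. Since \<open>mode 0\<close> has
  square one, it corresponds to xi_0 + d/dxi_0 and not to xi_0 alone.\<close>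

lemma mode_modes_0:
  assumes "v \<in> H"
  shows "mode 0 (modes I v) = Theta (ext_mult (xi 0) (Poly_Mapping.single I 1) + ext_deriv 0 (Poly_Mapping.single I 1)) v"
proof (cases "0 |\<in>| I")
  case True
  define J where "J = I |-| {|0|}"
  have I: "I = finsert 0 J" using True by (auto simp: J_def)
  have "modes I v = mode 0 (modes J v)"
    unfolding I by (rule modes_insert_min) (auto simp: J_def)
  then have "mode 0 (modes I v) = modes J v" using mode_sq[of "modes J v" 0] assms by simp
  then show ?thesis using True by (simp add: xi_mult_single ext_deriv_single Theta_single J_def)
next
  case False
  then have "modes (finsert 0 I) v = mode 0 (modes I v)"
    by (intro modes_insert_min) (metis gr0I)
  then show ?thesis using False by (simp add: xi_mult_single ext_deriv_single Theta_single)
qed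

lemma mode_Theta:
  assumes "v \<in> H"
  shows "mode m (Theta f v) = Theta (ext_mult (xi m) f + (if m = 0 then ext_deriv 0 f else 0)) v"
proof (induction f rule: ext_span_induct)
  case (single I)
  then show ?case using mode_modes_0[OF assms] mode_modes_pos[OF assms, of m] by (simp add: Theta_single)
next
  case (add f g)
  have "mode m (Theta (f + g) v) = mode m (Theta f v) + mode m (Theta g v)"
    using assms by (simp add: Theta_add mode_lin)
  then show ?case unfolding add by (simp add: Theta_add xi_mult_linear ext_deriv_linear)
next
  case (scale a f)
  have "mode m (Theta (pscale a f) v) = s a (mode m (Theta f v))"
    using assms by (simp add: Theta_scale mode_lin)
  then show ?case unfolding scale
    by (simp add: Theta_add Theta_scale xi_mult_linear ext_deriv_linear scale_right_distrib)
qed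

lemma ps_Theta_nonpos:
  assumes "v \<in> H" "n \<le> 0" shows "ps n (Theta f v) = s lam (Theta (psi_op n f) v)"
proof (cases "n = 0")
  case True
  have "(of_real (sqrt 2) :: complex) \<noteq> 0" by simp
  then have "ps 0 (Theta f v) = s (lam / of_real (sqrt 2)) (mode 0 (Theta f v))"
    using lam0 by (simp add: mode_def)
  then show ?thesis using True assms by (simp add: mode_Theta psi_op_def Theta_scale)
next
  case False
  then have "ps n (Theta f v) = s lam (mode (nat (- n)) (Theta f v))"
    using lam0 assms(2) by (simp add: mode_def)
  then show ?thesis using False assms by (simp add: mode_Theta psi_op_def)
qed

text \<open>Restricting to even vectors avoids counting the vacuum space twice: its odd half is the
  image of the even half under psi_0, which belongs to the Fock factor.\<close>

definition vacua :: "'a set" where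
  "vacua = {v \<in> grade W 0. \<forall>n>0. ps n v = 0}"

lemma vacua_H: "v \<in> vacua \<Longrightarrow> v \<in> H" and vacua_grade: "v \<in> vacua \<Longrightarrow> v \<in> grade W 0"
  and vacua_kill: "v \<in> vacua \<Longrightarrow> n > 0 \<Longrightarrow> ps n v = 0"
  by (auto simp: vacua_def intro: grade_H)

lemma subspace_vacua: "subspace vacua"
  unfolding subspace_def
proof (intro conjI ballI allI)
  show "0 \<in> vacua" by (simp add: vacua_def subspace_0[OF subspace_grade])
next
  fix x y assume "x \<in> vacua" "y \<in> vacua"
  then show "x + y \<in> vacua" using vacua_H[of x] vacua_H[of y]
    by (simp add: vacua_def gact_lin subspace_add[OF subspace_grade])
next
  fix c x assume "x \<in> vacua"
  then show "s c x \<in> vacua" using vacua_H[of x]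
    by (simp add: vacua_def gact_lin subspace_scale[OF subspace_grade])
qed

text \<open>For n > 0 the Clifford relations move psi_n through the modes, identically on both
  sides, until it meets the vacuum vector.\<close>

lemma ps_Theta:
  assumes v: "v \<in> vacua" shows "ps n (Theta f v) = s lam (Theta (psi_op n f) v)"
proof (cases "n \<le> 0")
  case True
  then show ?thesis using ps_Theta_nonpos vacua_H[OF v] by blast
next
  case False
  have vH: "v \<in> H" using v by (rule vacua_H)
  show ?thesis
  proof (induction f rule: ext_induct)
    case vac
    then show ?case using False vacua_kill[OF v] by (simp add: psi_op_vac Theta_def)
  next
    case (psi k f)
    have "s lam (ps n (Theta (psi_op k f) v)) = ps n (ps k (Theta f v))"
      using vH psi(1) by (simp add: ps_Theta_nonpos gact_lin)
    also have "\<dots> = (if n = - k then s \<zeta> (Theta f v) else 0) - ps k (ps n (Theta f v))"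
      using ps_ps[of "Theta f v" n k] vH zo_zeta by simp
    also have "ps k (ps n (Theta f v)) = s \<zeta> (Theta (psi_op k (psi_op n f)) v)"
      unfolding psi(2) using vH psi(1) by (simp add: gact_lin ps_Theta_nonpos lam_lam)
    also have "(if n = - k then s \<zeta> (Theta f v) else 0) - s \<zeta> (Theta (psi_op k (psi_op n f)) v)
        = s \<zeta> (Theta (psi_op n (psi_op k f)) v)"
      unfolding psi_op_anticomm[of n k f] Theta_diff by (simp add: scale_right_diff_distrib Theta_def)
    finally have "s lam (ps n (Theta (psi_op k f) v)) = s lam (s lam (Theta (psi_op n (psi_op k f)) v))"
      by (simp add: lam_lam)
    then show ?case using lam0 by (auto simp only: scale_cancel_left)
  next
    case (add f g)
    have "ps n (Theta (f + g) v) = ps n (Theta f v) + ps n (Theta g v)" using vH by (simp add: Theta_add gact_lin)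
    then show ?case unfolding add by (simp add: psi_op_add Theta_add scale_right_distrib)
  next
    case (scale a f)
    have "ps n (Theta (pscale a f) v) = s a (ps n (Theta f v))" using vH by (simp add: Theta_scale gact_lin)
    then show ?case unfolding scale by (simp add: psi_op_scale Theta_scale mult.commute)
  qed
qed

text \<open>The coset construction. On a vacuum vector \<open>v\<close> the term
  \<open>Theta (Lbar k vac) v\<close> is the value of the Sugawara operator of the fermions, so
  normally ordered sums have to be formed in the Fock space only.\<close>

definition coset_vir :: "int \<Rightarrow> 'a \<Rightarrow> 'a" where
  "coset_vir k v = lo k v - Theta (Lbar k vac) v"

lemma coset_vir_H [simp]: "v \<in> H \<Longrightarrow> coset_vir k v \<in> H"
  by (simp add: coset_vir_def)

lemma coset_vir_lin:
  assumes "u \<in> H" "v \<in> H"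
  shows "coset_vir k (u + v) = coset_vir k u + coset_vir k v" "coset_vir k (s a u) = s a (coset_vir k u)"
  using assms by (simp_all add: coset_vir_def gact_lin Theta_right algebra_simps)

text \<open>\<open>lo k\<close> and \<open>Lbar k\<close> have the same commutators with the psi_n.
  The formula therefore propagates from \<open>vac\<close>, where it is the definition of
  \<open>coset_vir\<close>, and exhibits the action of L_k on a tensor product.\<close>

lemma lo_Theta:
  assumes v: "v \<in> vacua"
  shows "lo k (Theta f v) = Theta (Lbar k f) v + Theta f (coset_vir k v)"
proof (induction f rule: ext_induct)
  case vac
  then show ?case by (simp add: coset_vir_def)
next
  case (psi n f)
  have vH: "v \<in> H" using v by (rule vacua_H)
  let ?c = "of_int n + of_int k / 2 :: complex"
  have "s lam (lo k (Theta (psi_op n f) v)) = lo k (ps n (Theta f v))"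
    using vH psi(1) by (simp add: ps_Theta_nonpos gact_lin)
  also have "\<dots> = ps n (lo k (Theta f v)) - s ?c (ps (k + n) (Theta f v))"
    using vH by (simp add: lo_ps)
  also have "\<dots> = s lam (Theta (psi_op n (Lbar k f)) v + Theta (psi_op n f) (coset_vir k v) - s ?c (Theta (psi_op (k + n) f) v))"
    unfolding psi(2) ps_Theta[OF v] using vH psi(1)
    by (simp add: gact_lin ps_Theta_nonpos scale_right_distrib scale_right_diff_distrib mult.commute)
  also have "Theta (psi_op n (Lbar k f)) v + Theta (psi_op n f) (coset_vir k v) - s ?c (Theta (psi_op (k + n) f) v)
     = Theta (Lbar k (psi_op n f)) v + Theta (psi_op n f) (coset_vir k v)"
    unfolding Lbar_psi Theta_diff Theta_scale by simp
  finally show ?case using lam0 by (auto simp only: scale_cancel_left)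
next
  case (add f g)
  have "lo k (Theta (f + g) v) = lo k (Theta f v) + lo k (Theta g v)" using vacua_H[OF v] by (simp add: Theta_add gact_lin)
  then show ?case unfolding add by (simp add: Lbar_lin Theta_add)
next
  case (scale a f)
  have "lo k (Theta (pscale a f) v) = s a (lo k (Theta f v))" using vacua_H[OF v] by (simp add: Theta_scale gact_lin)
  then show ?case unfolding scale by (simp add: Lbar_lin Theta_scale scale_right_distrib)
qed

lemma mode_grade: "v \<in> grade W p \<Longrightarrow> mode n v \<in> grade W (1 + p)"
  using gact_grade[of v p "Psi 0"] gact_grade[of v p "Psi (- int n)"]
  unfolding mode_def gen_parity.simps by (simp only: subspace_scale[OF subspace_grade] split: if_split) simp

lemma modes_grade: "v \<in> grade W p \<Longrightarrow> modes I v \<in> grade W (of_nat (fcard I) + p)"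
proof (induction I rule: fset_min_induct)
  case (insert m I)
  then have "m |\<notin>| I" by blast
  then have "of_nat (fcard (finsert m I)) + p = 1 + (of_nat (fcard I) + p)"
    by (simp only: fcard_finsert_disjoint[OF \<open>m |\<notin>| I\<close>] of_nat_Suc add.assoc)
  then show ?case using mode_grade[OF insert.IH[OF insert.prems], of m] insert.hyps by (simp only: modes_insert_min)
qed (simp only: fcard_fempty of_nat_0 add_0_left modes_empty)

lemma Theta_grade:
  assumes "v \<in> grade W 0" "f \<in> grade fock p" shows "Theta f v \<in> grade W p"
  unfolding Theta_def
proof (intro subspace_sum[OF subspace_grade] subspace_scale[OF subspace_grade])
  fix I assume "I \<in> Poly_Mapping.keys f"
  then have "of_nat (fcard I) = p" using assms by (simp add: fock_def)
  then show "modes I v \<in> grade W p" using modes_grade[OF assms(1), of I] by (simp only: add_0_right)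
qed

lemma vac_grade: "vac \<in> grade fock 0"
  using single_fock_grade[of "{||}" 1] by (simp only: fcard_fempty of_nat_0)

text \<open>L_k and its Sugawara part have the same commutator with psi_n, so the difference
  respects the vacuum condition.\<close>

lemma coset_vir_vacua:
  assumes v: "v \<in> vacua" shows "coset_vir k v \<in> vacua"
proof -
  have vH: "v \<in> H" using v by (rule vacua_H)
  have "lo k v \<in> grade W 0" using gact_grade[OF vacua_grade[OF v], of "L k"] by simp
  moreover have "Theta (Lbar k vac) v \<in> grade W 0"
    by (rule Theta_grade[OF vacua_grade[OF v] Lbar_grade[OF vac_grade]])
  ultimately have "coset_vir k v \<in> grade W 0"
    unfolding coset_vir_def by (rule subspace_diff[OF subspace_grade])
  moreover have "ps n (coset_vir k v) = 0" if n: "n > 0" for n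
  proof -
    let ?c = "of_int n + of_int k / 2 :: complex"
    have "lo k (ps n v) = ps n (lo k v) - s ?c (ps (k + n) v)" using lo_ps[OF vH] .
    then have 1: "ps n (lo k v) = s ?c (ps (k + n) v)" using vacua_kill[OF v n] by simp
    have "psi_op n (Lbar k vac) = pscale ?c (psi_op (k + n) vac)"
      using Lbar_psi[of k n vac] psi_op_vac[OF n] by simp
    then have "ps n (Theta (Lbar k vac) v) = s ?c (s lam (Theta (psi_op (k + n) vac) v))"
      by (simp add: ps_Theta[OF v] Theta_scale mult.commute)
    also have "s lam (Theta (psi_op (k + n) vac) v) = ps (k + n) v" using ps_Theta[OF v, of "k + n" vac] by simp
    finally show ?thesis using 1 vH by (simp add: coset_vir_def gact_lin)
  qed
  ultimately show ?thesis by (simp add: vacua_def)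
qed

lemma co_vacua: "v \<in> vacua \<Longrightarrow> co v \<in> vacua"
  using gact_grade[OF vacua_grade, of v C] co_comm[OF vacua_H, of v "Psi _"]
  by (simp add: vacua_def) (metis gact_zero)

text \<open>Expanded, \<open>lo a (lo b v)\<close> contains mixed terms that are symmetric in a and
  b and cancel in the commutator. The Virasoro relation of the Fock space is subtracted from that of
  \<open>W\<close>, which lowers c by 1/2.\<close>

lemma coset_vir_comm:
  assumes v: "v \<in> vacua"
  shows "coset_vir m (coset_vir n v) - coset_vir n (coset_vir m v) = s (of_int (m - n)) (coset_vir (m + n) v)
    + (if m = - n then s (of_int (m ^ 3 - m) / 12) (co v - s (1 / 2) v) else 0)"
proof -
  have vH: "v \<in> H" using v by (rule vacua_H)
  have lo_eq: "lo k u = coset_vir k u + Theta (Lbar k vac) u" for k u by (simp add: coset_vir_def)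
  have ll: "lo a (lo b v) = Theta (Lbar a vac) (coset_vir b v) + coset_vir a (coset_vir b v)
      + (Theta (Lbar a (Lbar b vac)) v + Theta (Lbar b vac) (coset_vir a v))" for a b
  proof -
    have "lo a (lo b v) = lo a (coset_vir b v) + lo a (Theta (Lbar b vac) v)"
      by (subst lo_eq[of b]) (simp add: gact_lin vH)
    also have "lo a (coset_vir b v) = Theta (Lbar a vac) (coset_vir b v) + coset_vir a (coset_vir b v)"
      by (subst lo_eq) (simp add: add.commute)
    finally show ?thesis by (simp add: lo_Theta[OF v])
  qed
  have "coset_vir m (coset_vir n v) - coset_vir n (coset_vir m v)
      = lo m (lo n v) - lo n (lo m v) - Theta (Lbar m (Lbar n vac) - Lbar n (Lbar m vac)) v"
    unfolding ll Theta_diff by (simp add: algebra_simps)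
  also have "lo m (lo n v) - lo n (lo m v) = s (of_int (m - n)) (lo (m + n) v)
    + (if m = - n then s (of_int (m ^ 3 - m) / 12) (co v) else 0)"
    using lo_lo[OF vH, of m n] by simp
  also have "Theta (Lbar m (Lbar n vac) - Lbar n (Lbar m vac)) v
     = s (of_int (m - n)) (Theta (Lbar (m + n) vac) v) + s (if m = - n then of_int (m ^ 3 - m) / 24 else 0) v"
    unfolding Lbar_comm_vac Theta_add Theta_scale by simp
  also have "s (of_int (m - n)) (lo (m + n) v) + (if m = - n then s (of_int (m ^ 3 - m) / 12) (co v) else 0)
      - (s (of_int (m - n)) (Theta (Lbar (m + n) vac) v) + s (if m = - n then of_int (m ^ 3 - m) / 24 else 0) v)
    = s (of_int (m - n)) (coset_vir (m + n) v)
    + (if m = - n then s (of_int (m ^ 3 - m) / 12) (co v - s (1 / 2) v) else 0)"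
    unfolding coset_vir_def by (cases "m = - n") (simp_all add: scale_right_diff_distrib)
  finally show ?thesis .
qed

lemma co_modes: "v \<in> H \<Longrightarrow> co (modes I v) = modes I (co v)"
  by (induction I rule: fset_min_induct) (simp_all add: modes_insert_min mode_def gact_lin co_comm)

lemma co_Theta: "v \<in> H \<Longrightarrow> co (Theta f v) = Theta f (co v)"
  by (simp add: Theta_def gact_sum gact_lin co_modes)

text \<open>The modes applied to a subspace of vacuum vectors that is stable under the coset
  operators and c span a graded submodule. With all of \<open>vacua\<close> this generates
  \<open>W\<close>; with a submodule of \<open>vacua\<close> it gives simplicity of the Virasoro
  module.\<close>

lemma modes_span_full:
  assumes N: "subspace N" "N \<subseteq> vacua" "\<And>k v. v \<in> N \<Longrightarrow> coset_vir k v \<in> N" "\<And>v. v \<in> N \<Longrightarrow> co v \<in> N"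
    and nz: "v \<in> N" "v \<noteq> 0"
  shows "H = span {modes I u | I u. u \<in> N}"
proof -
  let ?S = "{modes I u | I u. u \<in> N}"
  have Th: "Theta f u \<in> span ?S" if "u \<in> N" for f u
    unfolding Theta_def using that by (intro span_sum span_scale span_base) blast
  have "graded_submodule FV W (span ?S)"
  proof (rule graded_submodule_span)
    fix w assume "w \<in> ?S"
    then obtain I u where w: "w = modes I u" and u: "u \<in> N" by blast
    have uV: "u \<in> vacua" using u N by blast
    show "\<exists>p. w \<in> grade W p" using w modes_grade[OF vacua_grade[OF uV]] by blast
    have w': "w = Theta (Poly_Mapping.single I 1) u" by (simp add: w Theta_single)
    fix g show "gact W g w \<in> span ?S"
    proof (cases g)
      case (L k)
      then show ?thesis unfolding w' using Th u N(3) by (simp add: lo_Theta[OF uV] span_add)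
    next
      case (Psi n)
      then show ?thesis unfolding w' using Th u by (simp add: ps_Theta[OF uV] span_scale)
    next
      case C
      then show ?thesis using w N(4)[OF u] by (auto simp: co_modes[OF vacua_H[OF uV]] intro!: span_base)
    next
      case Z
      have "modes I u \<in> span ?S" using u by (intro span_base) blast
      then show ?thesis using Z w zo_zeta[OF modes_H[OF vacua_H[OF uV]]] span_scale by simp
    qed
  qed
  moreover have "v \<in> span ?S" using Th[OF nz(1), of vac] by simp
  ultimately show ?thesis using submodule_full nz(2) by blast
qed

text \<open>If psi_m is the last positive generator not killing \<open>v\<close>, replace
  \<open>v\<close> by psi_m v: this vector is nonzero and killed by psi_m and all later ones.
  Repetition leads down to a vector killed by all psi_n with n > 0.\<close>

lemma exists_vacuum: obtains v where "v \<in> vacua" "v \<noteq> 0"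
proof -
  have "\<exists>v. v \<in> H \<and> v \<noteq> 0 \<and> (\<forall>n>int k. ps n v = 0)" if "v \<in> H" "v \<noteq> 0" "\<forall>n>int (k + d). ps n v = 0" for v k d
    using that
  proof (induction d arbitrary: v)
    case (Suc d)
    let ?m = "int (k + Suc d)"
    show ?case
    proof (cases "ps ?m v = 0")
      case True
      then have "ps n v = 0" if "n > int (k + d)" for n
        using Suc.prems(3) that by (cases "n = ?m") auto
      then show ?thesis using Suc.IH Suc.prems by blast
    next
      case False
      have "ps n (ps ?m v) = 0" if "n > int (k + d)" for n
      proof (cases "n = ?m")
        case True then show ?thesis using ps_sq[OF Suc.prems(1), of ?m] by simp
      next
        case False
        then have "ps n v = 0" using Suc.prems(3) that by auto
        then show ?thesis using ps_anti[OF Suc.prems(1), of n ?m] that by simp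
      qed
      moreover have "ps ?m v \<in> H" using Suc.prems(1) by simp
      ultimately show ?thesis using Suc.IH[of "ps ?m v"] False by blast
    qed
  qed auto
  note red = this
  obtain v N where v: "v \<in> H" "v \<noteq> 0" "\<forall>n\<ge>N. ps n v = 0" using exists_restricted by blast
  have "\<forall>n>int (0 + nat N). ps n v = 0" using v(3) by auto
  from red[OF v(1,2) this] obtain u where u: "u \<in> H" "u \<noteq> 0" "\<forall>n>0. ps n u = 0" by auto
  obtain a b where ab: "a \<in> grade W 0" "b \<in> grade W 1" "u = a + b"
    "\<And>g. g \<in> Psi ` {0<..} \<Longrightarrow> gact W g a = 0" "\<And>g. g \<in> Psi ` {0<..} \<Longrightarrow> gact W g b = 0"
    using kernel_decomp[OF u(1), of "Psi ` {0<..}"] u(3) by auto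
  have aV: "a \<in> vacua" using ab by (auto simp: vacua_def)
  show thesis
  proof (cases "a = 0")
    case True
    have bH: "b \<in> H" using ab(2) by (rule grade_H)
    \<comment> \<open>An odd vacuum vector is made even by psi_0, which is injective because its
      square is \<zeta>/2.\<close>
    have "ps 0 b \<in> grade W 0" using gact_grade[OF ab(2), of "Psi 0"] by simp
    moreover have "ps n (ps 0 b) = 0" if "n > 0" for n using ab(5)[of "Psi n"] ps_anti[OF bH, of n 0] that by auto
    ultimately have "ps 0 b \<in> vacua" by (simp add: vacua_def)
    moreover have "ps 0 b \<noteq> 0"
    proof
      assume "ps 0 b = 0"
      then have "s \<zeta> b = 0" using ps_conj[OF bH, of 0] by simp
      then show False using zeta u(2) ab(3) True by simp
    qed
    ultimately show thesis by (rule that)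
  qed (use that aV in blast)
qed

lemma vacua_full: "H = span {modes I u | I u. u \<in> vacua}"
proof -
  obtain v where "v \<in> vacua" "v \<noteq> 0" by (rule exists_vacuum)
  then show ?thesis by (intro modes_span_full[OF subspace_vacua subset_refl coset_vir_vacua co_vacua])
qed

lemma modes_decomp:
  assumes N: "subspace N" "N \<subseteq> H" and w: "w \<in> span {modes I u | I u. u \<in> N}"
  shows "\<exists>A F. finite A \<and> (\<forall>I. F I \<in> N) \<and> (\<forall>I. I \<notin> A \<longrightarrow> F I = 0) \<and> w = (\<Sum>I\<in>A. modes I (F I))"
  using w
proof (induction rule: span_induct_alt)
  case base
  show ?case by (rule exI[of _ "{}"], rule exI[of _ "\<lambda>_. 0"]) (simp add: subspace_0[OF N(1)])
next
  case (step c y w)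
  obtain J u where J: "y = modes J u" "u \<in> N" using step.hyps by blast
  obtain A F where A: "finite A" "\<forall>I. F I \<in> N" "\<forall>I. I \<notin> A \<longrightarrow> F I = 0" "w = (\<Sum>I\<in>A. modes I (F I))"
    using step.IH by blast
  define F' where "F' I = (if I = J then s c u else 0) + F I" for I
  have H: "u \<in> H" "F I \<in> H" for I using J A N by auto
  have modes0: "modes I 0 = 0" for I using modes_lin(2)[of 0 0 I 0] by simp
  have w: "w = (\<Sum>I\<in>insert J A. modes I (F I))"
    using A modes0 by (cases "J \<in> A") (simp_all add: insert_absorb)
  have e: "modes I (F' I) = (if I = J then s c (modes I u) else 0) + modes I (F I)" for I
    using H modes0 by (auto simp: F'_def modes_lin)
  have "s c y + w = (\<Sum>I\<in>insert J A. modes I (F' I))" unfolding e sum.distrib w using A(1) J(1) by simp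
  moreover have "F' I \<in> N" for I
    unfolding F'_def using A(2) J(2) subspace_0[OF N(1)] subspace_add[OF N(1)] subspace_scale[OF N(1)] by auto
  ultimately show ?case using A
    by (intro exI[of _ "insert J A"] exI[of _ F']) (auto simp: F'_def)
qed

text \<open>Apply psi_n for the largest index n that may occur: the monomials containing n lose it,
  the others are killed. By induction on the largest index the coefficients of the former vanish,
  and then those of the latter.\<close>

lemma modes_independent:
  assumes "finite A" "\<And>I. I \<in> A \<Longrightarrow> F I \<in> vacua" "(\<Sum>I\<in>A. modes I (F I)) = 0" "I \<in> A"
  shows "F I = 0"
proof -
  have main: "\<forall>I\<in>A. F I = 0" if "finite A" "\<forall>I\<in>A. F I \<in> vacua \<and> fset I \<subseteq> {..<Suc n}" "(\<Sum>I\<in>A. modes I (F I)) = 0" for A F n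
    using that
  proof (induction n arbitrary: A F)
    case 0
    define G where "G I = (if I \<in> A then F I else 0)" for I
    have GV: "G I \<in> vacua" for I using 0 subspace_0[OF subspace_vacua] by (simp add: G_def)
    have modes0: "modes I 0 = 0" for I using modes_lin(2)[of 0 0 I 0] by simp
    have sub: "A \<subseteq> {{||}, {|0|}}"
    proof
      fix I assume "I \<in> A"
      then have "fset I \<subseteq> {0}" using 0(2) by (auto simp: lessThan_Suc)
      then have "fset I = {} \<or> fset I = {0}" by blast
      then show "I \<in> {{||}, {|0|}}" by (auto simp: fset_eq_iff)
    qed
    have "(\<Sum>I\<in>A. modes I (F I)) = (\<Sum>I\<in>A. modes I (G I))"
      by (intro sum.cong refl) (simp add: G_def)
    also have "\<dots> = (\<Sum>I\<in>{{||}, {|0|}}. modes I (G I))"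
      using sub by (intro sum.mono_neutral_left) (auto simp: G_def modes0)
    also have "\<dots> = G {||} + modes {|0|} (G {|0|})" by (subst sum.insert) auto
    finally have e: "G {||} + modes {|0|} (G {|0|}) = 0 + 0" using 0(3) by simp
    \<comment> \<open>Only 1 and xi_0 are left. As vacuum vectors are even, the two terms have
      opposite parity and vanish separately.\<close>
    have "modes {|0|} (G {|0|}) \<in> grade W 1"
      using modes_grade[OF vacua_grade[OF GV], of "{|0|}"] by (simp add: fcard.rep_eq)
    then have "G {||} = 0 \<and> modes {|0|} (G {|0|}) = 0"
      using e vacua_grade[OF GV] subspace_0[OF subspace_grade] H_decomp_unique by blast
    moreover have "G {|0|} = 0" if "mode 0 (G {|0|}) = 0"
      using mode_sq[OF vacua_H[OF GV], of 0 "{|0|}"] that mode_lin(2)[of 0 0 0] by simp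
    ultimately show ?case using sub by (auto simp: G_def split: if_splits)
  next
    case (Suc n)
    let ?n = "Suc n"
    let ?A1 = "{I \<in> A. ?n |\<in>| I}" and ?A0 = "{I \<in> A. ?n |\<notin>| I}"
    define sg :: "nat fset \<Rightarrow> complex" where "sg I = (-1) ^ card {i. i |\<in>| I \<and> i < ?n}" for I
    have psi: "psi_op (int ?n) f = ext_deriv ?n f" for f by (simp add: psi_op_def del: of_nat_Suc)
    have VH: "F I \<in> H" "F I \<in> vacua" if "I \<in> A" for I using that Suc.prems(2) vacua_H by blast+
    \<comment> \<open>After this derivation only monomials containing \<open>?n\<close> remain; each
      loses this index and keeps its coefficient up to a nonzero factor.\<close>
    have "0 = ps (int ?n) (\<Sum>I\<in>A. modes I (F I))" using Suc.prems(3) by simp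
    also have "\<dots> = (\<Sum>I\<in>A. ps (int ?n) (Theta (Poly_Mapping.single I 1) (F I)))"
      using VH by (subst gact_sum) (auto simp: Theta_single)
    also have "\<dots> = (\<Sum>I\<in>A. s lam (Theta (psi_op (int ?n) (Poly_Mapping.single I 1)) (F I)))"
      using VH by (intro sum.cong refl ps_Theta)
    also have "\<dots> = (\<Sum>I\<in>?A1. s lam (Theta (psi_op (int ?n) (Poly_Mapping.single I 1)) (F I)))"
      using Suc.prems(1) by (intro sum.mono_neutral_right) (auto simp: psi ext_deriv_single Theta_def simp del: of_nat_Suc)
    also have "\<dots> = (\<Sum>I\<in>?A1. modes (I |-| {|?n|}) (s (lam * sg I) (F I)))"
      using VH by (intro sum.cong refl) (auto simp: psi ext_deriv_single Theta_single modes_scale sg_def simp del: of_nat_Suc)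
    also have "\<dots> = (\<Sum>J\<in>(\<lambda>I. I |-| {|?n|}) ` ?A1. modes J (s (lam * sg (finsert ?n J)) (F (finsert ?n J))))"
    proof (subst sum.reindex)
      show "inj_on (\<lambda>I. I |-| {|?n|}) ?A1" by (rule inj_onI) (metis (no_types, lifting) finsert_fminus mem_Collect_eq)
      show "(\<Sum>I\<in>?A1. modes (I |-| {|?n|}) (s (lam * sg I) (F I))) =
        sum ((\<lambda>J. modes J (s (lam * sg (finsert ?n J)) (F (finsert ?n J)))) \<circ> (\<lambda>I. I |-| {|?n|})) ?A1"
        by (intro sum.cong refl) (auto simp: insert_absorb finsert_absorb)
    qed
    finally have z: "(\<Sum>J\<in>(\<lambda>I. I |-| {|?n|}) ` ?A1. modes J (s (lam * sg (finsert ?n J)) (F (finsert ?n J)))) = 0" by simp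
    have ins: "finsert ?n (I |-| {|?n|}) = I" if "I \<in> ?A1" for I using that by auto
    have "\<forall>J\<in>(\<lambda>I. I |-| {|?n|}) ` ?A1. s (lam * sg (finsert ?n J)) (F (finsert ?n J)) = 0"
    proof (rule Suc.IH[OF _ _ z])
      show "\<forall>J\<in>(\<lambda>I. I |-| {|?n|}) ` ?A1. s (lam * sg (finsert ?n J)) (F (finsert ?n J)) \<in> vacua \<and> fset J \<subseteq> {..<Suc n}"
      proof
        fix J assume "J \<in> (\<lambda>I. I |-| {|?n|}) ` ?A1"
        then obtain I where I: "I \<in> ?A1" "J = I |-| {|?n|}" by blast
        then have "fset I \<subseteq> {..<Suc (Suc n)}" "F I \<in> vacua" using Suc.prems(2) by auto
        then show "s (lam * sg (finsert ?n J)) (F (finsert ?n J)) \<in> vacua \<and> fset J \<subseteq> {..<Suc n}"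
          using I ins[OF I(1)] subspace_scale[OF subspace_vacua] by (auto simp: less_Suc_eq)
      qed
    qed (use Suc.prems(1) in simp)
    then have F1: "F I = 0" if "I \<in> ?A1" for I
      using that ins[OF that] lam0 by (force simp: sg_def)
    have modes0: "modes I 0 = 0" for I using modes_lin(2)[of 0 0 I 0] by simp
    have "(\<Sum>I\<in>?A0. modes I (F I)) = (\<Sum>I\<in>A. modes I (F I))"
      using Suc.prems(1) F1 modes0 by (intro sum.mono_neutral_left) auto
    moreover have "fset I \<subseteq> {..<Suc n}" if "I \<in> ?A0" for I
    proof
      fix x assume x: "x \<in> fset I"
      then have "x < Suc (Suc n)" "x \<noteq> Suc n" using that Suc.prems(2) by auto
      then show "x \<in> {..<Suc n}" by simp
    qed
    ultimately have "\<forall>I\<in>?A0. F I = 0"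
      using Suc.prems by (intro Suc.IH) auto
    then show ?case using F1 by auto
  qed
  have "finite (\<Union>I\<in>A. fset I)" using assms(1) by simp
  then obtain n where "\<forall>i\<in>(\<Union>I\<in>A. fset I). i < n" using finite_nat_set_iff_bounded by blast
  then have "\<forall>I\<in>A. F I = 0" using assms(1-3) by (intro main[of A F n]) fastforce+
  then show ?thesis using assms(4) by blast
qed

end

section \<open>The isomorphism with the tensor product\<close>

interpretation fs: vector_space "fscale :: complex \<Rightarrow> ('a \<Rightarrow> complex) \<Rightarrow> _"
  by (rule vector_space_fscale)

lemma lookup_restrict_keys: "Poly_Mapping.lookup (restrict_keys K x) g = (if g \<in> K then Poly_Mapping.lookup x g else 0)"
  by (auto simp: restrict_keys_def lookup_sum lookup_single when_def in_keys_iff if_distrib cong: if_cong)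

lemma restrict_vir_parts:
  "restrict_keys vir_gens (fv_part 0 x) = restrict_keys vir_gens x" "restrict_keys vir_gens (fv_part 1 x) = 0"
  by (rule poly_mapping_eqI; auto simp: fv_part_def lookup_restrict_keys vir_gens_def)+

lemma lookup_sigma: "Poly_Mapping.lookup (sigma \<mu> x) g = sigma_coeff \<mu> g * Poly_Mapping.lookup x g"
  by (auto simp: sigma_def lookup_sum lookup_single when_def in_keys_iff if_distrib cong: if_cong)

lemma keys_sigma: "Poly_Mapping.keys (sigma \<mu> x) \<subseteq> Poly_Mapping.keys x"
  by (auto simp: in_keys_iff lookup_sigma)

lemma act_twist_fock: "act (twist \<mu> fock) x f
  = (\<Sum>g\<in>Poly_Mapping.keys x. pscale (Poly_Mapping.lookup x g * sigma_coeff \<mu> g) (fock_op g f))"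
proof -
  have "act (twist \<mu> fock) x f
    = (\<Sum>g\<in>Poly_Mapping.keys (sigma \<mu> x). pscale (Poly_Mapping.lookup x g * sigma_coeff \<mu> g) (fock_op g f))"
    by (simp add: twist_def fock_def lookup_sigma mult.commute)
  also have "\<dots> = (\<Sum>g\<in>Poly_Mapping.keys x. pscale (Poly_Mapping.lookup x g * sigma_coeff \<mu> g) (fock_op g f))"
    by (rule sum.mono_neutral_left) (use keys_sigma in \<open>auto simp: in_keys_iff lookup_sigma\<close>)
  finally show ?thesis .
qed

lemma fock_op_lin:
  "fock_op g (f + f') = fock_op g f + fock_op g f'" "fock_op g (pscale a f) = pscale a (fock_op g f)"
  by (cases g; simp add: Lbar_lin psi_op_lin pscale_simps mult.commute)+

lemma act_twist_fock_lin:
  "act (twist \<mu> fock) x (f + f') = act (twist \<mu> fock) x f + act (twist \<mu> fock) x f'"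
  "act (twist \<mu> fock) x (pscale a f) = pscale a (act (twist \<mu> fock) x f)"
  by (simp_all add: act_twist_fock fock_op_lin pscale_simps sum.distrib pm.scale_sum_right mult_ac)

text \<open>With the empty set in place of the Lie superalgebra only the axioms on the grading remain.\<close>

lemma graded_space_fock: "super_module {} (twist \<mu> fock)"
proof -
  have "grade fock 0 \<inter> grade fock 1 = {0}"
  proof
    show "grade fock 0 \<inter> grade fock 1 \<subseteq> {0}"
    proof
      fix f assume "f \<in> grade fock 0 \<inter> grade fock 1"
      then have "Poly_Mapping.keys f = {}" by (auto simp: fock_def)
      then show "f \<in> {0}" by simp
    qed
  qed (simp add: fock_def)
  then show ?thesis using subspace_fock_grade vector_space_pscale
    unfolding super_module_def by (simp add: twist_def linear_map_on_def) (simp add: fock_def)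
qed

lemma carr_twist_fock: "carr (twist \<mu> fock) = UNIV"
  using fock_carr by (simp add: carr_def twist_def)

lemma component_sum_fock: "component (twist \<mu> fock) 0 f + component (twist \<mu> fock) 1 f = f"
proof -
  have f: "f \<in> carr (twist \<mu> fock)" by (simp add: carr_twist_fock)
  from carr_decomp[OF graded_space_fock f, of 0]
  obtain a b where ab: "a \<in> grade (twist \<mu> fock) 0" "b \<in> grade (twist \<mu> fock) (0 + 1)" "f = a + b" by metis
  have "component (twist \<mu> fock) 0 (a + b) = a"
    using ab by (intro component_eq[OF graded_space_fock]) auto
  moreover have "component (twist \<mu> fock) 1 (b + a) = b"
    using ab by (intro component_eq[OF graded_space_fock]) auto
  ultimately show ?thesis using ab(3) by (simp add: add.commute)
qed

lemma carr_inflate: "carr (inflate V) = carr V"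
  by (simp add: carr_def inflate_def)

section \<open>The Virasoro module of vacuum vectors\<close>

context restricted_module
begin

lemma Theta_right_scale: "u \<in> H \<Longrightarrow> Theta f (s a u) = s a (Theta f u)"
  by (rule Theta_right)

lemma modes_zero [simp]: "modes I 0 = 0"
  using modes_scale[of 0 I 0] by simp

lemma modes_diff: "u \<in> H \<Longrightarrow> v \<in> H \<Longrightarrow> modes I (u - v) = modes I u - modes I v"
  using modes_lin(1)[of u "s (-1) v" I] modes_scale[of v I "-1"] by simp

text \<open>The operators on the second tensor factor. The central element c loses the 1/2 with
  which it acts on the Fock factor; the odd generators and z act on the Fock factor alone.\<close>

primrec vac_op :: "gen \<Rightarrow> 'a \<Rightarrow> 'a" where
  "vac_op (L k) = coset_vir k"
| "vac_op (Psi n) = (\<lambda>v. 0)"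
| "vac_op C = (\<lambda>v. co v - s (1 / 2) v)"
| "vac_op Z = (\<lambda>v. 0)"

definition vacuum_module :: "'a smod" where
  "vacuum_module = \<lparr> scl = s, grade = (\<lambda>p. if p = 0 then vacua else {0}), act = gen_act s vac_op \<rparr>"

lemma carr_vacuum: "carr vacuum_module = vacua"
  by (auto simp: carr_def vacuum_module_def)

lemma vac_op_vacua: "v \<in> vacua \<Longrightarrow> vac_op g v \<in> vacua"
  using coset_vir_vacua co_vacua subspace_diff[OF subspace_vacua] subspace_scale[OF subspace_vacua] subspace_0[OF subspace_vacua]
  by (cases g) auto

lemma vac_op_add: "u \<in> H \<Longrightarrow> v \<in> H \<Longrightarrow> vac_op g (u + v) = vac_op g u + vac_op g v"
  by (cases g) (simp_all add: coset_vir_lin gact_lin scale_right_distrib)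

lemma vac_op_scale: "u \<in> H \<Longrightarrow> vac_op g (s a u) = s a (vac_op g u)"
  using coset_vir_lin(2)[of u u] by (cases g) (simp_all add: gact_lin scale_right_diff_distrib mult.commute)

lemma coset_vir_scale: "v \<in> H \<Longrightarrow> coset_vir k (s a v) = s a (coset_vir k v)"
  by (rule coset_vir_lin)

lemma coset_vir_diff: "u \<in> H \<Longrightarrow> v \<in> H \<Longrightarrow> coset_vir k (u - v) = coset_vir k u - coset_vir k v"
  using coset_vir_lin(1)[of u "s (-1) v" k] coset_vir_scale[of v k "-1"] by simp

lemma co_coset_vir: "v \<in> H \<Longrightarrow> co (coset_vir k v) = coset_vir k (co v)"
  by (simp add: coset_vir_def gact_lin co_comm co_Theta)

lemma super_module_vacuum: "super_module Vir vacuum_module"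
  unfolding Vir_eq vacuum_module_def
proof (rule super_module_gen_act[OF vector_space_axioms])
  let ?G = "\<lambda>p :: bit. if p = 0 then vacua else {0}"
  have carr: "carr \<lparr>scl = s, grade = ?G, act = gen_act s vac_op\<rparr> = vacua"
    using carr_vacuum by (simp add: vacuum_module_def)
  show "subspace (?G p)" for p using subspace_vacua subspace_single_0 by simp
  show "?G 0 \<inter> ?G 1 = {0}" using subspace_0[OF subspace_vacua] by auto
  show "linear_map_on s s (carr \<lparr>scl = s, grade = ?G, act = gen_act s vac_op\<rparr>) (vac_op g)" for g
    unfolding carr linear_map_on_def using vac_op_add vac_op_scale vacua_H by blast
  show "vac_op g v \<in> ?G (gen_parity g + q)" if "g \<in> vir_gens" "v \<in> ?G q" for g q v
  proof -
    have p: "gen_parity g + q = q" using that(1) by (auto simp: vir_gens_def)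
    have "vac_op g 0 = 0" using vac_op_scale[of 0 g 0] by simp
    then show ?thesis unfolding p using that(2) vac_op_vacua by (auto split: if_splits)
  qed
  show "gen_act s vac_op (gen_bracket g h) v = vac_op g (vac_op h v)
      - s (koszul (gen_parity g * gen_parity h)) (vac_op h (vac_op g v))"
    if g: "g \<in> vir_gens" and h: "h \<in> vir_gens" and v: "v \<in> carr \<lparr>scl = s, grade = ?G, act = gen_act s vac_op\<rparr>" for g h v
  proof -
    have v: "v \<in> vacua" "v \<in> H" using v vacua_H by (auto simp: carr)
    have k: "koszul 0 = 1" by (simp add: koszul_def)
    consider m n where "g = L m" "h = L n" | m where "g = L m" "h = C" | m where "g = C" "h = L m" | "g = C" "h = C"
      using g h by (auto simp: vir_gens_def)
    then show ?thesis
    proof cases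
      case 1
      then show ?thesis using coset_vir_comm[OF v(1), of m n] by (simp add: ga k)
    next
      case 2
      then show ?thesis using v(2) by (simp add: ga k coset_vir_diff coset_vir_scale co_coset_vir)
    next
      case 3
      then show ?thesis using v(2) by (simp add: ga k coset_vir_diff coset_vir_scale co_coset_vir)
    qed (simp add: ga k)
  qed
qed

lemma act_vacuum_basis: "act vacuum_module (basis g) v = vac_op g v"
  by (simp add: vacuum_module_def ga)

lemma basis_Vir: "basis (L k) \<in> Vir" "basis C \<in> Vir"
  by (auto simp: Vir_def vir_gens_def)

text \<open>A nonzero submodule \<open>N\<close> generates all of \<open>W\<close> through modes.
  Expanding a vacuum vector with coefficients in \<open>N\<close> and comparing the coefficients of
  the empty monomial shows that it lies in \<open>N\<close>.\<close>

lemma simple_vacuum: "simple_module Vir vacuum_module"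
  unfolding simple_module_def
proof (intro conjI allI impI super_module_vacuum)
  obtain v where "v \<in> vacua" "v \<noteq> 0" by (rule exists_vacuum)
  then show "carr vacuum_module \<noteq> {0}" by (auto simp: carr_vacuum)
  fix N assume N: "graded_submodule Vir vacuum_module N"
  then have sub: "subspace N" by (simp add: graded_submodule_def vacuum_module_def)
  have NV: "N \<subseteq> vacua"
  proof
    fix v assume "v \<in> N"
    then obtain a b where "v = a + b" "a \<in> grade vacuum_module 0" "b \<in> grade vacuum_module 1"
      using N unfolding graded_submodule_def by blast
    then show "v \<in> vacua" by (simp add: vacuum_module_def)
  qed
  have act: "act vacuum_module x v \<in> N" if "x \<in> Vir" "v \<in> N" for x v
    using N that unfolding graded_submodule_def by blast
  have cN: "coset_vir k v \<in> N" if "v \<in> N" for k v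
    using act[OF basis_Vir(1)[of k] that] by (simp add: act_vacuum_basis)
  have coN: "co v \<in> N" if "v \<in> N" for v
  proof -
    have "co v - s (1 / 2) v + s (1 / 2) v \<in> N"
      using act[OF basis_Vir(2) that] that by (intro subspace_add[OF sub] subspace_scale[OF sub]) (simp_all add: act_vacuum_basis)
    then show ?thesis by simp
  qed
  show "N = {0} \<or> N = carr vacuum_module"
  proof (cases "N = {0}")
    case False
    then obtain u where u: "u \<in> N" "u \<noteq> 0" using subspace_0[OF sub] by blast
    note full = modes_span_full[OF sub NV cN coN u]
    have "v \<in> N" if v: "v \<in> vacua" for v
    proof -
      have NH: "N \<subseteq> H" using NV vacua_H by blast
      have sp: "v \<in> span {modes I u | I u. u \<in> N}" using full vacua_H[OF v] by blast
      obtain A F where A: "finite A" "\<And>I. F I \<in> N" "\<And>I. I \<notin> A \<Longrightarrow> F I = 0" "v = (\<Sum>I\<in>A. modes I (F I))"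
        using modes_decomp[OF sub NH sp] by blast
      \<comment> \<open>The expansion over \<open>N\<close> minus the trivial expansion of
        \<open>v\<close>, so that independence applies.\<close>
      define F' where "F' I = F I - (if I = {||} then v else 0)" for I
      have F': "F' I \<in> vacua" for I
        unfolding F'_def using A(2) NV v subspace_0[OF subspace_vacua] by (intro subspace_diff[OF subspace_vacua]) auto
      have FH: "F I \<in> H" for I using A(2) NV vacua_H by blast
      have md: "modes I (F' I) = modes I (F I) - (if I = {||} then v else 0)" for I
        unfolding F'_def using FH[of I] vacua_H[OF v] by (cases "I = {||}") (simp_all add: modes_diff)
      have "(\<Sum>I\<in>insert {||} A. modes I (F I)) = v"
        using A(1,3,4) by (cases "{||} \<in> A") (simp_all add: insert_absorb)
      then have "(\<Sum>I\<in>insert {||} A. modes I (F' I)) = 0"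
        unfolding md sum_subtractf using A(1) by simp
      then have "F' {||} = 0" using A(1) F' by (intro modes_independent[of "insert {||} A" F']) auto
      then have "v = F {||}" by (simp add: F'_def)
      then show "v \<in> N" using A(2) by simp
    qed
    then show ?thesis using NV carr_vacuum by blast
  qed simp
qed

lemma coset_vir_0: "coset_vir 0 v = lo 0 v - s (1 / 16) v"
  by (simp add: coset_vir_def Lbar_vac_0 Theta_scale)

lemma weight_space_vacuum: "weight_space vacuum_module \<gamma> = vacua \<inter> wt (\<gamma> + 1 / 16)"
proof -
  have "coset_vir 0 v = s \<gamma> v \<longleftrightarrow> lo 0 v = s (\<gamma> + 1 / 16) v" for v
    by (simp add: coset_vir_0 scale_left_distrib diff_eq_eq)
  moreover have "scl vacuum_module = s" by (simp add: vacuum_module_def)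
  ultimately show ?thesis
    unfolding weight_space_def[of vacuum_module] carr_vacuum act_vacuum_basis
    by (auto intro: wtI vacua_H dest: wt_eq)
qed

lemma weight_vacuum: "weight_module Vir vacuum_module"
  unfolding weight_module_def
proof (intro conjI super_module_vacuum)
  have sc: "scl vacuum_module = s" by (simp add: vacuum_module_def)
  have st: "lo 0 v \<in> vacua" if "v \<in> vacua" for v
  proof -
    have "coset_vir 0 v + s (1 / 16) v \<in> vacua"
      using that by (intro subspace_add[OF subspace_vacua] subspace_scale[OF subspace_vacua] coset_vir_vacua)
    then show ?thesis by (simp add: coset_vir_0)
  qed
  have "vacua \<subseteq> span (\<Union>\<gamma>. weight_space vacuum_module \<gamma>)"
  proof
    fix v assume v: "v \<in> vacua"
    obtain A x where A: "finite A" "\<And>\<alpha>. x \<alpha> \<in> wt \<alpha>" "v = (\<Sum>\<alpha>\<in>A. x \<alpha>)"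
      using wt_decomp[OF vacua_H[OF v]] by metis
    have "\<forall>\<alpha>\<in>A. x \<alpha> \<in> vacua" using wt_stable_decomp[OF subspace_vacua st A(1,2)] A(3) v by blast
    then have "x \<alpha> \<in> weight_space vacuum_module (\<alpha> - 1 / 16)" if "\<alpha> \<in> A" for \<alpha>
      using A(2)[of \<alpha>] that by (simp add: weight_space_vacuum)
    then show "v \<in> span (\<Union>\<gamma>. weight_space vacuum_module \<gamma>)"
      unfolding A(3) by (intro span_sum span_base) blast
  qed
  moreover have "span (\<Union>\<gamma>. weight_space vacuum_module \<gamma>) \<subseteq> vacua"
    by (rule span_minimal) (auto simp: weight_space_vacuum subspace_vacua)
  ultimately show "carr vacuum_module = module.span (scl vacuum_module) (\<Union>\<gamma>. weight_space vacuum_module \<gamma>)"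
    unfolding sc carr_vacuum by blast
qed

text \<open>If vacuum vectors u_n of weight \<beta> - n existed for infinitely many n \<ge> 1, the
  vectors psi_(-n) u_n would all lie in the weight space of \<beta>, and the operators psi_n would
  separate them. Since all weights lie in one coset of the integers, finitely many such n mean a
  lower bound.\<close>

lemma highest_weight_vacuum: "highest_weight Vir vacuum_module"
proof -
  obtain v where v: "v \<in> vacua" "v \<noteq> 0" by (rule exists_vacuum)
  have "vacua = span (\<Union>\<gamma>. weight_space vacuum_module \<gamma>)"
    using weight_vacuum carr_vacuum by (simp add: weight_module_def vacuum_module_def)
  then have "\<exists>\<gamma> w. w \<in> weight_space vacuum_module \<gamma> \<and> w \<noteq> 0"
  proof (rule contrapos_pp)
    assume "\<nexists>\<gamma> w. w \<in> weight_space vacuum_module \<gamma> \<and> w \<noteq> 0"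
    then have "(\<Union>\<gamma>. weight_space vacuum_module \<gamma>) \<subseteq> {0}" by blast
    then have "span (\<Union>\<gamma>. weight_space vacuum_module \<gamma>) \<subseteq> {0}" by (intro span_minimal) auto
    then show "vacua \<noteq> span (\<Union>\<gamma>. weight_space vacuum_module \<gamma>)" using v by blast
  qed
  then obtain \<beta> w where w: "w \<in> vacua" "w \<in> wt \<beta>" "w \<noteq> 0" by (auto simp: weight_space_vacuum)
  define D where "D = {n :: nat. n \<ge> 1 \<and> (\<exists>u\<in>vacua. u \<in> wt (\<beta> - of_nat n) \<and> u \<noteq> 0)}"
  obtain B where B: "finite B" "wt \<beta> \<subseteq> span B" by (rule wt_finite)
  have "finite D"
  proof (rule ccontr)
    assume "infinite D"
    then obtain T where T: "finite T" "T \<subseteq> D" "card T = Suc (card B)"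
      by (metis infinite_arbitrarily_large)
    then have "\<forall>n\<in>T. \<exists>u\<in>vacua. u \<in> wt (\<beta> - of_nat n) \<and> u \<noteq> 0" by (auto simp: D_def)
    then obtain u where u: "\<And>n. n \<in> T \<Longrightarrow> u n \<in> vacua" "\<And>n. n \<in> T \<Longrightarrow> u n \<in> wt (\<beta> - of_nat n)" "\<And>n. n \<in> T \<Longrightarrow> u n \<noteq> 0"
      by metis
    have uH: "u n \<in> H" if "n \<in> T" for n using u(1)[OF that] by (rule vacua_H)
    have pos: "n \<ge> 1" if "n \<in> T" for n using T that by (auto simp: D_def)
    have "card T \<le> card B"
    proof (rule card_le_separated[OF B(1) T(1), of "\<lambda>n. ps (- int n) (u n)" "\<lambda>n. ps (int n)"])
      fix n assume n: "n \<in> T"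
      have "ps (- int n) (u n) \<in> wt \<beta>" using ps_wt[OF u(2)[OF n], of "- int n"] by simp
      then show "ps (- int n) (u n) \<in> span B" using B by blast
      show "ps (- int n) (u n) \<in> H" using uH[OF n] by simp
      have "ps (int n) (u n) = 0" using u(1) n pos[OF n] by (intro vacua_kill) auto
      then show "ps (int n) (ps (- int n) (u n)) \<noteq> 0"
        using ps_conj[OF uH[OF n], of "int n"] u(3)[OF n] zeta by simp
    next
      show "linear_map_on s s H (ps (int m))" for m by (rule gact_linear)
    next
      fix m n assume mn: "m \<in> T" "n \<in> T" "m \<noteq> n"
      have "ps (int m) (u n) = 0" using u(1) mn pos[OF mn(1)] by (intro vacua_kill) auto
      then show "ps (int m) (ps (- int n) (u n)) = 0"
        using ps_anti[OF uH[OF mn(2)], of "int m" "- int n"] mn(3) by simp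
    qed
    then show False using T(3) by simp
  qed
  define d where "d = Max (insert 0 D)"
  have d: "n \<le> d" if "n \<in> D" for n unfolding d_def using \<open>finite D\<close> that by (intro Max_ge) auto
  have "{\<alpha>. weight_space vacuum_module \<alpha> \<noteq> {0}} \<subseteq> {(\<beta> - 1 / 16 - of_nat d) + of_nat n | n. True}"
  proof
    fix \<gamma> assume "\<gamma> \<in> {\<alpha>. weight_space vacuum_module \<alpha> \<noteq> {0}}"
    moreover have "0 \<in> weight_space vacuum_module \<gamma>"
      using subspace_0[OF subspace_vacua] subspace_0[OF subspace_wt] by (simp add: weight_space_vacuum)
    ultimately obtain u where u: "u \<in> vacua" "u \<in> wt (\<gamma> + 1 / 16)" "u \<noteq> 0" by (auto simp: weight_space_vacuum)
    from wt_coset[OF w(2,3) u(2,3)] obtain k :: int where k: "\<gamma> + 1 / 16 = \<beta> + of_int k" by blast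
    have "- k \<le> int d"
    proof (cases "k < 0")
      case True
      then have "\<beta> + of_int k = \<beta> - of_nat (nat (- k))" by (simp add: of_nat_nat)
      then have "nat (- k) \<in> D" using True u k by (auto simp: D_def)
      then show ?thesis using d True by fastforce
    qed simp
    then have "(of_nat (nat (k + int d)) :: complex) = of_int k + of_nat d" by (simp add: of_nat_nat)
    moreover have "\<gamma> = \<beta> + of_int k - 1 / 16" using k by (simp add: eq_diff_eq)
    ultimately have "\<gamma> = (\<beta> - 1 / 16 - of_nat d) + of_nat (nat (k + int d))" by simp
    then show "\<gamma> \<in> {(\<beta> - 1 / 16 - of_nat d) + of_nat n | n. True}" by blast
  qed
  then show ?thesis unfolding highest_weight_def using weight_vacuum by blast
qed

section \<open>The map to the tensor product\<close>

abbreviation "FM \<equiv> twist lam fock"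
abbreviation "VN \<equiv> inflate vacuum_module"
abbreviation "pure \<equiv> pure_tensor FM VN"

lemma carr_VN: "carr VN = vacua"
  by (simp add: carr_inflate carr_vacuum)

lemma scl_FM [simp]: "scl FM = pscale" and scl_VN [simp]: "scl VN = s"
  by (simp_all add: twist_def fock_def inflate_def vacuum_module_def)

lemma act_VN: "act VN x v = gen_act s vac_op x v"
proof -
  have sub: "Poly_Mapping.keys (restrict_keys vir_gens x) \<subseteq> Poly_Mapping.keys x"
    by (auto simp: in_keys_iff lookup_restrict_keys split: if_splits)
  have "act VN x v = (\<Sum>g\<in>Poly_Mapping.keys (restrict_keys vir_gens x). s (Poly_Mapping.lookup x g) (vac_op g v))"
    unfolding inflate_def vacuum_module_def gen_act_def
    by (simp, rule sum.cong) (auto simp: in_keys_iff lookup_restrict_keys split: if_splits)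
  also have "\<dots> = gen_act s vac_op x v" unfolding gen_act_def
  proof (rule sum.mono_neutral_left)
    show "\<forall>g\<in>Poly_Mapping.keys x - Poly_Mapping.keys (restrict_keys vir_gens x). s (Poly_Mapping.lookup x g) (vac_op g v) = 0"
    proof
      fix g assume "g \<in> Poly_Mapping.keys x - Poly_Mapping.keys (restrict_keys vir_gens x)"
      then show "s (Poly_Mapping.lookup x g) (vac_op g v) = 0"
        by (cases g) (auto simp: in_keys_iff lookup_restrict_keys vir_gens_def)
    qed
  qed (use sub in auto)
  finally show ?thesis .
qed

lemma act_VN_vacua: "v \<in> vacua \<Longrightarrow> act VN x v \<in> vacua"
  unfolding act_VN gen_act_def
  by (intro subspace_sum[OF subspace_vacua] subspace_scale[OF subspace_vacua] vac_op_vacua)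

lemma act_VN_lin:
  "u \<in> vacua \<Longrightarrow> v \<in> vacua \<Longrightarrow> act VN x (u + v) = act VN x u + act VN x v"
  "u \<in> vacua \<Longrightarrow> act VN x (s a u) = s a (act VN x u)"
  unfolding act_VN gen_act_def
  by (simp_all add: vac_op_add vac_op_scale vacua_H scale_right_distrib sum.distrib scale_sum_right mult.commute)

lemma act_VN_parts: "act VN (fv_part 0 x) v = act VN x v" "act VN (fv_part 1 x) v = 0"
  by (simp_all add: inflate_def restrict_vir_parts vacuum_module_def ga)

lemma pure_lin:
  assumes "v \<in> vacua" "w \<in> vacua"
  shows "pure (f + g) v = pure f v + pure g v" "pure (pscale a f) v = fscale a (pure f v)"
    "pure f (v + w) = pure f v + pure f w" "pure f (s a v) = fscale a (pure f v)"
  using pure_tensor_bilinear[of FM VN] assms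
  unfolding bilinear_on_def linear_map_on_def carr_VN carr_twist_fock scl_FM scl_VN by blast+

lemma pure_zero_right: "pure f 0 = 0"
  using pure_lin(4)[of 0 0 f 0] subspace_0[OF subspace_vacua] by simp

lemma pure_expand:
  assumes v: "v \<in> vacua"
  shows "pure f v = (\<Sum>I\<in>Poly_Mapping.keys f. pure (Poly_Mapping.single I 1) (s (Poly_Mapping.lookup f I) v))"
proof -
  have sc: "pure (Poly_Mapping.single I 1) (s (Poly_Mapping.lookup f I) v)
      = pure (pscale (Poly_Mapping.lookup f I) (Poly_Mapping.single I 1)) v" for I
    using pure_lin(2,4)[OF v v] by simp
  have "pure (\<Sum>I\<in>Poly_Mapping.keys f. pscale (Poly_Mapping.lookup f I) (Poly_Mapping.single I 1)) v
     = (\<Sum>I\<in>Poly_Mapping.keys f. pure (pscale (Poly_Mapping.lookup f I) (Poly_Mapping.single I 1)) v)"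
    by (rule linear_map_on_sum[OF vector_space_pscale vector_space_fscale pm.subspace_UNIV, of "\<lambda>f. pure f v"])
       (use pure_lin[OF v v] in \<open>simp_all add: linear_map_on_def\<close>)
  then show ?thesis unfolding sc using poly_mapping_expand[of f] by simp
qed

text \<open>The odd part of \<open>x\<close> acts by zero on the second factor, so no sign appears.
  The argument uses only the grading of the Fock space and linearity of its operators, where
  \<open>tensor_act_pure\<close> assumes the module axioms for both factors.\<close>

lemma tensor_act_pure_vacua:
  assumes v: "v \<in> vacua"
  shows "tensor_act FM VN x (pure f v) = pure (act FM x f) v + pure f (act VN x v)"
proof
  fix B
  show "tensor_act FM VN x (pure f v) B = (pure (act FM x f) v + pure f (act VN x v)) B"
  proof (cases "bilinear_on FM VN (*) B")
    case False
    then show ?thesis by (simp add: tensor_act_def pure_tensor_def)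
  next
    case True
    then have Bl: "B (g + h) w = B g w + B h w" "B (pscale a g) w = a * B g w" if "w \<in> vacua" for g h w a
      using that unfolding bilinear_on_def linear_map_on_def carr_VN carr_twist_fock scl_FM scl_VN by blast+
    have Br: "B g (w + w') = B g w + B g w'" "B g (s a w) = a * B g w" if "w \<in> vacua" "w' \<in> vacua" for g w w' a
      using that True unfolding bilinear_on_def linear_map_on_def carr_VN carr_twist_fock scl_FM scl_VN by blast+
    let ?B = "\<lambda>m n. B (act FM x m) n
       + (\<Sum>p\<in>{0, 1}. \<Sum>q\<in>{0, 1}. koszul (p * q) * B (component FM q m) (act VN (fv_part p x) n))"
    have B0: "B g 0 = 0" for g using Br(2)[of 0 0 g 0] subspace_0[OF subspace_vacua] by simp
    have e: "?B m n = B (act FM x m) n + B m (act VN x n)" if n: "n \<in> vacua" for m n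
    proof -
      have "B (component FM 0 m) (act VN x n) + B (component FM 1 m) (act VN x n) = B m (act VN x n)"
        using Bl(1)[OF act_VN_vacua[OF n], of "component FM 0 m" "component FM 1 m" x] by (simp add: component_sum_fock)
      then show ?thesis by (simp add: act_VN_parts B0 koszul_def)
    qed
    have "bilinear_on FM VN (*) ?B"
      unfolding bilinear_on_def linear_map_on_def carr_VN carr_twist_fock scl_FM scl_VN
    proof (intro conjI ballI allI)
      fix n f g a assume n: "n \<in> vacua"
      show "?B (f + g) n = ?B f n + ?B g n" "?B (pscale a f) n = a * ?B f n"
        unfolding e[OF n] unfolding act_twist_fock_lin Bl[OF n] Bl[OF act_VN_vacua[OF n]] by (simp_all add: algebra_simps)
    next
      fix m u w a assume u: "u \<in> vacua" and w: "w \<in> vacua"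
      note uw = subspace_add[OF subspace_vacua u w]
      show "?B m (u + w) = ?B m u + ?B m w"
        unfolding e[OF u] e[OF w] e[OF uw] unfolding act_VN_lin(1)[OF u w] Br(1)[OF u w]
          Br(1)[OF act_VN_vacua[OF u] act_VN_vacua[OF w]] by (simp add: algebra_simps)
    next
      fix m u a assume u: "u \<in> vacua"
      note au = subspace_scale[OF subspace_vacua u, of a]
      show "?B m (s a u) = a * ?B m u"
        unfolding e[OF u] e[OF au] unfolding act_VN_lin(2)[OF u] Br(2)[OF u u] Br(2)[OF act_VN_vacua[OF u] act_VN_vacua[OF u]]
        by (simp add: algebra_simps)
    qed
    then have "tensor_act FM VN x (pure f v) B = ?B f v" using True by (simp add: tensor_act_def pure_tensor_def)
    also have "\<dots> = (pure (act FM x f) v + pure f (act VN x v)) B"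
      unfolding e[OF v] using True by (simp add: pure_tensor_def)
    finally show ?thesis .
  qed
qed

text \<open>Checked on generators; for z the agreement is the equation between \<open>lam\<close>
  and \<zeta>.\<close>

lemma act_Theta:
  assumes v: "v \<in> vacua"
  shows "act W x (Theta f v) = Theta (act FM x f) v + Theta f (act VN x v)"
proof -
  have vH: "v \<in> H" using v by (rule vacua_H)
  have g: "gact W g (Theta f v) = Theta (pscale (sigma_coeff lam g) (fock_op g f)) v + Theta f (vac_op g v)" for g
  proof (cases g)
    case (L k)
    then show ?thesis by (simp add: lo_Theta[OF v])
  next
    case (Psi n)
    have "Theta f 0 = 0" using Theta_right(2)[of 0 0 f 0] by simp
    then show ?thesis using Psi by (simp add: ps_Theta[OF v] Theta_scale)
  next
    case C
    have "Theta f (s (1 / 2) v) = s (1 / 2) (Theta f v)" by (rule Theta_right(2)[OF vH vH])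
    then show ?thesis using C vH by (simp add: co_Theta Theta_scale Theta_right_diff)
  next
    case Z
    have "Theta f 0 = 0" using Theta_right(2)[of 0 0 f 0] by simp
    then show ?thesis using Z vH zo_zeta[of "Theta f v"] by (simp add: Theta_scale lam)
  qed
  have ThL: "Theta (\<Sum>g\<in>K. F g) v = (\<Sum>g\<in>K. Theta (F g) v)" for K and F :: "gen \<Rightarrow> ext"
    by (induction K rule: infinite_finite_induct) (simp_all add: Theta_add)
  have ThR: "Theta f (\<Sum>g\<in>K. F g) = (\<Sum>g\<in>K. Theta f (F g))" if "\<And>g. F g \<in> H" for K and F :: "gen \<Rightarrow> 'a"
    by (rule linear_map_on_sum[OF vector_space_axioms vector_space_axioms subspace_H _ that])
       (auto simp: linear_map_on_def Theta_right)
  have voH: "vac_op g v \<in> H" for g using vac_op_vacua[OF v] vacua_H by blast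
  have sR: "Theta f (s a w) = s a (Theta f w)" if "w \<in> H" for a w by (rule Theta_right(2)[OF that that])
  have "act W x (Theta f v) = (\<Sum>g\<in>Poly_Mapping.keys x. s (Poly_Mapping.lookup x g) (gact W g (Theta f v)))"
    using act_gens[OF Theta_H[OF vH]] by (simp add: gen_act_def)
  also have "\<dots> = (\<Sum>g\<in>Poly_Mapping.keys x. Theta (pscale (Poly_Mapping.lookup x g * sigma_coeff lam g) (fock_op g f)) v)
      + (\<Sum>g\<in>Poly_Mapping.keys x. Theta f (s (Poly_Mapping.lookup x g) (vac_op g v)))"
    unfolding g sum.distrib[symmetric] by (intro sum.cong refl) (simp add: scale_right_distrib Theta_scale sR[OF voH])
  also have "\<dots> = Theta (act FM x f) v + Theta f (act VN x v)"
    unfolding act_twist_fock act_VN gen_act_def ThL using voH by (subst ThR) simp_all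
  finally show ?thesis .
qed

text \<open>An expansion of \<open>w\<close> in Fock monomials with vacuum coefficients. Demanding
  zero coefficients outside \<open>A\<close> makes expansions over different index sets comparable,
  and determines \<open>F\<close> by \<open>w\<close>.\<close>

definition is_rep :: "'a \<Rightarrow> nat fset set \<Rightarrow> (nat fset \<Rightarrow> 'a) \<Rightarrow> bool" where
  "is_rep w A F \<longleftrightarrow> finite A \<and> (\<forall>I. F I \<in> vacua) \<and> (\<forall>I. I \<notin> A \<longrightarrow> F I = 0) \<and> w = (\<Sum>I\<in>A. modes I (F I))"

definition rep_tensor :: "nat fset set \<Rightarrow> (nat fset \<Rightarrow> 'a) \<Rightarrow> (ext, 'a) tensor" where
  "rep_tensor A F = (\<Sum>I\<in>A. pure (Poly_Mapping.single I 1) (F I))"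

text \<open>The choice is harmless, because the coefficient function is unique and enlarging the
  index set only adds zero terms.\<close>

definition to_tensor :: "'a \<Rightarrow> (ext, 'a) tensor" where
  "to_tensor w = (let r = (SOME r. is_rep w (fst r) (snd r)) in rep_tensor (fst r) (snd r))"

lemma is_rep_exists:
  assumes w: "w \<in> H" obtains A F where "is_rep w A F"
proof -
  have V: "vacua \<subseteq> H" using vacua_H by blast
  have sp: "w \<in> span {modes I u | I u. u \<in> vacua}" using w vacua_full by simp
  show thesis using modes_decomp[OF subspace_vacua V sp] that unfolding is_rep_def by blast
qed

lemma is_rep_superset: "is_rep w A F \<Longrightarrow> finite A' \<Longrightarrow> A \<subseteq> A' \<Longrightarrow> is_rep w A' F"
  unfolding is_rep_def by (auto intro!: sum.mono_neutral_left)

lemma rep_tensor_superset: "is_rep w A F \<Longrightarrow> finite A' \<Longrightarrow> A \<subseteq> A' \<Longrightarrow> rep_tensor A' F = rep_tensor A F"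
  unfolding is_rep_def rep_tensor_def by (intro sum.mono_neutral_right) (auto simp: pure_zero_right)

lemma is_rep_unique:
  assumes "is_rep w A F" "is_rep w A' F'" shows "F = F'"
proof
  fix I
  let ?A = "insert I (A \<union> A')"
  have fin: "finite ?A" using assms by (simp add: is_rep_def)
  have r: "is_rep w ?A F" "is_rep w ?A F'" using is_rep_superset[OF _ fin] assms by blast+
  then have "(\<Sum>I\<in>?A. modes I (F I - F' I)) = 0"
    using vacua_H by (simp add: is_rep_def modes_diff sum_subtractf)
  then have "F I - F' I = 0"
    using fin r subspace_diff[OF subspace_vacua] by (intro modes_independent[of ?A "\<lambda>I. F I - F' I" I]) (auto simp: is_rep_def)
  then show "F I = F' I" by simp
qed

lemma to_tensor_eq:
  assumes "is_rep w A F" shows "to_tensor w = rep_tensor A F"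
proof -
  define r where "r = (SOME r. is_rep w (fst r) (snd r))"
  have r: "is_rep w (fst r) (snd r)"
    unfolding r_def by (rule someI[of "\<lambda>r. is_rep w (fst r) (snd r)" "(A, F)"]) (simp add: assms)
  then have e: "snd r = F" by (rule is_rep_unique[OF _ assms])
  have fin: "finite (A \<union> fst r)" using r assms by (simp add: is_rep_def)
  have "rep_tensor (fst r) F = rep_tensor A F"
    using rep_tensor_superset[OF assms fin] rep_tensor_superset[OF r[unfolded e] fin] by simp
  then show ?thesis by (simp add: to_tensor_def e flip: r_def)
qed

lemma to_tensor_add:
  assumes "u \<in> H" "w \<in> H" shows "to_tensor (u + w) = to_tensor u + to_tensor w"
proof -
  obtain A F where r1: "is_rep u A F" by (rule is_rep_exists[OF assms(1)])
  obtain A' F' where "is_rep w A' F'" by (rule is_rep_exists[OF assms(2)])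
  note r0 = r1 this
  let ?A = "A \<union> A'"
  have fin: "finite ?A" using r0 by (simp add: is_rep_def)
  have r: "is_rep u ?A F" "is_rep w ?A F'" using is_rep_superset[OF _ fin] r0 by blast+
  then have V: "F I \<in> vacua" "F' I \<in> vacua" for I by (simp_all add: is_rep_def)
  have "is_rep (u + w) ?A (\<lambda>I. F I + F' I)"
    using r subspace_add[OF subspace_vacua] V vacua_H by (auto simp: is_rep_def modes_lin sum.distrib)
  then show ?thesis using r by (simp add: to_tensor_eq rep_tensor_def pure_lin[OF V] sum.distrib)
qed

lemma to_tensor_scale:
  assumes "u \<in> H" shows "to_tensor (s a u) = fscale a (to_tensor u)"
proof -
  obtain A F where r: "is_rep u A F" by (rule is_rep_exists[OF assms])
  then have V: "F I \<in> vacua" for I by (simp add: is_rep_def)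
  have "is_rep (s a u) A (\<lambda>I. s a (F I))"
    using r subspace_scale[OF subspace_vacua] V vacua_H by (auto simp: is_rep_def modes_scale scale_sum_right)
  then show ?thesis using r by (simp add: to_tensor_eq rep_tensor_def pure_lin(4)[OF V V] fs.scale_sum_right)
qed

lemma to_tensor_Theta:
  assumes v: "v \<in> vacua" shows "to_tensor (Theta f v) = pure f v"
proof -
  have "is_rep (Theta f v) (Poly_Mapping.keys f) (\<lambda>I. s (Poly_Mapping.lookup f I) v)"
    using v subspace_scale[OF subspace_vacua] vacua_H[OF v]
    by (auto simp: is_rep_def Theta_def modes_scale in_keys_iff)
  then show ?thesis unfolding pure_expand[OF v] by (simp add: to_tensor_eq rep_tensor_def)
qed

lemma rep_Theta: "is_rep w A F \<Longrightarrow> w = (\<Sum>I\<in>A. Theta (Poly_Mapping.single I 1) (F I))"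
  by (simp add: is_rep_def Theta_single)

lemma to_tensor_linear: "linear_map_on s fscale H to_tensor"
  by (simp add: linear_map_on_def to_tensor_add to_tensor_scale)

lemma to_tensor_sum: "(\<And>i. i \<in> K \<Longrightarrow> w i \<in> H) \<Longrightarrow> to_tensor (sum w K) = (\<Sum>i\<in>K. to_tensor (w i))"
  by (rule linear_map_on_sum[OF vector_space_axioms vector_space_fscale subspace_H to_tensor_linear])

text \<open>\<open>Theta\<close> is bilinear and so factors through the tensor product, where it
  recovers \<open>w\<close> from its image.\<close>

lemma to_tensor_zero: assumes "w \<in> H" "to_tensor w = 0" shows "w = 0"
proof -
  obtain A F where r: "is_rep w A F" by (rule is_rep_exists[OF assms(1)])
  have "bilinear_on FM VN s Theta"
    unfolding bilinear_on_def linear_map_on_def carr_VN carr_twist_fock scl_FM scl_VN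
    using vacua_H by (auto simp: Theta_add Theta_scale Theta_right(1) Theta_right_scale)
  moreover have "(\<Sum>I\<in>A. pure (Poly_Mapping.single I 1) (F I)) = 0"
    using assms(2) to_tensor_eq[OF r] by (simp add: rep_tensor_def)
  ultimately have "(\<Sum>I\<in>A. Theta (Poly_Mapping.single I 1) (F I)) = 0"
    using r by (intro tensor_universal[OF vector_space_axioms]) (auto simp: carr_VN carr_twist_fock is_rep_def)
  then show ?thesis using rep_Theta[OF r] by simp
qed

abbreviation "TP \<equiv> tensor_product FM VN"

lemma pure_single_grade: "v \<in> vacua \<Longrightarrow> pure (Poly_Mapping.single I 1) v \<in> grade TP (of_nat (fcard I))"
  unfolding tensor_product_def using single_fock_grade[of I 1]
  by (simp, intro fs.span_base CollectI exI[of _ "Poly_Mapping.single I 1"] exI[of _ v] exI[of _ "of_nat (fcard I)"] exI[of _ 0])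
     (auto simp: twist_def inflate_def vacuum_module_def)

lemma subspace_grade_TP: "fs.subspace (grade TP p)"
  by (simp add: tensor_product_def)

text \<open>The images of the homogeneous parts are determined exactly, beyond the inclusion that an
  isomorphism requires, because the comparison with a restricted dual has to pull homogeneous
  vectors back.\<close>

lemma to_tensor_iso:
  "bij_betw to_tensor H (carr TP)" "linear_map_on s (scl TP) H to_tensor" "to_tensor ` grade W p = grade TP p"
  "w \<in> H \<Longrightarrow> to_tensor (act W x w) = act TP x (to_tensor w)"
proof -
  have subT: "fs.subspace (carr TP)" unfolding carr_def using fs.subspace_sums[OF subspace_grade_TP subspace_grade_TP] .
  have gT: "grade TP p \<subseteq> carr TP" for p
  proof
    fix t assume t: "t \<in> grade TP p"
    have "t + 0 \<in> carr TP" by (rule sum_in_carr[OF t fs.subspace_0[OF subspace_grade_TP]])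
    then show "t \<in> carr TP" by simp
  qed
  have img: "fs.subspace (to_tensor ` X)" if X: "subspace X" "X \<subseteq> H" for X
    unfolding fs.subspace_def
  proof (intro conjI ballI allI)
    show "0 \<in> to_tensor ` X" using to_tensor_scale[of 0 0] subspace_0[OF X(1)] by (intro image_eqI[of _ _ 0]) simp_all
  next
    fix x y assume "x \<in> to_tensor ` X" "y \<in> to_tensor ` X"
    then obtain u v where uv: "x = to_tensor u" "y = to_tensor v" "u \<in> X" "v \<in> X" by blast
    then have "u \<in> H" "v \<in> H" using X by blast+
    with uv show "x + y \<in> to_tensor ` X" using X subspace_add[OF X(1) uv(3,4)]
      by (intro image_eqI[of _ _ "u + v"]) (auto simp: to_tensor_add)
  next
    fix c x assume "x \<in> to_tensor ` X"
    then obtain u where u: "x = to_tensor u" "u \<in> X" by blast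
    then have "u \<in> H" using X by blast
    with u show "fscale c x \<in> to_tensor ` X" using X subspace_scale[OF X(1) u(2)]
      by (intro image_eqI[of _ _ "s c u"]) (auto simp: to_tensor_scale)
  qed
  have gi': "grade TP p \<subseteq> to_tensor ` grade W p" for p
    unfolding tensor_product_def smod.simps
  proof (rule fs.span_minimal[OF _ img[OF subspace_grade]])
    show "{pure m n |m n pa q. m \<in> grade FM pa \<and> n \<in> grade VN q \<and> pa + q = p} \<subseteq> to_tensor ` grade W p"
    proof
      fix t assume "t \<in> {pure m n |m n pa q. m \<in> grade FM pa \<and> n \<in> grade VN q \<and> pa + q = p}"
      then obtain m n pa q where t: "t = pure m n" "m \<in> grade FM pa" "n \<in> grade VN q" "pa + q = p" by blast
      have n: "n \<in> vacua" using t(3) subspace_0[OF subspace_vacua] by (auto simp: inflate_def vacuum_module_def split: if_splits)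
      have "Theta m n \<in> grade W p"
      proof (cases "q = 0")
        case True
        then have "pa = p" using t(4) by (simp only: add_0_right)
        then have "m \<in> grade fock p" using t(2) by (simp add: twist_def)
        then show ?thesis by (rule Theta_grade[OF vacua_grade[OF n]])
      next
        case False
        then have "n = 0" using t(3) by (simp add: inflate_def vacuum_module_def)
        then show ?thesis using Theta_right_scale[of 0 m 0] subspace_0[OF subspace_grade] by simp
      qed
      then show "t \<in> to_tensor ` grade W p" using to_tensor_Theta[OF n, of m] t(1) by (intro image_eqI[of _ _ "Theta m n"]) simp_all
    qed
  qed (use grade_H in blast)
  have gi: "grade TP p \<subseteq> to_tensor ` H" for p using gi'[of p] grade_H by blast
  have img: "fs.subspace (to_tensor ` H)" by (rule img[OF subspace_H subset_refl])
  have "carr TP \<subseteq> to_tensor ` H"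
  proof
    fix t assume "t \<in> carr TP"
    then obtain u v where uv: "t = u + v" "u \<in> grade TP 0" "v \<in> grade TP 1" by (auto simp: carr_def[of TP])
    show "t \<in> to_tensor ` H" unfolding uv(1) using uv(2,3) gi by (intro fs.subspace_add[OF img]) auto
  qed
  moreover have "to_tensor ` H \<subseteq> carr TP"
  proof safe
    fix w assume "w \<in> H"
    then obtain A F where r: "is_rep w A F" using is_rep_exists by blast
    then show "to_tensor w \<in> carr TP" unfolding to_tensor_eq[OF r] rep_tensor_def
      by (intro fs.subspace_sum[OF subT] subsetD[OF gT pure_single_grade]) (simp add: is_rep_def)
  qed
  moreover have "inj_on to_tensor H"
  proof
    fix u w assume uw: "u \<in> H" "w \<in> H" "to_tensor u = to_tensor w"
    have "to_tensor (u + s (-1) w) = to_tensor u + fscale (-1) (to_tensor w)"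
      using uw by (simp only: to_tensor_add to_tensor_scale H_closed)
    also have "\<dots> = 0" using uw(3) by simp
    finally have "u + s (-1) w = 0" using uw by (intro to_tensor_zero) simp_all
    then show "u = w" by simp
  qed
  ultimately show "bij_betw to_tensor H (carr TP)" unfolding bij_betw_def by blast
  show "linear_map_on s (scl TP) H to_tensor" using to_tensor_linear by (simp add: tensor_product_def)
  have "to_tensor ` grade W p \<subseteq> grade TP p" for p
  proof safe
    fix w assume w: "w \<in> grade W p"
    obtain A F where r: "is_rep w A F" by (rule is_rep_exists[OF grade_H[OF w]])
    let ?A1 = "{I \<in> A. of_nat (fcard I) = p}" and ?A2 = "{I \<in> A. of_nat (fcard I) = p + 1}"
    have fin: "finite A" and FV: "\<And>I. F I \<in> vacua" using r by (auto simp: is_rep_def)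
    have two: "(b :: bit) = p \<or> b = p + 1" "p + 1 \<noteq> p" for b by (cases b; cases p; simp)+
    have A: "A = ?A1 \<union> ?A2" "?A1 \<inter> ?A2 = {}" using two by auto
    have m: "modes I (F I) \<in> grade W (of_nat (fcard I))" for I
      using modes_grade[OF vacua_grade[OF FV], of I] by (simp only: add_0_right)
    have w1: "(\<Sum>I\<in>?A1. modes I (F I)) \<in> grade W p" and w2: "(\<Sum>I\<in>?A2. modes I (F I)) \<in> grade W (p + 1)"
      using m by (auto intro!: subspace_sum[OF subspace_grade]) (metis m)+
    have ws: "w = (\<Sum>I\<in>?A1. modes I (F I)) + (\<Sum>I\<in>?A2. modes I (F I))"
      using r fin A by (subst sum.union_disjoint[symmetric]) (auto simp: is_rep_def)
    \<comment> \<open>The part of the wrong parity is a difference of vectors of parity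
      \<open>p\<close>, hence zero, and independence of the modes removes its coefficients.\<close>
    then have "(\<Sum>I\<in>?A2. modes I (F I)) = w - (\<Sum>I\<in>?A1. modes I (F I))" by simp
    then have "(\<Sum>I\<in>?A2. modes I (F I)) \<in> grade W p" using w w1 subspace_diff[OF subspace_grade] by simp
    moreover have "grade W p \<inter> grade W (p + 1) = {0}"
    proof -
      have "grade W 0 \<inter> grade W 1 = {0}" using super unfolding super_module_def by blast
      then show ?thesis by (cases p) auto
    qed
    ultimately have "(\<Sum>I\<in>?A2. modes I (F I)) = 0" using w2 by blast
    then have z: "F I = 0" if "I \<in> ?A2" for I
      using that fin FV by (intro modes_independent[of ?A2 F]) auto
    show "to_tensor w \<in> grade TP p" unfolding to_tensor_eq[OF r] rep_tensor_def
    proof (rule fs.subspace_sum[OF subspace_grade_TP])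
      fix I assume I: "I \<in> A"
      show "pure (Poly_Mapping.single I 1) (F I) \<in> grade TP p"
      proof (cases "of_nat (fcard I) = p")
        case True
        then show ?thesis using pure_single_grade[OF FV, of I I] by simp
      next
        case False
        then have "I \<in> ?A2" using I two(1)[of "of_nat (fcard I)"] by simp
        then show ?thesis using z by (simp add: pure_zero_right fs.subspace_0[OF subspace_grade_TP])
      qed
    qed
  qed
  then show "to_tensor ` grade W p = grade TP p" using gi' by blast
  show "to_tensor (act W x w) = act TP x (to_tensor w)" if w: "w \<in> H"
  proof -
    obtain A F where r: "is_rep w A F" by (rule is_rep_exists[OF w])
    have FV: "F I \<in> vacua" for I using r by (simp add: is_rep_def)
    have lin: "linear_map_on s s H (act W x)" using super unfolding super_module_def by blast
    have "act W x w = (\<Sum>I\<in>A. act W x (Theta (Poly_Mapping.single I 1) (F I)))"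
      by (subst rep_Theta[OF r], rule linear_map_on_sum[OF vector_space_axioms vector_space_axioms subspace_H lin])
         (simp add: vacua_H[OF FV])
    also have "\<dots> = (\<Sum>I\<in>A. Theta (act FM x (Poly_Mapping.single I 1)) (F I) + Theta (Poly_Mapping.single I 1) (act VN x (F I)))"
      by (simp add: act_Theta[OF FV])
    also have "to_tensor \<dots> = (\<Sum>I\<in>A. pure (act FM x (Poly_Mapping.single I 1)) (F I) + pure (Poly_Mapping.single I 1) (act VN x (F I)))"
      using vacua_H FV act_VN_vacua by (subst to_tensor_sum) (simp_all add: to_tensor_add to_tensor_Theta)
    also have "\<dots> = (\<Sum>I\<in>A. tensor_act FM VN x (pure (Poly_Mapping.single I 1) (F I)))"
      by (simp add: tensor_act_pure_vacua[OF FV])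
    also have "\<dots> = tensor_act FM VN x (to_tensor w)"
    proof -
      have "tensor_act FM VN x (sum t K) = (\<Sum>i\<in>K. tensor_act FM VN x (t i))" for K and t :: "nat fset \<Rightarrow> _"
      proof -
        have z: "tensor_act FM VN x 0 = 0" by (simp add: tensor_act_def fun_eq_iff)
        have a: "tensor_act FM VN x (t + t') = tensor_act FM VN x t + tensor_act FM VN x t'" for t t'
          by (simp add: tensor_act_def fun_eq_iff)
        show ?thesis by (induction K rule: infinite_finite_induct) (simp_all only: sum.infinite sum.empty sum.insert z a not_False_eq_True)
      qed
      then show ?thesis by (simp add: to_tensor_eq[OF r] rep_tensor_def)
    qed
    finally show ?thesis by (simp add: tensor_product_def)
  qed
qed

end

section \<open>The contragredient module\<close>

lemma koszul_add: "koszul (p + q) = koszul p * koszul q"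
  by (cases p; cases q) (simp_all add: koszul_def)

lemma koszul_sq [simp]: "koszul p * koszul p = 1"
  by (simp add: koszul_def)

lemma koszul_0 [simp]: "koszul 0 = 1"
  by (simp add: koszul_def)

lemma bit_add_self: "(p :: bit) + p = 0" "p + (p + q) = q"
  by (cases p; cases q; simp)+

lemma fv_grade_subspace: "pm.subspace (fv_grade p)"
  using subspace_span_of_gens[of "{g. gen_parity g = p}"]
  by (simp add: fv_grade_def span_of_gens_def subset_eq Ball_def)

lemma single_fv_grade: "gen_parity g = p \<Longrightarrow> Poly_Mapping.single g c \<in> fv_grade p"
  by (auto simp: fv_grade_def in_keys_iff lookup_single when_def)

lemma gen_bracket_grade: "gen_bracket g h \<in> fv_grade (gen_parity g + gen_parity h)"
  using pm.subspace_0[OF fv_grade_subspace] pm.subspace_neg[OF fv_grade_subspace single_fv_grade]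
  by (cases g; cases h) (auto intro!: pm.subspace_add[OF fv_grade_subspace] single_fv_grade simp: single_uminus[symmetric] simp del: single_uminus)

lemma bracket_grade:
  assumes "x \<in> fv_grade p" "y \<in> fv_grade q" shows "bracket x y \<in> fv_grade (p + q)"
  unfolding bracket_def
proof (intro pm.subspace_sum[OF fv_grade_subspace] pm.subspace_scale[OF fv_grade_subspace])
  fix g h assume "g \<in> Poly_Mapping.keys x" "h \<in> Poly_Mapping.keys y"
  then show "gen_bracket g h \<in> fv_grade (p + q)" using assms gen_bracket_grade[of g h] by (simp add: fv_grade_def)
qed

lemma lookup_fv_part: "Poly_Mapping.lookup (fv_part p x) g = (if gen_parity g = p then Poly_Mapping.lookup x g else 0)"
  by (simp add: fv_part_def lookup_restrict_keys)

lemma fv_part_grade: "fv_part p x \<in> fv_grade p"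
  by (auto simp: fv_grade_def in_keys_iff lookup_fv_part split: if_splits)

lemma fv_part_lin: "fv_part p (x + y) = fv_part p x + fv_part p y" "fv_part p (pscale a x) = pscale a (fv_part p x)"
  by (rule poly_mapping_eqI; simp add: lookup_fv_part lookup_add)+

lemma fv_part_sum: "x = fv_part 0 x + fv_part 1 x"
proof (rule poly_mapping_eqI)
  fix g show "Poly_Mapping.lookup x g = Poly_Mapping.lookup (fv_part 0 x + fv_part 1 x) g"
    by (cases "gen_parity g") (simp_all add: lookup_fv_part lookup_add)
qed

context fv_module
begin

abbreviation "cp \<equiv> component W"

lemma cp_grade: "v \<in> H \<Longrightarrow> cp p v \<in> grade W p"
proof -
  assume "v \<in> H"
  then obtain a b where "a \<in> grade W p" "b \<in> grade W (p + 1)" "v = a + b" using carr_decomp[OF super] by metis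
  then show ?thesis using component_eq[OF super] by simp
qed

lemma cp_H [simp]: "v \<in> H \<Longrightarrow> cp p v \<in> H"
  using cp_grade grade_H by blast

lemma cp_lin: "u \<in> H \<Longrightarrow> v \<in> H \<Longrightarrow> cp p (u + v) = cp p u + cp p v" "u \<in> H \<Longrightarrow> cp p (s a u) = s a (cp p u)"
  using component_linear[OF super, of p] unfolding linear_map_on_def by blast+

lemma cp_hom: "v \<in> grade W q \<Longrightarrow> cp p v = (if p = q then v else 0)"
proof -
  assume v: "v \<in> grade W q"
  have 0: "0 \<in> grade W r" for r using subspace_0[OF subspace_grade] .
  show ?thesis
  proof (cases "p = q")
    case True
    then show ?thesis using component_eq[OF super v 0] by simp
  next
    case False
    then have "q = p + 1" by (cases p; cases q) simp_all
    then show ?thesis using component_eq[OF super 0, of v p] v False by simp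
  qed
qed

lemma act_lin_arg: "u \<in> H \<Longrightarrow> v \<in> H \<Longrightarrow> act W x (u + v) = act W x u + act W x v" "u \<in> H \<Longrightarrow> act W x (s a u) = s a (act W x u)"
  by (simp_all add: act_gens gen_act_def gact_lin scale_right_distrib sum.distrib scale_sum_right mult.commute)

lemma act_lin_fv: "v \<in> H \<Longrightarrow> act W (x + y) v = act W x v + act W y v" "v \<in> H \<Longrightarrow> act W (pscale a x) v = s a (act W x v)"
  "v \<in> H \<Longrightarrow> act W 0 v = 0"
  by (simp_all add: act_gens ga)

lemma act_H [simp]: "v \<in> H \<Longrightarrow> act W x v \<in> H"
  by (simp add: act_gens gen_act_def H_sum)

lemma act_grade:
  assumes "x \<in> fv_grade p" "v \<in> grade W q" shows "act W x v \<in> grade W (p + q)"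
proof -
  have "\<forall>p q. \<forall>x \<in> FV \<inter> fv_grade p. \<forall>v \<in> grade W q. act W x v \<in> grade W (p + q)"
    using super unfolding super_module_def by (elim conjE)
  then show ?thesis using assms by blast
qed

lemma act_bracket:
  assumes "x \<in> fv_grade p" "y \<in> fv_grade q" "v \<in> H"
  shows "act W (bracket x y) v = act W x (act W y v) - s (koszul (p * q)) (act W y (act W x v))"
proof -
  have "\<forall>p q. \<forall>x \<in> FV \<inter> fv_grade p. \<forall>y \<in> FV \<inter> fv_grade q. \<forall>v \<in> H.
        act W (bracket x y) v = act W x (act W y v) - s (koszul (p * q)) (act W y (act W x v))"
    using super unfolding super_module_def by (elim conjE)
  then show ?thesis using assms by blast
qed

end

section \<open>A symmetric form and the contragredient action on the same space\<close>

context hc_module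
begin

text \<open>A homogeneous basis identifies the restricted dual with the module itself, via the symmetric form
  that makes the basis orthonormal.  This keeps the contragredient module on the type \<^typ>\<open>'a\<close>.\<close>

definition hom_basis :: "'a set" where
  "hom_basis = (SOME B. B \<subseteq> (\<Union>\<alpha> p. wt \<alpha> \<inter> grade W p) \<and> independent B \<and> (\<Union>\<alpha> p. wt \<alpha> \<inter> grade W p) \<subseteq> span B)"

lemma hom_basis:
  "hom_basis \<subseteq> (\<Union>\<alpha> p. wt \<alpha> \<inter> grade W p)" "independent hom_basis" "(\<Union>\<alpha> p. wt \<alpha> \<inter> grade W p) \<subseteq> span hom_basis"
proof -
  have "\<exists>B. B \<subseteq> (\<Union>\<alpha> p. wt \<alpha> \<inter> grade W p) \<and> independent B \<and> (\<Union>\<alpha> p. wt \<alpha> \<inter> grade W p) \<subseteq> span B"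
    using maximal_independent_subset by metis
  from someI_ex[OF this]
  show "hom_basis \<subseteq> (\<Union>\<alpha> p. wt \<alpha> \<inter> grade W p)" "independent hom_basis" "(\<Union>\<alpha> p. wt \<alpha> \<inter> grade W p) \<subseteq> span hom_basis"
    unfolding hom_basis_def by blast+
qed

lemma basis_hom: assumes "b \<in> hom_basis" obtains \<alpha> p where "b \<in> wt \<alpha>" "b \<in> grade W p"
  using assms hom_basis(1) by blast

lemma basis_H [simp]: "b \<in> hom_basis \<Longrightarrow> b \<in> H"
  using basis_hom wt_H by blast

lemma span_basis: "span hom_basis = H"
proof
  show "span hom_basis \<subseteq> H" by (rule span_minimal[OF _ subspace_H]) auto
  have "wt \<alpha> \<subseteq> span hom_basis" for \<alpha>
  proof
    fix v assume v: "v \<in> wt \<alpha>"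
    obtain a b where ab: "a \<in> grade W 0" "b \<in> grade W 1" "v = a + b" using H_decomp wt_H[OF v] by blast
    then have "a \<in> wt \<alpha>" "b \<in> wt \<alpha>" using wt_parity v by blast+
    then have "a \<in> span hom_basis" "b \<in> span hom_basis" using ab hom_basis(3) by blast+
    then show "v \<in> span hom_basis" using ab span_add by simp
  qed
  then show "H \<subseteq> span hom_basis" unfolding H_span_wt by (intro span_minimal) auto
qed

definition coord :: "'a \<Rightarrow> 'a \<Rightarrow> complex" where
  "coord b v = representation hom_basis v b"

lemma coord_add: "u \<in> H \<Longrightarrow> v \<in> H \<Longrightarrow> coord b (u + v) = coord b u + coord b v"
  and coord_scale: "u \<in> H \<Longrightarrow> coord b (s a u) = a * coord b u"
  by (simp_all add: coord_def representation_add[OF hom_basis(2)] representation_scale[OF hom_basis(2)] span_basis)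

lemma coord_basis: "b' \<in> hom_basis \<Longrightarrow> coord b b' = (if b = b' then 1 else 0)"
  by (simp add: coord_def representation_basis[OF hom_basis(2)])

lemma coord_supp: "coord b v \<noteq> 0 \<Longrightarrow> b \<in> hom_basis"
  unfolding coord_def by (rule representation_ne_zero)

lemma finite_coord: "finite {b. coord b v \<noteq> 0}"
  unfolding coord_def by (rule finite_representation)

lemma coord_expand: "v \<in> H \<Longrightarrow> (\<Sum>b | coord b v \<noteq> 0. s (coord b v) b) = v"
  unfolding coord_def by (rule sum_nonzero_representation_eq[OF hom_basis(2)]) (simp add: span_basis)

lemma coord_linear: "linear_map_on s (*) H (coord b)"
  by (simp add: linear_map_on_def coord_add coord_scale)

lemma vector_space_complex: "vector_space ((*) :: complex \<Rightarrow> complex \<Rightarrow> complex)"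
  by unfold_locales (simp_all add: algebra_simps)

lemma coord_sum: "(\<And>i. i \<in> I \<Longrightarrow> f i \<in> H) \<Longrightarrow> coord b (sum f I) = (\<Sum>i\<in>I. coord b (f i))"
  by (rule linear_map_on_sum[OF vector_space_axioms vector_space_complex subspace_H coord_linear])

lemma coord_combination:
  assumes "finite F" "F \<subseteq> hom_basis" shows "coord b (\<Sum>c\<in>F. s (r c) c) = (if b \<in> F then r b else 0)"
proof -
  have "coord b (\<Sum>c\<in>F. s (r c) c) = (\<Sum>c\<in>F. coord b (s (r c) c))" using assms by (intro coord_sum) auto
  also have "\<dots> = (\<Sum>c\<in>F. if c = b then r c else 0)"
    using assms by (intro sum.cong refl) (auto simp: coord_scale coord_basis)
  finally show ?thesis using assms by simp
qed

text \<open>Every basis vector is a weight vector, so comparing coefficients in L_0 v = \<alpha> v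
  leaves only basis vectors of weight \<alpha>.\<close>

lemma coord_wt:
  assumes v: "v \<in> wt \<alpha>" and b: "b \<in> wt \<gamma>" "coord b v \<noteq> 0" shows "\<gamma> = \<alpha>"
proof -
  let ?F = "{c. coord c v \<noteq> 0}"
  have vH: "v \<in> H" using v by (rule wt_H)
  have "\<forall>c\<in>?F. \<exists>\<gamma>. c \<in> wt \<gamma>" using coord_supp basis_hom by blast
  then obtain w where w: "\<And>c. c \<in> ?F \<Longrightarrow> c \<in> wt (w c)" by metis
  have FH: "c \<in> H" if "c \<in> ?F" for c using that coord_supp basis_H by blast
  have "lo 0 v = lo 0 (\<Sum>c\<in>?F. s (coord c v) c)" using coord_expand[OF vH] by simp
  also have "\<dots> = (\<Sum>c\<in>?F. s (coord c v * w c) c)"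
  proof (subst gact_sum)
    show "(\<Sum>c\<in>?F. lo 0 (s (coord c v) c)) = (\<Sum>c\<in>?F. s (coord c v * w c) c)"
      using FH by (intro sum.cong refl) (simp add: gact_scale wt_eq[OF w])
  qed (use FH in simp)
  finally have "coord b (lo 0 v) = coord b v * w b"
    using b(2) coord_supp finite_coord[of v] by (simp add: coord_combination subset_eq)
  moreover have "coord b (lo 0 v) = \<alpha> * coord b v" using wt_eq[OF v] coord_scale[OF vH] by simp
  ultimately have wb: "w b = \<alpha>" using b(2) by simp
  then have "b \<in> wt \<alpha>" using w[of b] b(2) by simp
  then have "s \<alpha> b = s \<gamma> b" using wt_eq b(1) by metis
  moreover have "b \<noteq> 0" using coord_supp[OF b(2)] hom_basis(2) dependent_zero by blast
  ultimately show ?thesis by simp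
qed

lemma coord_grade:
  assumes v: "v \<in> grade W p" and b: "b \<in> grade W q" "coord b v \<noteq> 0" shows "q = p"
proof (rule ccontr)
  assume "q \<noteq> p"
  then have q: "q = p + 1" by (cases p; cases q) simp_all
  let ?F = "{c. coord c v \<noteq> 0}"
  let ?F1 = "{c \<in> ?F. c \<in> grade W p}" and ?F2 = "{c \<in> ?F. c \<notin> grade W p}"
  have vH: "v \<in> H" using v by (rule grade_H)
  have F2: "c \<in> grade W (p + 1)" if c: "c \<in> ?F2" for c
  proof -
    have "c \<in> hom_basis" using c coord_supp by blast
    then obtain r where r: "c \<in> grade W r" using basis_hom by metis
    then have "r \<noteq> p" using c by auto
    then have "r = p + 1" by (cases p; cases r) simp_all
    then show ?thesis using r by simp
  qed
  have fin: "finite ?F1" "finite ?F2" using finite_coord[of v] by simp_all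
  let ?a = "\<Sum>c\<in>?F1. s (coord c v) c" and ?b = "\<Sum>c\<in>?F2. s (coord c v) c"
  have e: "v = ?a + ?b"
  proof -
    have "?a + ?b = (\<Sum>c\<in>?F1 \<union> ?F2. s (coord c v) c)" using fin by (intro sum.union_disjoint[symmetric]) auto
    also have "?F1 \<union> ?F2 = ?F" by auto
    finally show ?thesis using coord_expand[OF vH] by simp
  qed
  have gr: "?a \<in> grade W p" "?b \<in> grade W (p + 1)"
    using F2 by (auto intro!: subspace_sum[OF subspace_grade] subspace_scale[OF subspace_grade])
  then have "cp p (?a + ?b) = ?a" by (rule component_eq[OF super])
  then have "?b = 0" using e cp_hom[OF v, of p] by simp
  then have "coord b ?b = 0" using coord_scale[of 0 b 0] by simp
  moreover have "coord b ?b = (if b \<in> ?F2 then coord b v else 0)"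
    using fin coord_supp by (intro coord_combination) auto
  moreover have "b \<notin> grade W p"
  proof
    assume "b \<in> grade W p"
    then have "cp p b = b" using cp_hom[of b p p] by simp
    moreover have "cp p b = 0" using cp_hom[OF b(1), of p] \<open>q \<noteq> p\<close> by (metis (full_types))
    ultimately have "b = 0" by simp
    then show False using coord_supp[OF b(2)] hom_basis(2) dependent_zero by auto
  qed
  ultimately show False using b(2) by auto
qed

definition form :: "'a \<Rightarrow> 'a \<Rightarrow> complex" where
  "form u v = (\<Sum>b | coord b u \<noteq> 0. coord b u * coord b v)"

lemma form_superset:
  assumes "finite F" "{b. coord b u \<noteq> 0} \<subseteq> F \<or> {b. coord b v \<noteq> 0} \<subseteq> F"
  shows "form u v = (\<Sum>b\<in>F. coord b u * coord b v)"
proof -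
  let ?U = "{b. coord b u \<noteq> 0}"
  have "form u v = (\<Sum>b\<in>?U \<union> F. coord b u * coord b v)"
    unfolding form_def using assms finite_coord[of u] by (intro sum.mono_neutral_left) auto
  also have "\<dots> = (\<Sum>b\<in>F. coord b u * coord b v)"
    using assms finite_coord[of u] by (intro sum.mono_neutral_right) auto
  finally show ?thesis .
qed

lemma form_sym: "form u v = form v u"
  using form_superset[OF finite_coord[of v], of u v] by (simp add: form_def mult.commute)

lemma form_right: "v \<in> H \<Longrightarrow> w \<in> H \<Longrightarrow> form u (v + w) = form u v + form u w" "v \<in> H \<Longrightarrow> form u (s a v) = a * form u v"
  by (simp_all add: form_def coord_add coord_scale algebra_simps sum.distrib sum_distrib_left)

lemma form_left: "v \<in> H \<Longrightarrow> w \<in> H \<Longrightarrow> form (v + w) u = form v u + form w u" "v \<in> H \<Longrightarrow> form (s a v) u = a * form v u"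
  using form_right(1)[of v w u] form_right(2)[where v = v and u = u and a = a] by (simp_all add: form_sym[of _ u])

lemma form_neg: "v \<in> H \<Longrightarrow> form u (- v) = - form u v" "v \<in> H \<Longrightarrow> form (- v) u = - form v u"
  using form_right(2)[where v = v and u = u and a = "-1"] form_left(2)[where v = v and u = u and a = "-1"] by simp_all

lemma form_zero [simp]: "form u 0 = 0" "form 0 u = 0"
  using form_right(2)[where v = 0 and u = u and a = 0] form_left(2)[where v = 0 and u = u and a = 0] by simp_all

lemma form_basis: "b \<in> hom_basis \<Longrightarrow> form b v = coord b v" "b \<in> hom_basis \<Longrightarrow> form v b = coord b v"
proof -
  assume b: "b \<in> hom_basis"
  then have "{c. coord c b \<noteq> 0} \<subseteq> {b}" by (auto simp: coord_basis split: if_splits)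
  then show "form b v = coord b v" using b by (subst form_superset[of "{b}"]) (auto simp: coord_basis)
  then show "form v b = coord b v" by (simp add: form_sym)
qed

lemma form_ext:
  assumes "u \<in> H" "u' \<in> H" "\<And>b. b \<in> hom_basis \<Longrightarrow> form u b = form u' b" shows "u = u'"
proof -
  have c: "coord b u = coord b u'" for b
  proof (cases "b \<in> hom_basis")
    case False
    then have "coord b u = 0" "coord b u' = 0" using coord_supp by blast+
    then show ?thesis by simp
  qed (use assms(3)[of b] in \<open>simp add: form_basis\<close>)
  have "(\<Sum>b | coord b u \<noteq> 0. s (coord b u) b) = (\<Sum>b | coord b u' \<noteq> 0. s (coord b u') b)"
    by (simp only: c)
  then show ?thesis unfolding coord_expand[OF assms(1)] coord_expand[OF assms(2)] .
qed

lemma form_wt: "u \<in> wt \<alpha> \<Longrightarrow> v \<in> wt \<beta> \<Longrightarrow> \<alpha> \<noteq> \<beta> \<Longrightarrow> form u v = 0"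
proof -
  assume uv: "u \<in> wt \<alpha>" "v \<in> wt \<beta>" "\<alpha> \<noteq> \<beta>"
  have "coord b u * coord b v = 0" for b
  proof (rule ccontr)
    assume "coord b u * coord b v \<noteq> 0"
    then have nz: "coord b u \<noteq> 0" "coord b v \<noteq> 0" by auto
    obtain \<gamma> where "b \<in> wt \<gamma>" using basis_hom coord_supp[OF nz(1)] by metis
    then have "\<gamma> = \<alpha>" "\<gamma> = \<beta>" using coord_wt uv nz by blast+
    then show False using uv by simp
  qed
  then show ?thesis unfolding form_def by (intro sum.neutral ballI)
qed

lemma form_grade: "u \<in> grade W p \<Longrightarrow> v \<in> grade W q \<Longrightarrow> p \<noteq> q \<Longrightarrow> form u v = 0"
proof -
  assume uv: "u \<in> grade W p" "v \<in> grade W q" "p \<noteq> q"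
  have "coord b u * coord b v = 0" for b
  proof (rule ccontr)
    assume "coord b u * coord b v \<noteq> 0"
    then have nz: "coord b u \<noteq> 0" "coord b v \<noteq> 0" by auto
    obtain r where "b \<in> grade W r" using basis_hom coord_supp[OF nz(1)] by metis
    then have "r = p" "r = q" using coord_grade uv nz by blast+
    then show False using uv by simp
  qed
  then show ?thesis unfolding form_def by (intro sum.neutral ballI)
qed

lemma finite_basis_wt: "finite (hom_basis \<inter> wt \<alpha>)"
proof -
  obtain B where B: "finite B" "wt \<alpha> \<subseteq> span B" by (rule wt_finite)
  have "independent (hom_basis \<inter> wt \<alpha>)" using hom_basis(2) by (rule independent_mono) blast
  then show ?thesis using independent_span_bound[OF B(1)] B(2) by blast
qed

text \<open>The vector representing \<phi> with respect to the form. It is meaningful when \<phi>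
  vanishes on almost all basis vectors; otherwise the sum defaults to 0.\<close>

definition riesz :: "('a \<Rightarrow> complex) \<Rightarrow> 'a" where
  "riesz \<phi> = (\<Sum>b | b \<in> hom_basis \<and> \<phi> b \<noteq> 0. s (\<phi> b) b)"

lemma riesz_H: "riesz \<phi> \<in> H"
  unfolding riesz_def by (intro H_sum) simp

lemma form_riesz:
  assumes lin: "linear_map_on s (*) H \<phi>" and fin: "finite {b \<in> hom_basis. \<phi> b \<noteq> 0}" and v: "v \<in> H"
  shows "form (riesz \<phi>) v = \<phi> v"
proof -
  let ?F = "{b \<in> hom_basis. \<phi> b \<noteq> 0}" and ?V = "{b. coord b v \<noteq> 0}"
  have c: "coord b (riesz \<phi>) = (if b \<in> ?F then \<phi> b else 0)" for b
    unfolding riesz_def using fin by (intro coord_combination) auto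
  have bV: "b \<in> H" if "b \<in> ?V" for b using that coord_supp basis_H by blast
  have "form (riesz \<phi>) v = (\<Sum>b\<in>?V. coord b (riesz \<phi>) * coord b v)"
    by (rule form_superset[OF finite_coord]) simp
  also have "\<dots> = (\<Sum>b\<in>?V. \<phi> (s (coord b v) b))"
    using lin coord_supp bV by (intro sum.cong refl) (auto simp: c linear_map_on_def)
  also have "\<dots> = \<phi> (\<Sum>b\<in>?V. s (coord b v) b)"
    using bV by (intro linear_map_on_sum[OF vector_space_axioms vector_space_complex subspace_H lin, symmetric]) auto
  finally show ?thesis using coord_expand[OF v] by simp
qed

definition transp :: "fv \<Rightarrow> 'a \<Rightarrow> 'a" where
  "transp x u = riesz (\<lambda>v. form u (act W x v))"

lemma transp_H [simp]: "transp x u \<in> H"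
  by (simp add: transp_def riesz_H)

text \<open>The functional to be represented has finite support on the basis: \<open>u\<close>
  involves finitely many weights, \<open>x\<close> shifts weights by finitely many integers, and
  each weight space contains finitely many basis vectors.\<close>

lemma form_transp:
  assumes u: "u \<in> H" and v: "v \<in> H" shows "form (transp x u) v = form u (act W x v)"
  unfolding transp_def
proof (rule form_riesz[OF _ _ v])
  show "linear_map_on s (*) H (\<lambda>v. form u (act W x v))"
    by (simp add: linear_map_on_def act_lin_arg form_right)
  define A where "A = (\<Union>g\<in>Poly_Mapping.keys x. \<Union>c\<in>{c. coord c u \<noteq> 0}.
      \<Union>\<gamma>\<in>{\<gamma>. c \<in> wt \<gamma>}. hom_basis \<inter> wt (\<gamma> + of_int (gen_shift g)))"
  have "finite {\<gamma>. c \<in> wt \<gamma>}" if "c \<noteq> 0" for c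
  proof (cases "\<exists>\<gamma>. c \<in> wt \<gamma>")
    case True
    then obtain \<gamma> where \<gamma>: "c \<in> wt \<gamma>" by blast
    have "\<gamma>' = \<gamma>" if "c \<in> wt \<gamma>'" for \<gamma>'
      using wt_eq[OF \<gamma>] wt_eq[OF that] \<open>c \<noteq> 0\<close> by simp
    then have "{\<gamma>. c \<in> wt \<gamma>} \<subseteq> {\<gamma>}" by blast
    then show ?thesis by (rule finite_subset) simp
  qed simp
  moreover have "c \<noteq> 0" if "coord c u \<noteq> 0" for c using coord_supp[OF that] hom_basis(2) dependent_zero by blast
  ultimately have finA: "finite A"
    unfolding A_def by (intro finite_UN_I finite_keys finite_coord finite_basis_wt) auto
  have "{b \<in> hom_basis. form u (act W x b) \<noteq> 0} \<subseteq> A"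
  proof
    fix b assume "b \<in> {b \<in> hom_basis. form u (act W x b) \<noteq> 0}"
    then have b: "b \<in> hom_basis" "form u (act W x b) \<noteq> 0" by auto
    then obtain c where c: "coord c u \<noteq> 0" "coord c (act W x b) \<noteq> 0"
      unfolding form_def by (metis (mono_tags, lifting) mem_Collect_eq mult_eq_0_iff sum.neutral)
    have "coord c (act W x b) = (\<Sum>g\<in>Poly_Mapping.keys x. coord c (s (Poly_Mapping.lookup x g) (gact W g b)))"
      using b(1) by (simp add: act_gens gen_act_def) (rule coord_sum, simp)
    then have "(\<Sum>g\<in>Poly_Mapping.keys x. coord c (s (Poly_Mapping.lookup x g) (gact W g b))) \<noteq> 0"
      using c(2) by simp
    then obtain g where g: "g \<in> Poly_Mapping.keys x" "coord c (s (Poly_Mapping.lookup x g) (gact W g b)) \<noteq> 0"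
      by (rule sum.not_neutral_contains_not_neutral)
    then have cg: "coord c (gact W g b) \<noteq> 0" using b(1) by (simp add: coord_scale)
    obtain \<gamma> where \<gamma>: "c \<in> wt \<gamma>" using basis_hom coord_supp[OF c(1)] by metis
    obtain \<beta> where \<beta>: "b \<in> wt \<beta>" using basis_hom b(1) by metis
    have "\<gamma> = \<beta> - of_int (gen_shift g)" using coord_wt[OF gact_wt[OF \<beta>] \<gamma> cg] .
    then have "b \<in> wt (\<gamma> + of_int (gen_shift g))" using \<beta> by simp
    then show "b \<in> A" unfolding A_def using g(1) c(1) \<gamma> b(1) by blast
  qed
  then show "finite {b \<in> hom_basis. form u (act W x b) \<noteq> 0}" using finA finite_subset by blast
qed

lemma transp_eqI: "u \<in> H \<Longrightarrow> w \<in> H \<Longrightarrow> (\<And>v. v \<in> H \<Longrightarrow> form u (act W x v) = form w v) \<Longrightarrow> transp x u = w"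
  by (intro form_ext) (simp_all add: form_transp)

lemma transp_lin_arg: "u \<in> H \<Longrightarrow> v \<in> H \<Longrightarrow> transp x (u + v) = transp x u + transp x v" "u \<in> H \<Longrightarrow> transp x (s a u) = s a (transp x u)"
  by (rule transp_eqI; simp add: form_left form_transp)+

lemma transp_lin_fv: "u \<in> H \<Longrightarrow> transp (x + y) u = transp x u + transp y u" "u \<in> H \<Longrightarrow> transp (pscale a x) u = s a (transp x u)"
  "u \<in> H \<Longrightarrow> transp 0 u = 0"
  by (rule transp_eqI; simp add: form_left form_right form_transp act_lin_fv)+

lemma transp_zero [simp]: "transp x 0 = 0"
  using transp_lin_arg(2)[of 0 x 0] by simp

lemma transp_grade:
  assumes x: "x \<in> fv_grade p" and u: "u \<in> grade W q" shows "transp x u \<in> grade W (p + q)"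
proof -
  have uH: "u \<in> H" using u by (rule grade_H)
  have c0: "b \<in> grade W (p + q)" if b: "coord b (transp x u) \<noteq> 0" for b
  proof (rule ccontr)
    have bB: "b \<in> hom_basis" using coord_supp[OF b] .
    assume n: "b \<notin> grade W (p + q)"
    obtain r where r: "b \<in> grade W r" using basis_hom bB by metis
    have "q \<noteq> p + r"
    proof
      assume "q = p + r"
      then have "p + q = r" by (simp only: bit_add_self)
      then show False using n r by simp
    qed
    then have "form u (act W x b) = 0" using form_grade[OF u act_grade[OF x r]] by simp
    then show False using b form_basis(2)[OF bB] form_transp[OF uH basis_H[OF bB]] by simp
  qed
  have "(\<Sum>b | coord b (transp x u) \<noteq> 0. s (coord b (transp x u)) b) \<in> grade W (p + q)"
    using c0 by (intro subspace_sum[OF subspace_grade] subspace_scale[OF subspace_grade]) simp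
  then show ?thesis using coord_expand[of "transp x u"] by simp
qed

text \<open>Different weight spaces are orthogonal for the form, so L_0 is self-adjoint.\<close>

lemma transp_L0: "u \<in> H \<Longrightarrow> transp (basis (L 0)) u = lo 0 u"
proof (rule form_ext)
  fix b assume u: "u \<in> H" and b: "b \<in> hom_basis"
  obtain \<beta> where \<beta>: "b \<in> wt \<beta>" using basis_hom b by metis
  obtain A x where A: "finite A" "\<And>\<alpha>. x \<alpha> \<in> wt \<alpha>" "u = (\<Sum>\<alpha>\<in>A. x \<alpha>)" using wt_decomp[OF u] by metis
  have xH: "x \<alpha> \<in> H" for \<alpha> using A(2) wt_H by blast
  have fsum: "form (\<Sum>\<alpha>\<in>A. y \<alpha>) b = (\<Sum>\<alpha>\<in>A. form (y \<alpha>) b)" if "\<And>\<alpha>. y \<alpha> \<in> H" for y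
    by (rule linear_map_on_sum[OF vector_space_axioms vector_space_complex subspace_H, of "\<lambda>u. form u b"])
       (simp_all add: linear_map_on_def form_left that)
  have "form (transp (basis (L 0)) u) b = form u (lo 0 b)"
    using form_transp[OF u basis_H[OF b]] by (simp add: gact_def)
  also have "\<dots> = (\<Sum>\<alpha>\<in>A. \<beta> * form (x \<alpha>) b)"
    unfolding wt_eq[OF \<beta>] form_right(2)[OF basis_H[OF b]] A(3) fsum[OF xH] by (simp add: sum_distrib_left)
  also have "\<dots> = (\<Sum>\<alpha>\<in>A. form (lo 0 (x \<alpha>)) b)"
  proof (rule sum.cong[OF refl])
    fix \<alpha> show "\<beta> * form (x \<alpha>) b = form (lo 0 (x \<alpha>)) b"
      unfolding wt_eq[OF A(2)] form_left(2)[OF xH] using form_wt[OF A(2) \<beta>, of \<alpha>] by (cases "\<alpha> = \<beta>") auto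
  qed
  also have "\<dots> = form (lo 0 u) b"
    unfolding A(3) using xH by (subst gact_sum) (simp_all add: fsum)
  finally show "form (transp (basis (L 0)) u) b = form (lo 0 u) b" .
qed simp_all

text \<open>The sign convention of \<open>restricted_dual\<close>, with the functional replaced by
  the vector that represents it.\<close>

definition dual_act :: "fv \<Rightarrow> 'a \<Rightarrow> 'a" where
  "dual_act x u = - (\<Sum>p\<in>{0, 1}. \<Sum>q\<in>{0, 1}. s (koszul (p * q)) (transp (fv_part p x) (cp q u)))"

definition dual :: "'a smod" where
  "dual = \<lparr> scl = s, grade = grade W, act = dual_act \<rparr>"

lemma dual_act_H: "u \<in> H \<Longrightarrow> dual_act x u \<in> H"
  unfolding dual_act_def by (intro H_closed(5) H_sum H_closed(4)) simp

lemma dual_act_hom: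
  assumes x: "x \<in> fv_grade p" and u: "u \<in> grade W q"
  shows "dual_act x u = - s (koszul (p * q)) (transp x u)"
proof -
  have uH: "u \<in> H" using u by (rule grade_H)
  show ?thesis unfolding dual_act_def fv_part_homogeneous[OF x] cp_hom[OF u]
    using uH by (cases p; cases q) (simp_all add: transp_lin_fv)
qed

lemma dual_act_lin_arg:
  assumes "u \<in> H" "v \<in> H"
  shows "dual_act x (u + v) = dual_act x u + dual_act x v"
  using assms by (simp add: dual_act_def cp_lin transp_lin_arg scale_right_distrib algebra_simps)

lemma dual_act_scale:
  assumes "u \<in> H" shows "dual_act x (s a u) = s a (dual_act x u)"
  using assms by (simp add: dual_act_def cp_lin transp_lin_arg scale_right_distrib scale_right_diff_distrib mult.commute)

lemma dual_act_lin_fv: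
  assumes "u \<in> H"
  shows "dual_act (x + y) u = dual_act x u + dual_act y u" "dual_act (pscale a x) u = s a (dual_act x u)"
  using assms by (simp_all add: dual_act_def fv_part_lin transp_lin_fv scale_right_distrib scale_right_diff_distrib mult.commute algebra_simps)

lemma carr_dual: "carr dual = H"
  by (simp add: carr_def dual_def)

text \<open>Transposition reverses products, which exchanges the two terms of the bracket; the minus
  sign and the Koszul signs of the action restore it.\<close>

lemma dual_bracket_hom:
  assumes x: "x \<in> fv_grade p" and y: "y \<in> fv_grade q" and u: "u \<in> grade W r"
  shows "dual_act (bracket x y) u = dual_act x (dual_act y u) - s (koszul (p * q)) (dual_act y (dual_act x u))"
proof -
  have uH: "u \<in> H" using u by (rule grade_H)
  have two: "dual_act x (dual_act y u) = s (koszul (p * (q + r) + q * r)) (transp x (transp y u))"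
    if x: "x \<in> fv_grade p" and y: "y \<in> fv_grade q" for x y p q
  proof -
    have g: "- s (koszul (q * r)) (transp y u) \<in> grade W (q + r)"
      by (intro subspace_neg[OF subspace_grade] subspace_scale[OF subspace_grade] transp_grade[OF y u])
    have "transp x (- s (koszul (q * r)) (transp y u)) = s (- koszul (q * r)) (transp x (transp y u))"
      using transp_lin_arg(2)[of "transp y u" x "- koszul (q * r)"] by simp
    then show ?thesis
      unfolding dual_act_hom[OF y u] dual_act_hom[OF x g] by (simp add: koszul_add mult.commute)
  qed
  show ?thesis unfolding two[OF x y] two[OF y x] dual_act_hom[OF bracket_grade[OF x y] u]
  proof (rule form_ext)
    fix b assume "b \<in> hom_basis"
    then have bH: "b \<in> H" by simp
    define K where "K = koszul (q * r + p * r)"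
    define Q where "Q = koszul (p * q)"
    \<comment> \<open>All signs are expressed by \<open>K\<close> and \<open>Q\<close>, using that
      exponents count modulo two.\<close>
    have k: "Q * koszul (q * (p + r) + p * r) = K" "koszul ((p + q) * r) = K" "koszul (p * (q + r) + q * r) = K * Q"
      unfolding K_def Q_def by (cases p; cases q; cases r; simp add: koszul_def)+
    let ?xy = "form u (act W x (act W y b))" and ?yx = "form u (act W y (act W x b))"
    have "form (- s K (transp (bracket x y) u)) b = - K * form u (act W (bracket x y) b)"
      using bH uH by (simp add: form_neg form_left form_transp)
    also have "form u (act W (bracket x y) b) = ?xy - Q * ?yx"
      unfolding act_bracket[OF x y bH] Q_def[symmetric]
      using bH form_right(1)[of "act W x (act W y b)" "s (- Q) (act W y (act W x b))" u]
      by (simp add: form_neg form_right(2))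
    finally have 1: "form (- s K (transp (bracket x y) u)) b = - K * (?xy - Q * ?yx)" .
    have "form (s (K * Q) (transp x (transp y u)) - s K (transp y (transp x u))) b
        = form (s (K * Q) (transp x (transp y u))) b - form (s K (transp y (transp x u))) b"
      using form_left(1)[of "s (K * Q) (transp x (transp y u))" "- s K (transp y (transp x u))" b] by (simp add: form_neg)
    also have "\<dots> = K * Q * ?yx - K * ?xy"
      using bH uH by (simp add: form_left(2) form_transp)
    finally have 2: "form (s (K * Q) (transp x (transp y u)) - s K (transp y (transp x u))) b = K * Q * ?yx - K * ?xy" .
    show "form (- s (koszul ((p + q) * r)) (transp (bracket x y) u)) b
      = form (s (koszul (p * (q + r) + q * r)) (transp x (transp y u))
        - s (koszul (p * q)) (s (koszul (q * (p + r) + p * r)) (transp y (transp x u)))) b"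
      unfolding Q_def[symmetric] scale_scale k 1 2 by (simp add: algebra_simps)
  qed simp_all
qed

lemma super_module_dual: "super_module FV dual"
  unfolding super_module_def carr_dual
proof (intro conjI allI ballI)
  show "vector_space (scl dual)" using vector_space_axioms by (simp add: dual_def)
  show "module.subspace (scl dual) (grade dual p)" for p using subspace_grade by (simp add: dual_def)
  show "grade dual 0 \<inter> grade dual 1 = {0}" using super unfolding super_module_def by (simp add: dual_def)
  show "linear_map_on (scl dual) (scl dual) H (act dual x)" for x
    by (simp add: linear_map_on_def dual_def dual_act_lin_arg dual_act_scale)
  show "linear_map_on pscale (scl dual) FV (\<lambda>x. act dual x v)" if "v \<in> H" for v
    using that by (simp add: linear_map_on_def dual_def dual_act_lin_fv)
  show "act dual x v \<in> grade dual (p + q)" if "x \<in> FV \<inter> fv_grade p" "v \<in> grade dual q" for p q x v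
  proof -
    have x: "x \<in> fv_grade p" and v: "v \<in> grade W q" using that by (simp_all add: dual_def)
    have "- s (koszul (p * q)) (transp x v) \<in> grade W (p + q)"
      by (intro subspace_neg[OF subspace_grade] subspace_scale[OF subspace_grade] transp_grade x v)
    then show ?thesis unfolding dual_def smod.simps dual_act_hom[OF x v] .
  qed
  fix p q x y v assume "x \<in> FV \<inter> fv_grade p" "y \<in> FV \<inter> fv_grade q" and v: "v \<in> H"
  then have xy: "x \<in> fv_grade p" "y \<in> fv_grade q" by simp_all
  obtain a b where ab: "a \<in> grade W 0" "b \<in> grade W 1" "v = a + b" using H_decomp[OF v] .
  then have H: "a \<in> H" "b \<in> H" using grade_H by blast+
  have "dual_act (bracket x y) v = dual_act x (dual_act y v) - s (koszul (p * q)) (dual_act y (dual_act x v))"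
    unfolding ab(3) using H dual_bracket_hom[OF xy ab(1)] dual_bracket_hom[OF xy ab(2)]
    by (simp add: dual_act_lin_arg dual_act_H scale_right_distrib)
  then show "act dual (bracket x y) v = act dual x (act dual y v) - scl dual (koszul (p * q)) (act dual y (act dual x v))"
    by (simp add: dual_def)
qed

lemma dual_L0: "u \<in> H \<Longrightarrow> dual_act (basis (L 0)) u = - lo 0 u"
proof -
  assume u: "u \<in> H"
  obtain a b where ab: "a \<in> grade W 0" "b \<in> grade W 1" "u = a + b" using H_decomp[OF u] .
  then have H: "a \<in> H" "b \<in> H" using grade_H by blast+
  have L: "basis (L 0) \<in> fv_grade 0" by (simp add: fv_grade_def)
  show ?thesis unfolding ab(3) using H dual_act_hom[OF L ab(1)] dual_act_hom[OF L ab(2)]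
    by (simp add: dual_act_lin_arg transp_L0 gact_lin)
qed

lemma weight_space_dual: "weight_space dual \<alpha> = wt (- \<alpha>)"
proof -
  have "(- lo 0 v = s \<alpha> v) = (lo 0 v = s (- \<alpha>) v)" for v by (auto simp: minus_equation_iff)
  then have "(dual_act (basis (L 0)) v = s \<alpha> v) = (lo 0 v = s (- \<alpha>) v)" if "v \<in> H" for v
    using dual_L0[OF that] by simp
  moreover have "scl dual = s" "act dual = dual_act" by (simp_all add: dual_def)
  ultimately show ?thesis unfolding weight_space_def carr_dual by (auto simp: gact_def)
qed

lemma harish_chandra_dual: "harish_chandra FV dual"
  unfolding harish_chandra_def weight_module_def
proof (intro conjI allI super_module_dual)
  have sc: "scl dual = s" by (simp add: dual_def)
  have "(\<Union>\<alpha>. weight_space dual \<alpha>) = (\<Union>\<alpha>. wt \<alpha>)"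
    unfolding weight_space_dual by (metis (no_types, lifting) SUP_cong UN_extend_simps(10) surj_uminus)
  then show "carr dual = module.span (scl dual) (\<Union>\<alpha>. weight_space dual \<alpha>)"
    unfolding sc carr_dual using H_span_wt by simp
  show "\<exists>B. finite B \<and> weight_space dual \<alpha> \<subseteq> module.span (scl dual) B" for \<alpha>
    unfolding sc weight_space_dual using wt_finite[of "- \<alpha>"] by blast
qed

lemma separating_functional:
  assumes M: "subspace M" and b: "b \<notin> M"
  obtains \<phi> where "linear_map_on s (*) UNIV \<phi>" "\<And>v. v \<in> M \<Longrightarrow> \<phi> v = (0 :: complex)" "\<phi> b = 1"
proof -
  obtain C where C: "C \<subseteq> M" "independent C" "M \<subseteq> span C" using maximal_independent_subset by metis
  have "span C = M" using C M by (simp add: span_subspace)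
  then have ind: "independent (insert b C)" using C(2) b by (intro independent_insertI) auto
  interpret vp: vector_space_pair s "(*) :: complex \<Rightarrow> complex \<Rightarrow> complex"
    by (intro vector_space_pair.intro vector_space_axioms vector_space_complex)
  from vp.linear_independent_extend[OF ind, of "\<lambda>x. if x = b then 1 else 0"]
  obtain \<phi> where lin: "Vector_Spaces.linear s (*) \<phi>" and ext: "\<forall>x\<in>insert b C. \<phi> x = (if x = b then 1 else 0)" by blast
  interpret \<phi>: Vector_Spaces.linear s "(*) :: complex \<Rightarrow> complex \<Rightarrow> complex" \<phi> by (fact lin)
  show thesis
  proof (rule that)
    show "linear_map_on s (*) UNIV \<phi>" by (simp add: linear_map_on_def \<phi>.add \<phi>.scale)
    show "\<phi> b = 1" using ext by simp
    fix v assume "v \<in> M"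
    then have "v \<in> span C" using C by blast
    then show "\<phi> v = 0"
    proof (induction rule: span_induct_alt)
      case (step c x y)
      have "\<phi> x = 0" using ext step.hyps C(1) b by auto
      then show ?case using step by (simp add: \<phi>.add \<phi>.scale)
    qed (rule \<phi>.zero)
  qed
qed

text \<open>The orthogonal complement \<open>P\<close> of a submodule \<open>N\<close> is a
  submodule of \<open>W\<close>, hence 0 or everything. If \<open>P\<close> is everything,
  \<open>N\<close> is zero. If \<open>P\<close> is 0, a basis vector outside \<open>N\<close> would
  be detected by a functional vanishing on \<open>N\<close>, whose representing vector is a nonzero
  element of \<open>P\<close>.\<close>

lemma simple_dual: "simple_module FV dual"
  unfolding simple_module_def
proof (intro conjI allI impI super_module_dual)
  show "carr dual \<noteq> {0}" using H_nonzero unfolding carr_dual by blast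
  fix N assume N: "graded_submodule FV dual N"
  have sub: "subspace N" using N by (simp add: graded_submodule_def dual_def)
  have dec: "\<exists>a\<in>N \<inter> grade W 0. \<exists>b\<in>N \<inter> grade W 1. v = a + b" if v: "v \<in> N" for v
  proof -
    have "N = {u + v |u v. u \<in> N \<inter> grade W 0 \<and> v \<in> N \<inter> grade W 1}"
      using N by (simp add: graded_submodule_def dual_def)
    then have "v \<in> {u + v |u v. u \<in> N \<inter> grade W 0 \<and> v \<in> N \<inter> grade W 1}" using v by blast
    then show ?thesis by blast
  qed
  have NH: "N \<subseteq> H" using dec grade_H by (metis H_closed(2) IntD2 subsetI)
  have act: "dual_act x v \<in> N" if "v \<in> N" for x v
    using N that by (simp add: graded_submodule_def dual_def)
  have trN: "transp (basis g) n \<in> N" if n: "n \<in> N" for g n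
  proof -
    have hom: "transp (basis g) a \<in> N" if "a \<in> N" "a \<in> grade W q" for a q
    proof -
      have "s (- koszul (gen_parity g * q)) (dual_act (basis g) a) \<in> N"
        using act that(1) subspace_scale[OF sub] by blast
      then show ?thesis unfolding dual_act_hom[OF basis_grade that(2)] by simp
    qed
    obtain a b where ab: "a \<in> N" "a \<in> grade W 0" "b \<in> N" "b \<in> grade W 1" "n = a + b" using dec[OF n] by blast
    then have "transp (basis g) n = transp (basis g) a + transp (basis g) b"
      using transp_lin_arg(1)[of a b] grade_H by blast
    then show ?thesis using hom ab subspace_add[OF sub] by metis
  qed
  define P where "P = {v \<in> H. \<forall>n\<in>N. form n v = 0}"
  have "graded_submodule FV W P"
  proof (rule graded_submoduleI)
    show "subspace P" unfolding subspace_def P_def by (auto simp: form_right)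
    show "gact W g v \<in> P" if v: "v \<in> P" for g v
    proof -
      have "form n (gact W g v) = 0" if "n \<in> N" for n
      proof -
        have "form n (gact W g v) = form (transp (basis g) n) v"
          using form_transp[of n v "basis g"] that NH v by (auto simp: gact_def P_def)
        then show ?thesis using trN[OF that] v by (simp add: P_def)
      qed
      then show ?thesis using v by (simp add: P_def)
    qed
    show "\<exists>a\<in>P \<inter> grade W 0. \<exists>b\<in>P \<inter> grade W 1. v = a + b" if v: "v \<in> P" for v
    proof -
      obtain a b where ab: "a \<in> grade W 0" "b \<in> grade W 1" "v = a + b" using H_decomp v by (auto simp: P_def)
      then have H: "a \<in> H" "b \<in> H" using grade_H by blast+
      have "form n a = 0 \<and> form n b = 0" if "n \<in> N" for n
      proof -
        obtain n0 n1 where n: "n0 \<in> N" "n0 \<in> grade W 0" "n1 \<in> N" "n1 \<in> grade W 1" "n = n0 + n1" using dec[OF \<open>n \<in> N\<close>] by blast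
        then have nH: "n0 \<in> H" "n1 \<in> H" using NH by blast+
        have o: "form n0 b = 0" "form n1 a = 0" using form_grade n ab by auto
        have "form n0 v = 0" "form n1 v = 0" using v n by (auto simp: P_def)
        then have "form n0 a = 0" "form n1 b = 0" using o H by (simp_all add: ab(3) form_right)
        then show ?thesis using o nH by (simp add: n(5) form_left)
      qed
      then have "a \<in> P" "b \<in> P" using H by (simp_all add: P_def)
      then show ?thesis using ab by blast
    qed
  qed (auto simp: P_def)
  then consider "P = {0}" | "P = H" using simple unfolding simple_module_def by blast
  then show "N = {0} \<or> N = carr dual"
  proof cases
    case 2
    have "n = 0" if "n \<in> N" for n
    proof (rule form_ext)
      show "n \<in> H" using that NH by blast
      show "form n b = form 0 b" if "b \<in> hom_basis" for b
        using \<open>n \<in> N\<close> basis_H[OF that] 2 by (auto simp: P_def)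
    qed simp
    then show ?thesis using subspace_0[OF sub] by blast
  next
    case 1
    have "hom_basis \<subseteq> N"
    proof
      fix b assume b: "b \<in> hom_basis"
      show "b \<in> N"
      proof (rule ccontr)
        assume bN: "b \<notin> N"
        obtain \<alpha> where \<alpha>: "b \<in> wt \<alpha>" using basis_hom[OF b] by metis
        let ?U = "span (\<Union>\<gamma>\<in>- {\<alpha>}. wt \<gamma>)"
        \<comment> \<open>Vanishing on all other weight spaces makes the functional finitely
          supported on the basis, so that \<open>riesz\<close> represents it.\<close>
        let ?M = "{n + u | n u. n \<in> N \<and> u \<in> ?U}"
        have M: "subspace ?M" using subspace_sums[OF sub subspace_span] .
        have "b \<notin> ?M"
        proof
          assume "b \<in> ?M"
          then obtain n u where nu: "b = n + u" "n \<in> N" "u \<in> ?U" by blast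
          obtain A x where A: "finite A" "A \<subseteq> - {\<alpha>}" "\<And>\<gamma>. x \<gamma> \<in> wt \<gamma>" "u = (\<Sum>\<gamma>\<in>A. x \<gamma>)"
            using wt_span_decomp[OF nu(3)] by blast
          \<comment> \<open>The weight components of \<open>n\<close>, with \<open>b\<close> as the
            one of weight \<alpha>; since \<open>N\<close> is stable under L_0, it would contain
            \<open>b\<close>.\<close>
          define y where "y \<gamma> = (if \<gamma> = \<alpha> then b else - x \<gamma>)" for \<gamma>
          have "\<alpha> \<notin> A" using A(2) by blast
          then have "(\<Sum>\<gamma>\<in>A. y \<gamma>) = (\<Sum>\<gamma>\<in>A. - x \<gamma>)" by (intro sum.cong) (auto simp: y_def)
          then have "(\<Sum>\<gamma>\<in>insert \<alpha> A. y \<gamma>) = n"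
            using A(1,4) \<open>\<alpha> \<notin> A\<close> nu(1) by (simp add: y_def sum_negf)
          moreover have "y \<gamma> \<in> wt \<gamma>" for \<gamma> using \<alpha> A(3) subspace_neg[OF subspace_wt] by (simp add: y_def)
          moreover have "lo 0 v \<in> N" if "v \<in> N" for v
            using trN[OF that, of "L 0"] transp_L0[of v] that NH by auto
          ultimately have "y \<alpha> \<in> N"
            using wt_stable_decomp[OF sub, of "insert \<alpha> A" y] A(1) nu(2) by blast
          then show False using bN by (simp add: y_def)
        qed
        then obtain \<phi> where \<phi>: "linear_map_on s (*) UNIV \<phi>" "\<And>v. v \<in> ?M \<Longrightarrow> \<phi> v = (0 :: complex)" "\<phi> b = 1"
          using separating_functional[OF M] by blast
        have lin: "linear_map_on s (*) H \<phi>" using \<phi>(1) by (simp add: linear_map_on_def)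
        have "{c \<in> hom_basis. \<phi> c \<noteq> 0} \<subseteq> hom_basis \<inter> wt \<alpha>"
        proof
          fix c assume c: "c \<in> {c \<in> hom_basis. \<phi> c \<noteq> 0}"
          obtain \<gamma> where \<gamma>: "c \<in> wt \<gamma>" using basis_hom c by blast
          have "\<gamma> = \<alpha>"
          proof (rule ccontr)
            assume "\<gamma> \<noteq> \<alpha>"
            then have "c \<in> ?U" using \<gamma> by (intro span_base) blast
            then have "0 + c \<in> ?M" using subspace_0[OF sub] by blast
            then show False using \<phi>(2) c by simp
          qed
          then show "c \<in> hom_basis \<inter> wt \<alpha>" using c \<gamma> by simp
        qed
        then have fin: "finite {c \<in> hom_basis. \<phi> c \<noteq> 0}" using finite_basis_wt finite_subset by blast
        note r = form_riesz[OF lin fin]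
        have "form n (riesz \<phi>) = 0" if "n \<in> N" for n
        proof -
          have "n + 0 \<in> ?M" using that span_zero by blast
          then have "\<phi> n = 0" using \<phi>(2) by simp
          then show ?thesis using r[of n] that NH by (auto simp: form_sym)
        qed
        then have "riesz \<phi> \<in> P" using riesz_H by (simp add: P_def)
        then have "riesz \<phi> = 0" using 1 by blast
        then show False using r[OF basis_H[OF b]] \<phi>(3) by simp
      qed
    qed
    then have "span hom_basis \<subseteq> N" using sub by (rule span_minimal)
    then show ?thesis using NH unfolding carr_dual span_basis by blast
  qed
qed

text \<open>The sign \<open>(-1)\<^bsup>|w|\<^esup>\<close> that makes the evaluation map into the bidual equivariant.\<close>

definition parity_sign :: "'a \<Rightarrow> 'a" where
  "parity_sign w = cp 0 w - cp 1 w"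

lemma parity_sign_H [simp]: "w \<in> H \<Longrightarrow> parity_sign w \<in> H"
  by (simp add: parity_sign_def)

lemma parity_sign_hom: "w \<in> grade W q \<Longrightarrow> parity_sign w = s (koszul q) w"
  using cp_hom[of w q 0] cp_hom[of w q 1] by (cases q) (simp_all add: parity_sign_def koszul_def)

lemma parity_sign_add: "u \<in> H \<Longrightarrow> v \<in> H \<Longrightarrow> parity_sign (u + v) = parity_sign u + parity_sign v"
  by (simp add: parity_sign_def cp_lin)

lemma parity_sign_scale: "u \<in> H \<Longrightarrow> parity_sign (s a u) = s a (parity_sign u)"
  by (simp add: parity_sign_def cp_lin scale_right_diff_distrib)

lemma parity_sign_diff: "u \<in> H \<Longrightarrow> v \<in> H \<Longrightarrow> parity_sign (u - v) = parity_sign u - parity_sign v"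
  using parity_sign_add[of u "s (-1) v"] parity_sign_scale[of v "-1"] by simp

lemma parity_sign_sq: "w \<in> H \<Longrightarrow> parity_sign (parity_sign w) = w"
proof -
  assume w: "w \<in> H"
  obtain a b where ab: "a \<in> grade W 0" "b \<in> grade W 1" "w = a + b" using H_decomp[OF w] .
  then have H: "a \<in> H" "b \<in> H" using grade_H by blast+
  show ?thesis unfolding ab(3) using H parity_sign_hom[OF ab(1)] parity_sign_hom[OF ab(2)]
    by (simp add: parity_sign_add parity_sign_diff koszul_def)
qed

lemma parity_sign_act:
  assumes x: "x \<in> fv_grade p" and w: "w \<in> H"
  shows "parity_sign (act W x w) = s (koszul p) (act W x (parity_sign w))"
proof -
  obtain a b where ab: "a \<in> grade W 0" "b \<in> grade W 1" "w = a + b" using H_decomp[OF w] .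
  then have H: "a \<in> H" "b \<in> H" using grade_H by blast+
  have g: "parity_sign (act W x a) = s (koszul p * koszul 0) (act W x a)" "parity_sign (act W x b) = s (koszul p * koszul 1) (act W x b)"
    using parity_sign_hom[OF act_grade[OF x ab(1)]] parity_sign_hom[OF act_grade[OF x ab(2)]] by (simp_all only: koszul_add)
  show ?thesis unfolding ab(3) using H parity_sign_hom[OF ab(1)] parity_sign_hom[OF ab(2)]
    by (simp add: act_lin_arg parity_sign_add g scale_right_distrib)
qed

text \<open>The signed sum of components that appears when the action on a restricted dual is
  evaluated; the signs of the two contragredient actions combine to one depending on
  \<open>x\<close> alone.\<close>

lemma dual_act_component:
  assumes x: "x \<in> fv_grade p" and u: "u \<in> H"
  shows "(\<Sum>q\<in>{0, 1}. s (koszul (p * q)) (cp q (dual_act x u))) = - s (koszul p) (transp x u)"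
proof -
  have hom: "(\<Sum>q\<in>{0, 1}. s (koszul (p * q)) (cp q (dual_act x u))) = - s (koszul p) (transp x u)" if u: "u \<in> grade W r" for u r
  proof -
    have g: "- s (koszul (p * r)) (transp x u) \<in> grade W (p + r)"
      by (intro subspace_neg[OF subspace_grade] subspace_scale[OF subspace_grade] transp_grade x u)
    have "(\<Sum>q\<in>{0, 1}. s (koszul (p * q)) (cp q (dual_act x u))) = s (koszul (p * (p + r))) (- s (koszul (p * r)) (transp x u))"
      unfolding dual_act_hom[OF x u] cp_hom[OF g] by (cases p; cases r) simp_all
    also have "\<dots> = - s (koszul p) (transp x u)"
      by (cases p; cases r) (simp_all add: koszul_def)
    finally show ?thesis .
  qed
  obtain a b where ab: "a \<in> grade W 0" "b \<in> grade W 1" "u = a + b" using H_decomp[OF u] .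
  then have H: "a \<in> H" "b \<in> H" using grade_H by blast+
  have "(\<Sum>q\<in>{0, 1}. s (koszul (p * q)) (cp q (dual_act x u)))
    = (\<Sum>q\<in>{0, 1}. s (koszul (p * q)) (cp q (dual_act x a))) + (\<Sum>q\<in>{0, 1}. s (koszul (p * q)) (cp q (dual_act x b)))"
    unfolding ab(3) using H by (simp add: dual_act_lin_arg cp_lin dual_act_H scale_right_distrib)
  also have "\<dots> = - s (koszul p) (transp x u)"
    unfolding hom[OF ab(1)] hom[OF ab(2)] ab(3) using H by (simp add: transp_lin_arg scale_right_distrib)
  finally show ?thesis .
qed

text \<open>Biduality: if \<open>P\<close> is a copy of the contragredient module of
  \<open>W\<close> under \<open>g\<close>, then \<open>w\<close> acts on \<open>P\<close> as the
  functional pairing u with the signed vector \<open>parity_sign w\<close>, where u corresponds to g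
  u. \<open>P\<close> may live on another type, as the tensor product does. Functionals vanishing on
  almost all weight spaces are finitely supported on the basis, which gives surjectivity.\<close>

lemma isomorphic_restricted_dual:
  fixes P :: "('b :: ab_group_add) smod"
  assumes bij: "bij_betw g H (carr P)" and lin: "linear_map_on s (scl P) H g"
    and gr: "\<And>p. g ` grade W p = grade P p" and act: "\<And>x u. u \<in> H \<Longrightarrow> g (dual_act x u) = act P x (g u)"
  shows "isomorphic FV W (restricted_dual P)"
proof -
  define gi where "gi = inv_into H g"
  have inj: "inj_on g H" and img: "g ` H = carr P" using bij by (auto simp: bij_betw_def)
  have gig: "gi (g u) = u" if "u \<in> H" for u unfolding gi_def using inj that by simp
  have carrE: "\<exists>u\<in>H. t = g u" if "t \<in> carr P" for t using that img by blast
  have gH: "g u \<in> carr P" if "u \<in> H" for u using that img by blast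
  have gl: "g (u + v) = g u + g v" "g (s a u) = scl P a (g u)" if "u \<in> H" "v \<in> H" for u v a
    using lin that unfolding linear_map_on_def by blast+
  have g_grade: "\<exists>u\<in>grade W p. t = g u" if "t \<in> grade P p" for t p using that gr by blast
  have cpP: "component P q (g u) = g (cp q u)" if u: "u \<in> H" for q u
    unfolding component_def[of P]
  proof (rule the_equality)
    obtain a b where ab: "a \<in> grade W q" "b \<in> grade W (q + 1)" "u = a + b" using carr_decomp[OF super u] by metis
    then have H: "a \<in> H" "b \<in> H" using grade_H by blast+
    have c: "cp q u = a" using component_eq[OF super ab(1,2)] ab(3) by simp
    have "g u - g a = g b" unfolding ab(3) gl(1)[OF H] by simp
    then have "g u - g (cp q u) = g b" by (simp only: c)
    then show "g (cp q u) \<in> grade P q \<and> g u - g (cp q u) \<in> grade P (q + 1)"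
      using gr ab c by (metis imageI)
    fix t assume t: "t \<in> grade P q \<and> g u - t \<in> grade P (q + 1)"
    then obtain a' b' where a': "a' \<in> grade W q" "t = g a'" and b': "b' \<in> grade W (q + 1)" "g u - t = g b'" using g_grade by meson
    then have H': "a' \<in> H" "b' \<in> H" using grade_H by blast+
    have "g u = g (a' + b')" using a'(2) b'(2) gl(1)[OF H'] by (simp add: diff_eq_eq add.commute)
    then have "u = a' + b'" using inj_onD[OF inj] u H' by simp
    then have "cp q u = a'" using component_eq[OF super a'(1) b'(1)] by simp
    then show "t = g (cp q u)" using a' by simp
  qed
  have wsP: "weight_space P \<alpha> = g ` wt (- \<alpha>)" for \<alpha>
  proof -
    have "(act P (basis (L 0)) (g u) = scl P \<alpha> (g u)) = (lo 0 u = s (- \<alpha>) u)" if u: "u \<in> H" for u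
    proof -
      have "act P (basis (L 0)) (g u) = g (- lo 0 u)" using act[OF u] dual_L0[OF u] by metis
      moreover have "scl P \<alpha> (g u) = g (s \<alpha> u)" using gl(2)[OF u u] by simp
      moreover have "(g (- lo 0 u) = g (s \<alpha> u)) = (- lo 0 u = s \<alpha> u)" using inj u by (auto simp: inj_on_def)
      ultimately show ?thesis by (auto simp: minus_equation_iff)
    qed
    then show ?thesis unfolding weight_space_def[of P] img[symmetric]
      by (auto simp: wt_eq wt_H intro!: wtI)
  qed
  define F where "F w = (\<lambda>t. if t \<in> carr P then form (gi t) (parity_sign w) else 0)" for w
  have Fg: "F w (g u) = form u (parity_sign w)" if "u \<in> H" for w u
    using that by (simp add: F_def gH gig)
  have rest: "F w \<in> restricted_forms P" if w: "w \<in> H" for w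
    unfolding restricted_forms_def
  proof (intro CollectI conjI allI impI)
    show "linear_map_on (scl P) (*) (carr P) (F w)"
      unfolding linear_map_on_def
    proof (intro conjI ballI allI)
      fix t t' assume "t \<in> carr P" "t' \<in> carr P"
      then obtain u u' where u: "u \<in> H" "t = g u" "u' \<in> H" "t' = g u'" using carrE by meson
      show "F w (t + t') = F w t + F w t'"
        unfolding u(2,4) gl(1)[OF u(1,3), symmetric] using u by (simp add: Fg form_left)
    next
      fix a t assume "t \<in> carr P"
      then obtain u where u: "u \<in> H" "t = g u" using carrE by meson
      show "F w (scl P a t) = a * F w t"
        unfolding u(2) gl(2)[OF u(1,1), symmetric] using u by (simp add: Fg form_left)
    qed
    show "t \<notin> carr P \<Longrightarrow> F w t = 0" for t by (simp add: F_def)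
    let ?S = "{c. coord c (parity_sign w) \<noteq> 0}"
    have "\<forall>c\<in>?S. \<exists>\<gamma>. c \<in> wt \<gamma>" using coord_supp basis_hom by blast
    then obtain wtf where wtf: "\<And>c. c \<in> ?S \<Longrightarrow> c \<in> wt (wtf c)" by metis
    have "{\<alpha>. \<exists>t\<in>weight_space P \<alpha>. F w t \<noteq> 0} \<subseteq> (\<lambda>c. - wtf c) ` ?S"
    proof
      fix \<alpha> assume "\<alpha> \<in> {\<alpha>. \<exists>t\<in>weight_space P \<alpha>. F w t \<noteq> 0}"
      then obtain u where u: "u \<in> wt (- \<alpha>)" "F w (g u) \<noteq> 0" by (auto simp: wsP)
      then have "form (parity_sign w) u \<noteq> 0" using Fg[OF wt_H[OF u(1)]] by (simp add: form_sym)
      then obtain c where "coord c (parity_sign w) * coord c u \<noteq> 0"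
        unfolding form_def by (rule sum.not_neutral_contains_not_neutral)
      then have c: "coord c (parity_sign w) \<noteq> 0" "coord c u \<noteq> 0" by auto
      then have "wtf c = - \<alpha>" using coord_wt[OF u(1) wtf] by simp
      then show "\<alpha> \<in> (\<lambda>c. - wtf c) ` ?S" using c(1) by force
    qed
    then show "finite {\<alpha>. \<exists>t\<in>weight_space P \<alpha>. F w t \<noteq> 0}" using finite_coord finite_subset by blast
  qed
  have grade_F: "F ` grade W p \<subseteq> grade (restricted_dual P) p" for p
  proof safe
    fix w assume w: "w \<in> grade W p"
    then have wH: "w \<in> H" by (rule grade_H)
    have "F w t = 0" if "t \<in> grade P (p + 1)" for t
    proof -
      obtain u where u: "u \<in> grade W (p + 1)" "t = g u" using g_grade \<open>t \<in> _\<close> by blast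
      have "p + 1 \<noteq> p" by (cases p) simp_all
      then have "form u w = 0" using form_grade[OF u(1) w] by simp
      then show ?thesis unfolding u(2) using Fg[OF grade_H[OF u(1)]] parity_sign_hom[OF w] form_right(2)[OF wH] by simp
    qed
    then show "F w \<in> grade (restricted_dual P) p" using rest[OF wH] by (simp add: restricted_dual_def)
  qed
  have Flin: "F (u + v) = F u + F v" "F (s a u) = fscale a (F u)" if "u \<in> H" "v \<in> H" for u v a
    using that by (auto simp: F_def fun_eq_iff fscale_def parity_sign_add parity_sign_scale form_right)
  have surj: "\<exists>w\<in>H. F w = f" if f: "f \<in> restricted_forms P" for f
  proof -
    from f have fl: "linear_map_on (scl P) (*) (carr P) f" and fz: "\<And>t. t \<notin> carr P \<Longrightarrow> f t = 0"
      and ff: "finite {\<alpha>. \<exists>v\<in>weight_space P \<alpha>. f v \<noteq> 0}" by (auto simp: restricted_forms_def)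
    define \<phi> where "\<phi> u = f (g u)" for u
    have \<phi>l: "linear_map_on s (*) H \<phi>"
      using fl gH unfolding linear_map_on_def \<phi>_def by (simp add: gl)
    have fin: "finite {b \<in> hom_basis. \<phi> b \<noteq> 0}"
    proof (rule finite_subset)
      show "{b \<in> hom_basis. \<phi> b \<noteq> 0} \<subseteq> (\<Union>\<alpha>\<in>{\<alpha>. \<exists>v\<in>weight_space P \<alpha>. f v \<noteq> 0}. hom_basis \<inter> wt (- \<alpha>))"
      proof
        fix b assume b: "b \<in> {b \<in> hom_basis. \<phi> b \<noteq> 0}"
        obtain \<gamma> where \<gamma>: "b \<in> wt \<gamma>" using basis_hom b by blast
        then have "g b \<in> weight_space P (- \<gamma>)" by (simp add: wsP)
        then have "- \<gamma> \<in> {\<alpha>. \<exists>v\<in>weight_space P \<alpha>. f v \<noteq> 0}" using b by (auto simp: \<phi>_def)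
        moreover have "b \<in> hom_basis \<inter> wt (- (- \<gamma>))" using b \<gamma> by simp
        ultimately show "b \<in> (\<Union>\<alpha>\<in>{\<alpha>. \<exists>v\<in>weight_space P \<alpha>. f v \<noteq> 0}. hom_basis \<inter> wt (- \<alpha>))" by blast
      qed
      show "finite (\<Union>\<alpha>\<in>{\<alpha>. \<exists>v\<in>weight_space P \<alpha>. f v \<noteq> 0}. hom_basis \<inter> wt (- \<alpha>))"
        using ff finite_basis_wt by blast
    qed
    \<comment> \<open>\<open>parity_sign\<close> is an involution and cancels the sign built into
      \<open>F\<close>.\<close>
    define w where "w = parity_sign (riesz \<phi>)"
    have wH: "w \<in> H" by (simp add: w_def riesz_H)
    have "F w = f"
    proof
      fix t show "F w t = f t"
      proof (cases "t \<in> carr P")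
        case True
        then obtain u where u: "u \<in> H" "t = g u" using carrE by blast
        have "F w t = form u (riesz \<phi>)" unfolding u(2) Fg[OF u(1)] by (simp add: w_def parity_sign_sq riesz_H)
        also have "\<dots> = \<phi> u" unfolding form_sym[of u] by (rule form_riesz[OF \<phi>l fin u(1)])
        also have "\<dots> = f t" by (simp add: \<phi>_def u(2))
        finally show ?thesis .
      qed (simp add: F_def fz)
    qed
    then show ?thesis using wH by blast
  qed
  have rd_decomp: "carr (restricted_dual P) = restricted_forms P"
  proof
    have fsub: "fs.subspace (restricted_forms P)"
    proof -
      have "finite {\<alpha>. \<exists>v\<in>weight_space P \<alpha>. f v + h v \<noteq> 0}"
        if "finite {\<alpha>. \<exists>v\<in>weight_space P \<alpha>. f v \<noteq> 0}" "finite {\<alpha>. \<exists>v\<in>weight_space P \<alpha>. h v \<noteq> 0}" for f h :: "'b \<Rightarrow> complex"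
        by (rule finite_subset[OF _ finite_UnI[OF that]]) auto
      moreover have "finite {\<alpha>. \<exists>v\<in>weight_space P \<alpha>. a * f v \<noteq> 0}"
        if "finite {\<alpha>. \<exists>v\<in>weight_space P \<alpha>. f v \<noteq> 0}" for f :: "'b \<Rightarrow> complex" and a
        by (rule finite_subset[OF _ that]) auto
      ultimately show ?thesis unfolding fs.subspace_def restricted_forms_def
        by (auto simp: linear_map_on_def fscale_def algebra_simps)
    qed
    show "carr (restricted_dual P) \<subseteq> restricted_forms P"
    proof
      fix f assume "f \<in> carr (restricted_dual P)"
      then obtain a b where "f = a + b" "a \<in> restricted_forms P" "b \<in> restricted_forms P"
        by (auto simp: carr_def restricted_dual_def)
      then show "f \<in> restricted_forms P" using fs.subspace_add[OF fsub] by simp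
    qed
    show "restricted_forms P \<subseteq> carr (restricted_dual P)"
    proof
      fix f assume "f \<in> restricted_forms P"
      then obtain w where wH: "w \<in> H" and w: "F w = f" using surj by blast
      obtain a b where ab: "a \<in> grade W 0" "b \<in> grade W 1" "w = a + b" using H_decomp[OF wH] .
      then have "f = F a + F b" using Flin(1)[of a b] grade_H w by auto
      moreover have "F a \<in> grade (restricted_dual P) 0" "F b \<in> grade (restricted_dual P) 1"
        using grade_F ab by blast+
      ultimately show "f \<in> carr (restricted_dual P)" unfolding carr_def[of "restricted_dual P"] by blast
    qed
  qed
  show ?thesis
    unfolding isomorphic_def
  proof (intro exI[of _ F] conjI allI ballI)
    show "linear_map_on s (scl (restricted_dual P)) H F"
      using Flin by (simp add: linear_map_on_def restricted_dual_def)
    show "F ` grade W p \<subseteq> grade (restricted_dual P) p" for p by (rule grade_F)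
    show "bij_betw F H (carr (restricted_dual P))"
      unfolding bij_betw_def
    proof
      show "inj_on F H"
      proof
        fix w w' assume w: "w \<in> H" "w' \<in> H" "F w = F w'"
        have "parity_sign w = parity_sign w'"
        proof (rule form_ext)
          fix b assume "b \<in> hom_basis"
          then have "form b (parity_sign w) = form b (parity_sign w')" using Fg[of b] w(3) by (metis basis_H)
          then show "form (parity_sign w) b = form (parity_sign w') b" by (simp add: form_sym)
        qed (use w in simp_all)
        then show "w = w'" using parity_sign_sq w by metis
      qed
      show "F ` H = carr (restricted_dual P)" unfolding rd_decomp using rest surj by blast
    qed
    show "F (act W x w) = act (restricted_dual P) x (F w)" if w: "w \<in> H" for x w
    proof
      fix t show "F (act W x w) t = act (restricted_dual P) x (F w) t"
      proof (cases "t \<in> carr P")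
        case False
        then show ?thesis by (simp add: F_def restricted_dual_def)
      next
        case True
        then obtain u where u: "u \<in> H" "t = g u" using carrE by blast
        have one: "(\<Sum>q\<in>{0, 1}. koszul (p * q) * F w (component P q (act P y (g u)))) = - form u (parity_sign (act W y w))"
          if y: "y \<in> fv_grade p" for p y
        proof -
          have F1: "F w (component P q (act P y (g u))) = form (cp q (dual_act y u)) (parity_sign w)" for q
            using u(1) by (simp add: act[symmetric] cpP dual_act_H Fg)
          have "(\<Sum>q\<in>{0, 1}. koszul (p * q) * F w (component P q (act P y (g u))))
             = form (\<Sum>q\<in>{0, 1}. s (koszul (p * q)) (cp q (dual_act y u))) (parity_sign w)"
            unfolding F1 using u(1) by (simp add: form_left dual_act_H)
          also have "\<dots> = - koszul p * form u (act W y (parity_sign w))"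
            unfolding dual_act_component[OF y u(1)] using u(1) w by (simp add: form_neg form_left form_transp)
          also have "\<dots> = - form u (parity_sign (act W y w))"
            unfolding parity_sign_act[OF y w] using w by (simp add: form_right)
          finally show ?thesis .
        qed
        have "act (restricted_dual P) x (F w) t
          = - (\<Sum>p\<in>{0, 1}. \<Sum>q\<in>{0, 1}. koszul (p * q) * F w (component P q (act P (fv_part p x) (g u))))"
          using True u(2) by (simp add: restricted_dual_def)
        also have "\<dots> = form u (parity_sign (act W (fv_part 0 x) w)) + form u (parity_sign (act W (fv_part 1 x) w))"
          unfolding one[OF fv_part_grade] by simp
        also have "\<dots> = form u (parity_sign (act W x w))"
        proof -
          have "act W x w = act W (fv_part 0 x) w + act W (fv_part 1 x) w"
            using act_lin_fv(1)[OF w, of "fv_part 0 x" "fv_part 1 x"] fv_part_sum[of x] by simp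
          then show ?thesis using w by (simp add: parity_sign_add form_right)
        qed
        finally show ?thesis unfolding u(2) Fg[OF u(1)] by simp
      qed
    qed
  qed
qed

end

section \<open>Classification\<close>

context charged_module
begin

text \<open>The vectors killed by almost all psi_(-n), with a bound depending on the vector, form a
  graded submodule: commuting with a generator shifts an index by a bounded amount at most.\<close>

lemma restricted_below:
  assumes "\<exists>v N. v \<in> H \<and> v \<noteq> 0 \<and> (\<forall>n\<ge>N. ps (- n) v = 0)" and w: "w \<in> H"
  obtains N where "\<And>n. n \<ge> N \<Longrightarrow> ps (- n) w = 0"
proof -
  let ?R = "{v \<in> H. \<exists>N. \<forall>n\<ge>N. ps (- n) v = 0}"
  have "graded_submodule FV W ?R"
  proof (rule graded_submoduleI)
    show "subspace ?R"
      unfolding subspace_def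
    proof (intro conjI ballI allI)
      fix x y assume "x \<in> ?R" "y \<in> ?R"
      then obtain N N' where N: "\<forall>n\<ge>N. ps (- n) x = 0" "\<forall>n\<ge>N'. ps (- n) y = 0" and H: "x \<in> H" "y \<in> H" by blast
      then have "\<forall>n\<ge>max N N'. ps (- n) (x + y) = 0" by (simp add: gact_lin)
      then show "x + y \<in> ?R" using H by (intro CollectI conjI exI[of _ "max N N'"]) simp_all
    next
      fix c x assume "x \<in> ?R"
      then show "s c x \<in> ?R" by (auto simp: gact_lin)
    qed simp
    fix g v assume v: "v \<in> ?R"
    then obtain N where N: "\<And>n. n \<ge> N \<Longrightarrow> ps (- n) v = 0" and vH: "v \<in> H" by blast
    have "\<exists>N. \<forall>n\<ge>N. ps (- n) (gact W g v) = 0"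
    proof (cases g)
      case (L m)
      have "ps (- n) (lo m v) = 0" if "n \<ge> max N (N + m)" for n
      proof -
        have "ps (m - n) v = 0" using N[of "n - m"] that by simp
        then show ?thesis using lo_ps[OF vH, of m "- n"] N[of n] that by simp
      qed
      then show ?thesis using L by blast
    next
      case (Psi m)
      have "ps (- n) (ps m v) = 0" if "n \<ge> max N (m + 1)" for n
        using ps_anti[OF vH, of "- n" m] N[of n] that by simp
      then show ?thesis using Psi by blast
    next
      case C
      have "ps (- n) (co v) = 0" if "n \<ge> N" for n
        using co_comm[OF vH, of "Psi (- n)"] N[OF that] by simp
      then show ?thesis using C by blast
    next
      case Z
      have "ps (- n) (zo v) = 0" if "n \<ge> N" for n
        using zo_comm[OF vH, of "Psi (- n)"] N[OF that] by simp
      then show ?thesis using Z by blast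
    qed
    then show "gact W g v \<in> ?R" using vH by simp
    obtain a b where ab: "a \<in> grade W 0" "b \<in> grade W 1" "v = a + b"
      "\<And>g. g \<in> (\<lambda>n. Psi (- n)) ` {N..} \<Longrightarrow> gact W g a = 0" "\<And>g. g \<in> (\<lambda>n. Psi (- n)) ` {N..} \<Longrightarrow> gact W g b = 0"
      using kernel_decomp[OF vH, of "(\<lambda>n. Psi (- n)) ` {N..}"] N by auto
    then have "a \<in> ?R" "b \<in> ?R" using grade_H by auto
    then show "\<exists>a\<in>?R \<inter> grade W 0. \<exists>b\<in>?R \<inter> grade W 1. v = a + b" using ab by blast
  qed auto
  moreover obtain v where "v \<in> ?R" "v \<noteq> 0" using assms(1) by blast
  ultimately have "?R = H" by (rule submodule_full)
  then show thesis using that w by blast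
qed

text \<open>On a weight space, finitely many vectors decide, so a common bound \<open>N\<close>
  makes all psi_(-n) with n \<ge> N vanish on it. Then a value of psi_n on a weight vector that
  falls into this weight space is killed by psi_(-n) and hence is zero by
  \<open>ps_proj_nonzero\<close>. So \<open>u\<close> is orthogonal to the image of psi_n, that is,
  the transpose of psi_n kills \<open>u\<close>.\<close>

lemma dual_restricted:
  assumes B: "\<exists>v N. v \<in> H \<and> v \<noteq> 0 \<and> (\<forall>n\<ge>N. ps (- n) v = 0)"
  shows "\<exists>u N. u \<in> H \<and> u \<noteq> 0 \<and> (\<forall>n\<ge>N. gact dual (Psi n) u = 0)"
proof -
  obtain u \<alpha> p where u: "u \<in> wt \<alpha>" "u \<in> grade W p" "u \<noteq> 0" using exists_weight_vector by metis
  have uH: "u \<in> H" using u(1) by (rule wt_H)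
  obtain A where A: "finite A" "wt \<alpha> \<subseteq> span A" by (rule wt_finite)
  obtain C where C: "C \<subseteq> wt \<alpha>" "independent C" "wt \<alpha> \<subseteq> span C" using maximal_independent_subset by metis
  have finC: "finite C" using independent_span_bound[OF A(1) C(2)] A(2) C(1) by blast
  have "\<forall>c\<in>C. \<exists>N. \<forall>n\<ge>N. ps (- n) c = 0"
  proof
    fix c assume "c \<in> C"
    then have "c \<in> H" using C(1) wt_H by blast
    then show "\<exists>N. \<forall>n\<ge>N. ps (- n) c = 0" using restricted_below[OF B] by blast
  qed
  then obtain f where f: "\<And>c n. c \<in> C \<Longrightarrow> n \<ge> f c \<Longrightarrow> ps (- n) c = 0" by metis
  define N where "N = Max (insert 1 (f ` C))"
  have N: "N \<ge> 1" "\<And>c. c \<in> C \<Longrightarrow> f c \<le> N" unfolding N_def using finC by auto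
  have kill: "ps (- n) w = 0" if "n \<ge> N" "w \<in> wt \<alpha>" for n w
  proof -
    have c: "ps (- n) c \<in> {0}" if "c \<in> C" for c using f[OF that] N(2)[OF that] \<open>n \<ge> N\<close> by simp
    have "C \<subseteq> H" using C(1) wt_H by blast
    then have "ps (- n) w \<in> {0}"
      by (rule gact_span[OF subspace_single_0 _ c subsetD[OF C(3) that(2)]])
    then show ?thesis by simp
  qed
  have "gact dual (Psi n) u = 0" if n: "n \<ge> N" for n
  proof -
    have "form u (ps n v) = 0" if v: "v \<in> H" for v
    proof -
      obtain A x where A: "finite A" "\<And>\<gamma>. x \<gamma> \<in> wt \<gamma>" "v = (\<Sum>\<gamma>\<in>A. x \<gamma>)" using wt_decomp[OF v] by metis
      have xH: "x \<gamma> \<in> H" for \<gamma> using A(2) wt_H by blast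
      have 0: "form u (ps n (x \<gamma>)) = 0" for \<gamma>
      proof (cases "\<gamma> - of_int n = \<alpha>")
        case True
        let ?w = "ps n (x \<gamma>)"
        have "?w \<in> wt \<alpha>" using ps_wt[OF A(2), of n \<gamma>] True by simp
        then have "ps (- n) ?w = 0" by (rule kill[OF n])
        \<comment> \<open>The bound is at least 1, so n \<noteq> 0 as the idempotent argument
          requires.\<close>
        then have "?w = 0" using ps_proj_nonzero[OF xH[of \<gamma>], of n] n N(1) by auto
        then show ?thesis by simp
      next
        case False
        then show ?thesis using form_wt[OF u(1) ps_wt[OF A(2), of n \<gamma>]] by auto
      qed
      have "form u (ps n v) = (\<Sum>\<gamma>\<in>A. form u (ps n (x \<gamma>)))"
        unfolding A(3) using xH
        by (intro linear_map_on_sum[OF vector_space_axioms vector_space_complex subspace_H, of "\<lambda>v. form u (ps n v)"])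
           (simp_all add: linear_map_on_def gact_lin form_right)
      then show ?thesis using 0 by simp
    qed
    then have "transp (basis (Psi n)) u = 0"
      by (intro transp_eqI uH) (simp_all add: gact_def)
    then show ?thesis using dual_act_hom[OF basis_grade u(2), of "Psi n"] by (simp add: gact_def dual_def)
  qed
  then show ?thesis using uH u(3) by blast
qed

end

theorem theorem5p4:
  fixes W :: "('w::ab_group_add) smod"
  assumes "simple_module FV W"
    and "harish_chandra FV W"
  shows
    "(\<exists>V :: 'w smod. simple_module Vir V \<and> harish_chandra Vir V \<and>
        isomorphic FV W (inflate V)) \<or>
     (\<exists>(l::complex) (V :: 'w smod). l \<noteq> 0 \<and> simple_module Vir V \<and> highest_weight Vir V \<and>
        isomorphic FV W (tensor_product (twist l fock) (inflate V))) \<or>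
     (\<exists>(l::complex) (V :: 'w smod). l \<noteq> 0 \<and> simple_module Vir V \<and> highest_weight Vir V \<and>
        isomorphic FV W (restricted_dual (tensor_product (twist l fock) (inflate V))))"
proof -
  have super: "super_module FV W" using assms(1) by (simp add: simple_module_def)
  interpret W: hc_module W
    by unfold_locales (fact super, fact assms(1), fact assms(2))
  obtain \<zeta> where "\<forall>v\<in>carr W. gact W Z v = scl W \<zeta> v"
    using W.zo_scalar ..
  then have \<zeta>: "gact W Z v = scl W \<zeta> v" if "v \<in> carr W" for v using that by blast
  show ?thesis
  proof (cases "\<zeta> = 0")
    case True
    then have z: "gact W Z v = 0" if "v \<in> carr W" for v using \<zeta>[OF that] by simp
    have psi: "gact W (Psi n) v = 0" if "v \<in> carr W" for n v
      using z that by (rule W.z_zero_imp_psi_zero)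
    have act: "act W x v = act W (restrict_keys vir_gens x) v" if v: "v \<in> carr W" for x v
    proof -
      have "gen_act (scl W) (gact W) x v = gen_act (scl W) (gact W) (restrict_keys vir_gens x) v"
        unfolding gen_act_def
      proof (rule sum.mono_neutral_cong_right)
        show "Poly_Mapping.keys (restrict_keys vir_gens x) \<subseteq> Poly_Mapping.keys x"
          by (auto simp: in_keys_iff lookup_restrict_keys split: if_splits)
        show "\<forall>g\<in>Poly_Mapping.keys x - Poly_Mapping.keys (restrict_keys vir_gens x).
          scl W (Poly_Mapping.lookup x g) (gact W g v) = 0"
        proof
          fix g assume "g \<in> Poly_Mapping.keys x - Poly_Mapping.keys (restrict_keys vir_gens x)"
          then show "scl W (Poly_Mapping.lookup x g) (gact W g v) = 0"
            using psi[OF v] z[OF v] by (cases g) (auto simp: in_keys_iff lookup_restrict_keys vir_gens_def)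
        qed
      qed (auto simp: in_keys_iff lookup_restrict_keys split: if_splits)
      then show ?thesis using W.act_gens[OF v] by simp
    qed
    \<comment> \<open>As F acts by zero, the Virasoro submodules are submodules for the whole
      algebra, and \<open>W\<close> itself serves as \<open>V\<close>.\<close>
    have sub: "graded_submodule FV W N" if N: "graded_submodule Vir W N" for N
      unfolding graded_submodule_def
    proof (intro conjI ballI)
      show "W.subspace N" "N = {u + v |u v. u \<in> N \<inter> grade W 0 \<and> v \<in> N \<inter> grade W 1}"
        using N unfolding graded_submodule_def by blast+
      fix x v assume v: "v \<in> N"
      have "v \<in> carr W"
      proof -
        have "v \<in> {u + v |u v. u \<in> N \<inter> grade W 0 \<and> v \<in> N \<inter> grade W 1}"
          using N v unfolding graded_submodule_def by blast
        then show ?thesis unfolding carr_def by blast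
      qed
      moreover have "restrict_keys vir_gens x \<in> Vir"
        by (auto simp: Vir_def in_keys_iff lookup_restrict_keys split: if_splits)
      ultimately show "act W x v \<in> N" using N v act unfolding graded_submodule_def by metis
    qed
    have "simple_module Vir W"
      using assms(1) sub super_module_sub[OF super] unfolding simple_module_def by blast
    moreover have "harish_chandra Vir W"
      using assms(2) super_module_sub[OF super] unfolding harish_chandra_def weight_module_def by blast
    moreover have "isomorphic FV W (inflate W)"
      unfolding isomorphic_def carr_inflate
    proof (intro exI[of _ id] conjI allI ballI)
      show "linear_map_on (scl W) (scl (inflate W)) (carr W) id" by (simp add: linear_map_on_def inflate_def)
      show "id ` grade W p \<subseteq> grade (inflate W) p" for p by (simp add: inflate_def)
      show "id (act W x v) = act (inflate W) x (id v)" if "v \<in> carr W" for x v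
        using act[OF that] by (simp add: inflate_def)
    qed simp
    ultimately show ?thesis by blast
  next
    case False
    interpret W: charged_module W \<zeta>
    proof unfold_locales
      show "gact W Z v = scl W \<zeta> v" if "v \<in> carr W" for v by (rule \<zeta>[OF that])
    qed (rule False)
    from W.psi_dichotomy show ?thesis
    proof
      assume up: "\<exists>v N. v \<in> carr W \<and> v \<noteq> 0 \<and> (\<forall>n\<ge>N. gact W (Psi n) v = 0)"
      interpret W: restricted_module W \<zeta> "csqrt \<zeta>"
        by unfold_locales (simp, rule up)
      have "isomorphic FV W (tensor_product (twist (csqrt \<zeta>) fock) (inflate W.vacuum_module))"
        unfolding isomorphic_def using W.to_tensor_iso by (intro exI[of _ W.to_tensor]) auto
      then show ?thesis
        using W.simple_vacuum W.highest_weight_vacuum W.lam0 by blast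
    next
      assume down: "\<exists>v N. v \<in> carr W \<and> v \<noteq> 0 \<and> (\<forall>n\<ge>N. gact W (Psi (- n)) v = 0)"
      let ?D = "W.dual"
      \<comment> \<open>Contragredience changes the sign of z, so the twist parameter is a square
        root of -\<zeta>.\<close>
      have zD: "gact ?D Z v = scl ?D (- \<zeta>) v" if v: "v \<in> carr ?D" for v
      proof -
        have vH: "v \<in> carr W" using v by (simp add: W.carr_dual)
        have hom: "W.dual_act (basis Z) a = scl W (- \<zeta>) a" if a: "a \<in> grade W q" for a q
        proof -
          have aH: "a \<in> carr W" using a by (rule W.grade_H)
          have "W.transp (basis Z) a = scl W \<zeta> a"
            using aH \<zeta> by (intro W.transp_eqI) (simp_all add: gact_def W.form_left W.form_right)
          then show ?thesis using W.dual_act_hom[OF W.basis_grade a, of Z] by simp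
        qed
        obtain a b where ab: "a \<in> grade W 0" "b \<in> grade W 1" "v = a + b" using W.H_decomp[OF vH] .
        then have "a \<in> carr W" "b \<in> carr W" using W.grade_H by blast+
        then have "W.dual_act (basis Z) v = scl W (- \<zeta>) v"
          unfolding ab(3) using hom[OF ab(1)] hom[OF ab(2)] by (simp add: W.dual_act_lin_arg W.scale_right_distrib)
        then show ?thesis by (simp add: gact_def W.dual_def)
      qed
      have res: "\<exists>v N. v \<in> carr ?D \<and> v \<noteq> 0 \<and> (\<forall>n\<ge>N. gact ?D (Psi n) v = 0)"
        using W.dual_restricted[OF down] by (simp add: W.carr_dual)
      interpret D: restricted_module ?D "- \<zeta>" "csqrt (- \<zeta>)"
      proof unfold_locales
        show "super_module FV ?D" by (rule W.super_module_dual)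
        show "simple_module FV ?D" by (rule W.simple_dual)
        show "harish_chandra FV ?D" by (rule W.harish_chandra_dual)
        show "- \<zeta> \<noteq> 0" using False by simp
        show "gact ?D Z v = scl ?D (- \<zeta>) v" if "v \<in> carr ?D" for v by (rule zD[OF that])
        show "(csqrt (- \<zeta>))\<^sup>2 = - \<zeta>" by simp
        show "\<exists>v N. v \<in> carr ?D \<and> v \<noteq> 0 \<and> (\<forall>n\<ge>N. gact ?D (Psi n) v = 0)" by (rule res)
      qed
      have sc: "scl ?D = scl W" "grade ?D = grade W" "act ?D = W.dual_act" by (simp_all add: W.dual_def)
      have "isomorphic FV W (restricted_dual (tensor_product (twist (csqrt (- \<zeta>)) fock) (inflate D.vacuum_module)))"
        by (rule W.isomorphic_restricted_dual[of D.to_tensor])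
           (use D.to_tensor_iso in \<open>simp_all add: W.carr_dual sc\<close>)
      then show ?thesis
        using D.simple_vacuum D.highest_weight_vacuum D.lam0 by blast
    qed
  qed
qed

end
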